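(* Let $X$ be a compact Hausdorff space, $\sigma\colon X\to X$ a homeomorphism, and let $A=\varinjlim_n C(X,M_{2^n})$ be the AH-algebra model of the dynamical system $(X,\sigma)$, with connecting maps $\phi_n(f)=\begin{pmatrix}f&0\\0&f\circ\sigma\end{pmatrix}$. Let $b\colon\varprojlim_n\{0,1\}^n\times X\to\{0,1\}^{\mathbb N}\times X$ be the bijection $$b\big(((t_1,\dots,t_n),x_n)_n\big)=\big((t_i)_{i\in\mathbb N},x_1\big).$$ Then $b$ is a homeomorphism. Moreover, the canonical groupoid model for $A$ (the Weyl groupoid of its canonical diagonal $C\subseteq A$) is isomorphic to a transformation groupoid $G_{2^\infty}\ltimes(\{0,1\}^{\mathbb N}\times X)$, where $G_{2^\infty}$ is the canonical groupoid model for the CAR algebra $M_{2^\infty}$, acting on $\{0,1\}^{\mathbb N}\times X$ by the conjugation action of $G_{2^\infty}$ on $\widehat C\cong\varprojlim_n\{0,1\}^n\times X$ transported along $b$.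
   Context: $\mathbb N=\{1,2,\dots\}$. The system is $C(X)\xrightarrow{\phi_0}C(X,M_2)\xrightarrow{\phi_1}\cdots\to C(X,M_{2^n})\xrightarrow{\phi_n}C(X,M_{2^{n+1}})\to\cdots$. Write $A_n=C(X,M_{2^n})$, let $C_n\subseteq A_n$ be the functions with diagonal values, $A=\varinjlim A_n$, $C=\varinjlim C_n\subseteq A$. Index the rows and columns of $M_{2^n}$ by $\{0,1\}^n$ so that in $\phi_n(f)$ the position of index $p$ in the block $f$ is labelled $p0$ and the position of index $p$ in the block $f\circ\sigma$ is labelled $p1$. Then $\widehat{C_n}\cong\{0,1\}^n\times X$ and the dual maps are $\hat\phi_n((t_1,\dots,t_{n+1}),x)=((t_1,\dots,t_n),\sigma^{t_{n+1}}(x))$. The projective limit $\widehat C\cong\varprojlim_n\{0,1\}^n\times X$ (over $n\ge1$, along the $\hat\phi_n$, with inverse limit topology) consists of sequences $(t_{[1,n]},x_n)_{n\ge1}$ with $t\in\{0,1\}^{\mathbb N}$ and $x_n=\sigma^{t_{n+1}}(x_{n+1})$. The inverse of $b$ is $b^{-1}(t,x)=(t_{[1,n]},\sigma^{-\sum_{i=2}^nt_i}(x))_n$. $G_{2^\infty}$ is the tail-equivalence groupoid on $\{0,1\}^{\mathbb N}$: pairs $(t,s)$ with $t_{[m,\infty)}=s_{[m,\infty)}$ for some $m$, $(t,s)(s,u)=(t,u)$, and base of open sets $Z_{p,q}=\{(t,s):t_{[1,n]}=p,s_{[1,n]}=q,t_{[n+1,\infty)}=s_{[n+1,\infty)}\}$,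 $p,q\in\{0,1\}^n$. It acts on $\widehat C$ with anchor map $(t_{[1,n]},x_n)_n\mapsto t$ by $((t,s)\cdot\chi)(c)=\chi(e_{p,q}^*c\,e_{p,q})$ for $c\in C$, $\chi\in\widehat C$ with anchor $s$, and $(t,s)\in Z_{p,q}$, where $e_{p,q}\in 1\otimes M_{2^n}\subseteq A_n\subseteq A$ is the matrix unit. For an action of an étale groupoid $\mathcal G$ on a space $Y$ with anchor map $\rho$, the transformation groupoid $\mathcal G\ltimes Y$ is $\{(\gamma,y):s(\gamma)=\rho(y)\}$ with subspace topology, $r(\gamma,y)=(r(\gamma),\gamma\cdot y)$, $s(\gamma,y)=(s(\gamma),y)$, $(\eta,\gamma\cdot y)(\gamma,y)=(\eta\gamma,y)$. The Weyl groupoid of the Cartan inclusion $C\subseteq A$ is Renault's groupoid of germs of the partial homeomorphisms of $\widehat C$ induced by normalisers of $C$ in $A$. *)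

theory Defs
  imports "HOL-Analysis.Analysis"
begin

section \<open>Sequential inductive limits of C*-algebras\<close>

record 'a cstar =
  cs_carrier :: "'a set"
  cs_zero :: 'a
  cs_add :: "'a \<Rightarrow> 'a \<Rightarrow> 'a"
  cs_scale :: "complex \<Rightarrow> 'a \<Rightarrow> 'a"
  cs_mult :: "'a \<Rightarrow> 'a \<Rightarrow> 'a"
  cs_star :: "'a \<Rightarrow> 'a"
  cs_norm :: "'a \<Rightarrow> real"

definition cs_diff :: "('a, 'm) cstar_scheme \<Rightarrow> 'a \<Rightarrow> 'a \<Rightarrow> 'a" where
  "cs_diff A a b = cs_add A a (cs_scale A (-1) b)"

text \<open>\<open>connect \<phi> n k\<close> is the connecting map from stage \<open>n\<close> to stage \<open>n + k\<close>.\<close>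

primrec connect :: "(nat \<Rightarrow> 'a \<Rightarrow> 'a) \<Rightarrow> nat \<Rightarrow> nat \<Rightarrow> 'a \<Rightarrow> 'a" where
  "connect \<phi> n 0 a = a"
| "connect \<phi> n (Suc k) a = \<phi> (n + k) (connect \<phi> n k a)"

text \<open>
  The C*-inductive limit is the closure, inside the product of the stages modulo the
  null sequences, of the set of eventually coherent sequences. A sequence belongs to
  (the preimage of) that closure iff it is asymptotically coherent in the sense of
  \<open>limit_seqs\<close>. Elements of the limit are thus classes of such sequences
  modulo null sequences, and all operations are computed on representatives.
\<close>

definition limit_seqs :: "(nat \<Rightarrow> 'a cstar) \<Rightarrow> (nat \<Rightarrow> 'a \<Rightarrow> 'a) \<Rightarrow> (nat \<Rightarrow> 'a) set" where
  "limit_seqs A \<phi> = {a. (\<forall>n. a n \<in> cs_carrier (A n)) \<and>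
     (\<forall>\<epsilon>>0. \<exists>N. \<forall>n\<ge>N. \<forall>k.
        cs_norm (A (n + k)) (cs_diff (A (n + k)) (a (n + k)) (connect \<phi> n k (a n))) < \<epsilon>)}"

definition limit_class ::
  "(nat \<Rightarrow> 'a cstar) \<Rightarrow> (nat \<Rightarrow> 'a \<Rightarrow> 'a) \<Rightarrow> (nat \<Rightarrow> 'a) \<Rightarrow> (nat \<Rightarrow> 'a) set" where
  "limit_class A \<phi> a = {b \<in> limit_seqs A \<phi>.
     (\<lambda>n. cs_norm (A n) (cs_diff (A n) (a n) (b n))) \<longlonglongrightarrow> 0}"

definition limit_rep :: "(nat \<Rightarrow> 'a) set \<Rightarrow> nat \<Rightarrow> 'a" where
  "limit_rep U = (SOME a. a \<in> U)"

definition cstar_limit ::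
  "(nat \<Rightarrow> 'a cstar) \<Rightarrow> (nat \<Rightarrow> 'a \<Rightarrow> 'a) \<Rightarrow> ((nat \<Rightarrow> 'a) set) cstar" where
  "cstar_limit A \<phi> = \<lparr>
     cs_carrier = limit_class A \<phi> ` limit_seqs A \<phi>,
     cs_zero = limit_class A \<phi> (\<lambda>n. cs_zero (A n)),
     cs_add = (\<lambda>U V. limit_class A \<phi> (\<lambda>n. cs_add (A n) (limit_rep U n) (limit_rep V n))),
     cs_scale = (\<lambda>c U. limit_class A \<phi> (\<lambda>n. cs_scale (A n) c (limit_rep U n))),
     cs_mult = (\<lambda>U V. limit_class A \<phi> (\<lambda>n. cs_mult (A n) (limit_rep U n) (limit_rep V n))),
     cs_star = (\<lambda>U. limit_class A \<phi> (\<lambda>n. cs_star (A n) (limit_rep U n))),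
     cs_norm = (\<lambda>U. lim (\<lambda>n. cs_norm (A n) (limit_rep U n)))\<rparr>"

text \<open>The canonical map from stage \<open>n\<close> into the limit.\<close>

definition limit_map ::
  "(nat \<Rightarrow> 'a cstar) \<Rightarrow> (nat \<Rightarrow> 'a \<Rightarrow> 'a) \<Rightarrow> nat \<Rightarrow> 'a \<Rightarrow> (nat \<Rightarrow> 'a) set" where
  "limit_map A \<phi> n a =
     limit_class A \<phi> (\<lambda>m. if m < n then cs_zero (A m) else connect \<phi> n (m - n) a)"

section \<open>Spectrum, normalisers and the Weyl groupoid\<close>

text \<open>
  Here \<open>C\<close> is a commutative C*-subalgebra of \<open>A\<close>. Its characters are the nonzero
  *-homomorphisms to the complex numbers, with the topology of pointwise convergence.
\<close>

definition characters :: "('a, 'm) cstar_scheme \<Rightarrow> 'a set \<Rightarrow> ('a \<Rightarrow> complex) set" where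
  "characters A C = {\<omega> \<in> extensional C.
     (\<forall>c\<in>C. \<forall>d\<in>C. \<omega> (cs_add A c d) = \<omega> c + \<omega> d) \<and>
     (\<forall>k. \<forall>c\<in>C. \<omega> (cs_scale A k c) = k * \<omega> c) \<and>
     (\<forall>c\<in>C. \<forall>d\<in>C. \<omega> (cs_mult A c d) = \<omega> c * \<omega> d) \<and>
     (\<forall>c\<in>C. \<omega> (cs_star A c) = cnj (\<omega> c)) \<and>
     (\<exists>c\<in>C. \<omega> c \<noteq> 0)}"

definition spectrum_top :: "('a, 'm) cstar_scheme \<Rightarrow> 'a set \<Rightarrow> ('a \<Rightarrow> complex) topology" where
  "spectrum_top A C = subtopology (product_topology (\<lambda>_. euclidean) C) (characters A C)"

text \<open>\<open>conj_by A n c\<close> is \<open>n* c n\<close>.\<close>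

definition conj_by :: "('a, 'm) cstar_scheme \<Rightarrow> 'a \<Rightarrow> 'a \<Rightarrow> 'a" where
  "conj_by A n c = cs_mult A (cs_mult A (cs_star A n) c) n"

definition normalisers :: "('a, 'm) cstar_scheme \<Rightarrow> 'a set \<Rightarrow> 'a set" where
  "normalisers A C = {n \<in> cs_carrier A.
     \<forall>c\<in>C. conj_by A n c \<in> C \<and> conj_by A (cs_star A n) c \<in> C}"

definition weyl_dom :: "('a, 'm) cstar_scheme \<Rightarrow> 'a set \<Rightarrow> 'a \<Rightarrow> ('a \<Rightarrow> complex) set" where
  "weyl_dom A C n = {\<omega> \<in> characters A C. Re (\<omega> (cs_mult A (cs_star A n) n)) > 0}"

text \<open>
  The partial homeomorphism \<open>\<alpha>\<^sub>n\<close> of a normaliser \<open>n\<close> is determined by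
  \<open>\<omega> (n* c n) = (\<alpha>\<^sub>n \<omega>) c \<cdot> \<omega> (n* n)\<close>; it is only meaningful on \<open>weyl_dom A C n\<close>.
\<close>

definition weyl_map ::
  "('a, 'm) cstar_scheme \<Rightarrow> 'a set \<Rightarrow> 'a \<Rightarrow> ('a \<Rightarrow> complex) \<Rightarrow> ('a \<Rightarrow> complex)" where
  "weyl_map A C n \<omega> =
     restrict (\<lambda>c. \<omega> (conj_by A n c) / \<omega> (cs_mult A (cs_star A n) n)) C"

text \<open>Units are identified with the corresponding arrows, so range and source are arrows.
  The product \<open>gp_mult G g h\<close> is meaningful only if \<open>gp_src G g = gp_rng G h\<close>.\<close>

record 'g top_groupoid =
  gp_top :: "'g topology"
  gp_rng :: "'g \<Rightarrow> 'g"
  gp_src :: "'g \<Rightarrow> 'g"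
  gp_mult :: "'g \<Rightarrow> 'g \<Rightarrow> 'g"

definition top_groupoid_iso ::
  "('g, 'm) top_groupoid_scheme \<Rightarrow> ('h, 'k) top_groupoid_scheme \<Rightarrow> ('g \<Rightarrow> 'h) \<Rightarrow> bool" where
  "top_groupoid_iso G H \<Phi> \<longleftrightarrow>
     homeomorphic_map (gp_top G) (gp_top H) \<Phi> \<and>
     (\<forall>g\<in>topspace (gp_top G).
        \<Phi> (gp_rng G g) = gp_rng H (\<Phi> g) \<and> \<Phi> (gp_src G g) = gp_src H (\<Phi> g)) \<and>
     (\<forall>g\<in>topspace (gp_top G). \<forall>h\<in>topspace (gp_top G).
        gp_src G g = gp_rng G h \<longrightarrow> \<Phi> (gp_mult G g h) = gp_mult H (\<Phi> g) (\<Phi> h))"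

definition top_groupoids_isomorphic ::
  "('g, 'm) top_groupoid_scheme \<Rightarrow> ('h, 'k) top_groupoid_scheme \<Rightarrow> bool" where
  "top_groupoids_isomorphic G H \<longleftrightarrow> (\<exists>\<Phi>. top_groupoid_iso G H \<Phi>)"

text \<open>
  The germ at \<open>y\<close> of a map defined near \<open>y\<close>: the base point, together with all functions
  agreeing with the map on a neighbourhood of \<open>y\<close>. Since domains are open, values of the
  (total) HOL function outside the domain play no role.
\<close>

type_synonym 'y germ = "'y \<times> ('y \<Rightarrow> 'y) set"

definition germ :: "'y topology \<Rightarrow> ('y \<Rightarrow> 'y) \<Rightarrow> 'y \<Rightarrow> 'y germ" where
  "germ Y f y = (y, {g. \<exists>U. openin Y U \<and> y \<in> U \<and> (\<forall>z\<in>U. f z = g z)})"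

definition germ_rep :: "'y germ \<Rightarrow> 'y \<Rightarrow> 'y" where
  "germ_rep g = (SOME f. f \<in> snd g)"

text \<open>The groupoid of germs of a family of partial homeomorphisms, each given as a pair of
  its open domain and its map.\<close>

definition germ_groupoid :: "'y topology \<Rightarrow> ('y set \<times> ('y \<Rightarrow> 'y)) set \<Rightarrow> ('y germ) top_groupoid" where
  "germ_groupoid Y P = \<lparr>
     gp_top = topology_generated_by {germ Y f ` U | D f U. (D, f) \<in> P \<and> openin Y U \<and> U \<subseteq> D},
     gp_rng = (\<lambda>g. germ Y id (germ_rep g (fst g))),
     gp_src = (\<lambda>g. germ Y id (fst g)),
     gp_mult = (\<lambda>g h. germ Y (germ_rep g \<circ> germ_rep h) (fst h))\<rparr>"

definition weyl_groupoid :: "('a, 'm) cstar_scheme \<Rightarrow> 'a set \<Rightarrow> (('a \<Rightarrow> complex) germ) top_groupoid" where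
  "weyl_groupoid A C = germ_groupoid (spectrum_top A C)
     ((\<lambda>n. (weyl_dom A C n, weyl_map A C n)) ` normalisers A C)"

section \<open>Groupoid actions and transformation groupoids\<close>

definition action_pairs ::
  "('g, 'm) top_groupoid_scheme \<Rightarrow> 'y topology \<Rightarrow> ('y \<Rightarrow> 'g) \<Rightarrow> ('g \<times> 'y) set" where
  "action_pairs G Y \<rho> =
     {(\<gamma>, y). \<gamma> \<in> topspace (gp_top G) \<and> y \<in> topspace Y \<and> gp_src G \<gamma> = \<rho> y}"

definition groupoid_action ::
  "('g, 'm) top_groupoid_scheme \<Rightarrow> 'y topology \<Rightarrow> ('y \<Rightarrow> 'g) \<Rightarrow> ('g \<Rightarrow> 'y \<Rightarrow> 'y) \<Rightarrow> bool" where
  "groupoid_action G Y \<rho> act \<longleftrightarrow>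
     continuous_map Y (gp_top G) \<rho> \<and>
     (\<forall>y\<in>topspace Y. gp_src G (\<rho> y) = \<rho> y \<and> gp_rng G (\<rho> y) = \<rho> y) \<and>
     continuous_map (subtopology (prod_topology (gp_top G) Y) (action_pairs G Y \<rho>)) Y
       (\<lambda>(\<gamma>, y). act \<gamma> y) \<and>
     (\<forall>(\<gamma>, y)\<in>action_pairs G Y \<rho>. \<rho> (act \<gamma> y) = gp_rng G \<gamma>) \<and>
     (\<forall>y\<in>topspace Y. act (\<rho> y) y = y) \<and>
     (\<forall>(\<gamma>, y)\<in>action_pairs G Y \<rho>. \<forall>\<eta>\<in>topspace (gp_top G).
        gp_src G \<eta> = gp_rng G \<gamma> \<longrightarrow> act (gp_mult G \<eta> \<gamma>) y = act \<eta> (act \<gamma> y))"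

definition transformation_groupoid ::
  "('g, 'm) top_groupoid_scheme \<Rightarrow> 'y topology \<Rightarrow> ('y \<Rightarrow> 'g) \<Rightarrow> ('g \<Rightarrow> 'y \<Rightarrow> 'y) \<Rightarrow>
     ('g \<times> 'y) top_groupoid" where
  "transformation_groupoid G Y \<rho> act = \<lparr>
     gp_top = subtopology (prod_topology (gp_top G) Y) (action_pairs G Y \<rho>),
     gp_rng = (\<lambda>(\<gamma>, y). (gp_rng G \<gamma>, act \<gamma> y)),
     gp_src = (\<lambda>(\<gamma>, y). (gp_src G \<gamma>, y)),
     gp_mult = (\<lambda>(\<eta>, z) (\<gamma>, y). (gp_mult G \<eta> \<gamma>, y))\<rparr>"

section \<open>The tail-equivalence groupoid\<close>

text \<open>
  Points of \<open>{0,1}\<^sup>\<nat>\<close> are functions \<open>nat \<Rightarrow> bool\<close> and words are lists of booleans, both indexed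
  from 0: the entry written \<open>t\<^sub>i\<close> with \<open>i \<ge> 1\<close> is \<open>t (i - 1)\<close>. So \<open>prefix_of n t\<close> is \<open>t\<^bsub>[1,n]\<^esub>\<close>.
\<close>

definition cantor :: "(nat \<Rightarrow> bool) topology" where
  "cantor = product_topology (\<lambda>_. discrete_topology UNIV) UNIV"

definition prefix_of :: "nat \<Rightarrow> (nat \<Rightarrow> bool) \<Rightarrow> bool list" where
  "prefix_of n t = map t [0..<n]"

definition tail_cyl :: "bool list \<Rightarrow> bool list \<Rightarrow> ((nat \<Rightarrow> bool) \<times> (nat \<Rightarrow> bool)) set" where
  "tail_cyl p q = {(t, s). prefix_of (length p) t = p \<and> prefix_of (length p) s = q \<and>
     (\<forall>i\<ge>length p. t i = s i)}"

definition tail_groupoid :: "((nat \<Rightarrow> bool) \<times> (nat \<Rightarrow> bool)) top_groupoid" where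
  "tail_groupoid = \<lparr>
     gp_top = topology_generated_by {tail_cyl p q | p q. length p = length q},
     gp_rng = (\<lambda>(t, s). (t, t)),
     gp_src = (\<lambda>(t, s). (s, s)),
     gp_mult = (\<lambda>(t, s) (s', u). (t, u))\<rparr>"

section \<open>The AH-algebra of a dynamical system\<close>

text \<open>
  Matrices over \<open>{0,1}\<^sup>n\<close> are functions of two words vanishing unless both words have length \<open>n\<close>;
  functions on \<open>X\<close> vanish outside \<open>topspace X\<close>.
\<close>

type_synonym 'x fmat = "'x \<Rightarrow> bool list \<Rightarrow> bool list \<Rightarrow> complex"

definition words :: "nat \<Rightarrow> bool list set" where
  "words n = {p. length p = n}"

text \<open>Operator norm on \<open>\<ell>\<^sup>2({0,1}\<^sup>n)\<close>.\<close>

definition mat_norm :: "nat \<Rightarrow> (bool list \<Rightarrow> bool list \<Rightarrow> complex) \<Rightarrow> real" where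
  "mat_norm n m = Sup {sqrt (\<Sum>p\<in>words n. (cmod (\<Sum>q\<in>words n. m p q * v q))\<^sup>2) | v.
     (\<Sum>q\<in>words n. (cmod (v q))\<^sup>2) \<le> 1}"

definition AH_stage :: "'x topology \<Rightarrow> nat \<Rightarrow> ('x fmat) cstar" where
  "AH_stage X n = \<lparr>
     cs_carrier = {f. (\<forall>p q. continuous_map X euclidean (\<lambda>x. f x p q)) \<and>
       (\<forall>x p q. f x p q \<noteq> 0 \<longrightarrow> x \<in> topspace X \<and> p \<in> words n \<and> q \<in> words n)},
     cs_zero = (\<lambda>x p q. 0),
     cs_add = (\<lambda>f g x p q. f x p q + g x p q),
     cs_scale = (\<lambda>c f x p q. c * f x p q),
     cs_mult = (\<lambda>f g x p q. \<Sum>r\<in>words n. f x p r * g x r q),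
     cs_star = (\<lambda>f x p q. cnj (f x q p)),
     cs_norm = (\<lambda>f. Sup (insert 0 ((\<lambda>x. mat_norm n (f x)) ` topspace X)))\<rparr>"

definition AH_connect :: "'x topology \<Rightarrow> ('x \<Rightarrow> 'x) \<Rightarrow> nat \<Rightarrow> 'x fmat \<Rightarrow> 'x fmat" where
  "AH_connect X \<sigma> n f = (\<lambda>x p q.
     if x \<in> topspace X \<and> p \<in> words (Suc n) \<and> q \<in> words (Suc n) \<and> last p = last q
     then f (if last p then \<sigma> x else x) (butlast p) (butlast q) else 0)"

definition AH_algebra :: "'x topology \<Rightarrow> ('x \<Rightarrow> 'x) \<Rightarrow> ((nat \<Rightarrow> 'x fmat) set) cstar" where
  "AH_algebra X \<sigma> = cstar_limit (AH_stage X) (AH_connect X \<sigma>)"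

definition AH_map :: "'x topology \<Rightarrow> ('x \<Rightarrow> 'x) \<Rightarrow> nat \<Rightarrow> 'x fmat \<Rightarrow> (nat \<Rightarrow> 'x fmat) set" where
  "AH_map X \<sigma> = limit_map (AH_stage X) (AH_connect X \<sigma>)"

definition diag_stage :: "'x topology \<Rightarrow> nat \<Rightarrow> ('x fmat) set" where
  "diag_stage X n = {f \<in> cs_carrier (AH_stage X n). \<forall>x p q. p \<noteq> q \<longrightarrow> f x p q = 0}"

text \<open>The inductive limit of the diagonal subalgebras, as a subalgebra of \<open>A\<close>, is the closure
  of the union of their images.\<close>

definition AH_diagonal :: "'x topology \<Rightarrow> ('x \<Rightarrow> 'x) \<Rightarrow> ((nat \<Rightarrow> 'x fmat) set) set" where
  "AH_diagonal X \<sigma> = {a \<in> cs_carrier (AH_algebra X \<sigma>). \<forall>\<epsilon>>0. \<exists>n. \<exists>f\<in>diag_stage X n.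
     cs_norm (AH_algebra X \<sigma>) (cs_diff (AH_algebra X \<sigma>) a (AH_map X \<sigma> n f)) < \<epsilon>}"

definition mat_unit :: "'x topology \<Rightarrow> ('x \<Rightarrow> 'x) \<Rightarrow> bool list \<Rightarrow> bool list \<Rightarrow> (nat \<Rightarrow> 'x fmat) set" where
  "mat_unit X \<sigma> p q = AH_map X \<sigma> (length p)
     (\<lambda>x p' q'. if x \<in> topspace X \<and> p' = p \<and> q' = q then 1 else 0)"

section \<open>The projective limit and the conjugation action\<close>

definition dual_map :: "('x \<Rightarrow> 'x) \<Rightarrow> bool list \<times> 'x \<Rightarrow> bool list \<times> 'x" where
  "dual_map \<sigma> = (\<lambda>(p, x). (butlast p, if last p then \<sigma> x else x))"

definition proj_limit :: "'x topology \<Rightarrow> ('x \<Rightarrow> 'x) \<Rightarrow> (nat \<Rightarrow> bool list \<times> 'x) topology" where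
  "proj_limit X \<sigma> = subtopology
     (product_topology (\<lambda>n. prod_topology (discrete_topology (words n)) X) {1..})
     {\<xi>. \<forall>n\<ge>1. \<xi> n = dual_map \<sigma> (\<xi> (Suc n))}"

definition b_map :: "(nat \<Rightarrow> bool list \<times> 'x) \<Rightarrow> (nat \<Rightarrow> bool) \<times> 'x" where
  "b_map \<xi> = ((\<lambda>i. fst (\<xi> (Suc i)) ! i), snd (\<xi> 1))"

text \<open>The identification of the projective limit with the spectrum of \<open>C\<close>: the point
  \<open>(p, x)\<close> at stage \<open>n\<close> is the character evaluating the diagonal entry \<open>p\<close> at \<open>x\<close>.\<close>

definition char_of ::
  "'x topology \<Rightarrow> ('x \<Rightarrow> 'x) \<Rightarrow> (nat \<Rightarrow> bool list \<times> 'x) \<Rightarrow> (nat \<Rightarrow> 'x fmat) set \<Rightarrow> complex" where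
  "char_of X \<sigma> \<xi> = (THE \<omega>. \<omega> \<in> characters (AH_algebra X \<sigma>) (AH_diagonal X \<sigma>) \<and>
     (\<forall>n\<ge>1. \<forall>f\<in>diag_stage X n.
        \<omega> (AH_map X \<sigma> n f) = f (snd (\<xi> n)) (fst (\<xi> n)) (fst (\<xi> n))))"

text \<open>The formula for the action is required for every basic set \<open>Z\<^bsub>p,q\<^esub>\<close> containing the arrow.\<close>

definition conj_action ::
  "'x topology \<Rightarrow> ('x \<Rightarrow> 'x) \<Rightarrow> (nat \<Rightarrow> bool) \<times> (nat \<Rightarrow> bool) \<Rightarrow>
     ((nat \<Rightarrow> 'x fmat) set \<Rightarrow> complex) \<Rightarrow> ((nat \<Rightarrow> 'x fmat) set \<Rightarrow> complex)" where
  "conj_action X \<sigma> \<gamma> \<omega> = (THE \<omega>'. \<omega>' \<in> characters (AH_algebra X \<sigma>) (AH_diagonal X \<sigma>) \<and>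
     (\<forall>p q. length p = length q \<longrightarrow> \<gamma> \<in> tail_cyl p q \<longrightarrow>
        (\<forall>c\<in>AH_diagonal X \<sigma>. \<omega>' c = \<omega> (conj_by (AH_algebra X \<sigma>) (mat_unit X \<sigma> p q) c))))"

definition b_inv :: "'x topology \<Rightarrow> ('x \<Rightarrow> 'x) \<Rightarrow> (nat \<Rightarrow> bool) \<times> 'x \<Rightarrow> (nat \<Rightarrow> bool list \<times> 'x)" where
  "b_inv X \<sigma> = inv_into (topspace (proj_limit X \<sigma>)) b_map"

definition char_inv ::
  "'x topology \<Rightarrow> ('x \<Rightarrow> 'x) \<Rightarrow> ((nat \<Rightarrow> 'x fmat) set \<Rightarrow> complex) \<Rightarrow> (nat \<Rightarrow> bool list \<times> 'x)" where
  "char_inv X \<sigma> = inv_into (topspace (proj_limit X \<sigma>)) (char_of X \<sigma>)"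

definition transported_action ::
  "'x topology \<Rightarrow> ('x \<Rightarrow> 'x) \<Rightarrow> (nat \<Rightarrow> bool) \<times> (nat \<Rightarrow> bool) \<Rightarrow>
     (nat \<Rightarrow> bool) \<times> 'x \<Rightarrow> (nat \<Rightarrow> bool) \<times> 'x" where
  "transported_action X \<sigma> \<gamma> y =
     b_map (char_inv X \<sigma> (conj_action X \<sigma> \<gamma> (char_of X \<sigma> (b_inv X \<sigma> y))))"

text \<open>The anchor map sends a point with first component \<open>t\<close> to the unit \<open>t = (t, t)\<close>.\<close>

definition transported_anchor :: "(nat \<Rightarrow> bool) \<times> 'x \<Rightarrow> (nat \<Rightarrow> bool) \<times> (nat \<Rightarrow> bool)" where
  "transported_anchor = (\<lambda>(t, x). (t, t))"

end

theory Submission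
  imports Defs
begin

text \<open>
  Write \<open>Y = {0,1}\<^sup>\<nat> \<times> X\<close>. Each point of \<open>Y\<close> gives a functional on \<open>A\<close>, the limit of the corresponding
  diagonal entries of a representing sequence, uniformly in the point. On the diagonal \<open>C\<close>
  these functionals give an isomorphism \<open>C \<cong> C(Y)\<close>, so \<open>Y\<close> is the spectrum of \<open>C\<close>, and conjugation by
  the matrix unit \<open>e\<^bsub>p,q\<^esub>\<close> is the map replacing the prefix \<open>q\<close> by \<open>p\<close> and moving \<open>X\<close> by a power of \<open>\<sigma>\<close>.

  The point is that the partial homeomorphism \<open>\<alpha>\<^sub>n\<close> of a normaliser \<open>n\<close> is locally one of these maps.
  Approximate \<open>n\<close> by an element of stage \<open>m\<close>. Then the functional \<open>c \<mapsto> y(n\<^sup>* c n)\<close> is close in norm to a positive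
  combination of evaluations at the finitely many points obtained from \<open>y\<close> by changing its prefix of length \<open>m\<close>.
  Since it is a positive multiple of the single evaluation \<open>\<alpha>\<^sub>n(y)\<close>, a Urysohn function shows that \<open>\<alpha>\<^sub>n(y)\<close> is one of
  these points, and by continuity the new prefix is locally constant. As \<open>G\<^bsub>2\<^sup>\<infinity>\<^esub>\<close> is principal, a germ is determined by
  its source and range, which identifies the two groupoids.
\<close>

section \<open>Limits of normed *-algebras\<close>

text \<open>Two coordinate systems are in play. \<open>b_map\<close> records the stage-1 coordinate
  of a point, whereas prefix exchange is simplest in the stage-0 coordinate, where all digits count
  alike: exchanging \<open>q\<close> for \<open>p\<close> moves \<open>X\<close> by
  \<open>\<sigma>\<close> to the power \<open>ones p\<close> minus \<open>ones q\<close>. The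
  analysis uses stage-0 coordinates, and \<open>kap\<close> and \<open>kapi\<close> translate at the
  end. The obstacle in the estimate is that the number of words doubles at each stage, so entrywise
  error bounds are useless late on. A column, however, has l2-norm at most the operator norm, and
  the error in a sum of squared entries is at most \<open>\<epsilon> * (2 * K)\<close> at every
  stage. With \<open>\<epsilon> = l / (8 * K)\<close> this is \<open>l / 4\<close>, below the weight
  \<open>l / 2\<close> that a point outside the finite candidate set would have to carry. The
  isomorphism is built from the transformation groupoid to the germs, the direction in which there
  is a formula; surjectivity is the local form of normalisers. Since the definitions use definite
  descriptions and chosen representatives, each construction comes with a statement of
  independence.\<close>

lemma tendsto_0_sandwich:
  fixes f g :: "nat \<Rightarrow> real"
  assumes "g \<longlonglongrightarrow> 0" "\<And>n. 0 \<le> f n" "\<And>n. f n \<le> g n"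
  shows "f \<longlonglongrightarrow> 0"
  by (rule tendsto_sandwich[of "\<lambda>_. 0" f _ g]) (use assms in auto)

text \<open>Collects what the limit construction uses of the stages: closure, isometric connecting
  homomorphisms and Lipschitz estimates in the distance \<open>d\<close>. In this form elements of
  the limit are handled through inequalities between representatives.\<close>

locale normed_star_system =
  fixes A :: "nat \<Rightarrow> 'a cstar" and \<phi> :: "nat \<Rightarrow> 'a \<Rightarrow> 'a"
  fixes car :: "nat \<Rightarrow> 'a set" and nrm :: "nat \<Rightarrow> 'a \<Rightarrow> real" and d :: "nat \<Rightarrow> 'a \<Rightarrow> 'a \<Rightarrow> real"
  defines car_def: "car n \<equiv> cs_carrier (A n)"
    and nrm_def: "nrm n \<equiv> cs_norm (A n)"
    and d_def: "d n a b \<equiv> cs_norm (A n) (cs_diff (A n) a b)"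
  assumes zero_closed: "cs_zero (A n) \<in> car n"
    and add_closed: "a \<in> car n \<Longrightarrow> b \<in> car n \<Longrightarrow> cs_add (A n) a b \<in> car n"
    and scale_closed: "a \<in> car n \<Longrightarrow> cs_scale (A n) c a \<in> car n"
    and mult_closed: "a \<in> car n \<Longrightarrow> b \<in> car n \<Longrightarrow> cs_mult (A n) a b \<in> car n"
    and star_closed: "a \<in> car n \<Longrightarrow> cs_star (A n) a \<in> car n"
    and map_closed: "a \<in> car n \<Longrightarrow> \<phi> n a \<in> car (Suc n)"
    and map_add: "a \<in> car n \<Longrightarrow> b \<in> car n \<Longrightarrow>
      \<phi> n (cs_add (A n) a b) = cs_add (A (Suc n)) (\<phi> n a) (\<phi> n b)"
    and map_scale: "a \<in> car n \<Longrightarrow> \<phi> n (cs_scale (A n) c a) = cs_scale (A (Suc n)) c (\<phi> n a)"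
    and map_mult: "a \<in> car n \<Longrightarrow> b \<in> car n \<Longrightarrow>
      \<phi> n (cs_mult (A n) a b) = cs_mult (A (Suc n)) (\<phi> n a) (\<phi> n b)"
    and map_star: "a \<in> car n \<Longrightarrow> \<phi> n (cs_star (A n) a) = cs_star (A (Suc n)) (\<phi> n a)"
    and map_norm: "a \<in> car n \<Longrightarrow> nrm (Suc n) (\<phi> n a) = nrm n a"
    and dist_refl: "a \<in> car n \<Longrightarrow> d n a a = 0"
    and dist_commute: "a \<in> car n \<Longrightarrow> b \<in> car n \<Longrightarrow> d n a b = d n b a"
    and dist_triangle: "a \<in> car n \<Longrightarrow> b \<in> car n \<Longrightarrow> e \<in> car n \<Longrightarrow> d n a e \<le> d n a b + d n b e"
    and norm_dist: "a \<in> car n \<Longrightarrow> b \<in> car n \<Longrightarrow> \<bar>nrm n a - nrm n b\<bar> \<le> d n a b"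
    and dist_add: "a \<in> car n \<Longrightarrow> b \<in> car n \<Longrightarrow> a' \<in> car n \<Longrightarrow> b' \<in> car n \<Longrightarrow>
      d n (cs_add (A n) a b) (cs_add (A n) a' b') \<le> d n a a' + d n b b'"
    and dist_scale: "a \<in> car n \<Longrightarrow> b \<in> car n \<Longrightarrow>
      d n (cs_scale (A n) c a) (cs_scale (A n) c b) \<le> cmod c * d n a b"
    and dist_mult: "a \<in> car n \<Longrightarrow> b \<in> car n \<Longrightarrow> a' \<in> car n \<Longrightarrow> b' \<in> car n \<Longrightarrow>
      d n (cs_mult (A n) a b) (cs_mult (A n) a' b') \<le> nrm n a * d n b b' + d n a a' * nrm n b'"
    and dist_star: "a \<in> car n \<Longrightarrow> b \<in> car n \<Longrightarrow> d n (cs_star (A n) a) (cs_star (A n) b) \<le> d n a b"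
begin

abbreviation "LS \<equiv> limit_seqs A \<phi>"
abbreviation "cls \<equiv> limit_class A \<phi>"
abbreviation "con \<equiv> connect \<phi>"
abbreviation "LA \<equiv> cstar_limit A \<phi>"

lemma dist_nonneg: "a \<in> car n \<Longrightarrow> b \<in> car n \<Longrightarrow> 0 \<le> d n a b"
  using norm_dist by fastforce

lemma con_closed: "a \<in> car n \<Longrightarrow> con n k a \<in> car (n + k)"
  by (induction k) (auto simp: map_closed)

lemma con_add: "a \<in> car n \<Longrightarrow> b \<in> car n \<Longrightarrow>
    con n k (cs_add (A n) a b) = cs_add (A (n + k)) (con n k a) (con n k b)"
  by (induction k) (auto simp: map_add con_closed)

lemma con_scale: "a \<in> car n \<Longrightarrow> con n k (cs_scale (A n) c a) = cs_scale (A (n + k)) c (con n k a)"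
  by (induction k) (auto simp: map_scale con_closed)

lemma con_mult: "a \<in> car n \<Longrightarrow> b \<in> car n \<Longrightarrow>
    con n k (cs_mult (A n) a b) = cs_mult (A (n + k)) (con n k a) (con n k b)"
  by (induction k) (auto simp: map_mult con_closed)

lemma con_star: "a \<in> car n \<Longrightarrow> con n k (cs_star (A n) a) = cs_star (A (n + k)) (con n k a)"
  by (induction k) (auto simp: map_star con_closed)

lemma con_norm: "a \<in> car n \<Longrightarrow> nrm (n + k) (con n k a) = nrm n a"
  by (induction k) (auto simp: map_norm con_closed)

lemma con_con: "con (n + k) l (con n k a) = con n (k + l) a"
  by (induction l) (auto simp: add.assoc)

lemma LS_iff: "a \<in> LS \<longleftrightarrow> (\<forall>n. a n \<in> car n) \<and>
    (\<forall>\<epsilon>>0. \<exists>N. \<forall>n\<ge>N. \<forall>k. d (n + k) (a (n + k)) (con n k (a n)) < \<epsilon>)"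
  unfolding limit_seqs_def car_def d_def by simp

lemma LS_car: "a \<in> LS \<Longrightarrow> a n \<in> car n"
  by (simp add: LS_iff)

lemma LS_coherent:
  assumes "a \<in> LS" "\<epsilon> > 0"
  obtains N where "\<And>n k. n \<ge> N \<Longrightarrow> d (n + k) (a (n + k)) (con n k (a n)) < \<epsilon>"
  using assms unfolding LS_iff by blast

text \<open>The connecting maps are isometric, so asymptotic coherence makes the norms a Cauchy
  sequence. Hence the \<open>lim\<close> in the norm of \<open>cstar_limit\<close> is a genuine
  limit.\<close>

lemma LS_norm_convergent:
  assumes "a \<in> LS"
  shows "convergent (\<lambda>n. nrm n (a n))"
proof -
  have "Cauchy (\<lambda>n. nrm n (a n))"
  proof (rule metric_CauchyI)
    fix e :: real assume "e > 0"
    then obtain N where N: "\<And>n k. n \<ge> N \<Longrightarrow> d (n + k) (a (n + k)) (con n k (a n)) < e/2"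
      using LS_coherent[OF assms, of "e/2"] by auto
    have *: "\<bar>nrm (N+k) (a (N+k)) - nrm N (a N)\<bar> < e/2" for k
    proof -
      have "\<bar>nrm (N+k) (a (N+k)) - nrm (N+k) (con N k (a N))\<bar> \<le> d (N+k) (a (N+k)) (con N k (a N))"
        by (rule norm_dist) (auto intro: LS_car assms con_closed)
      then show ?thesis using N[of N k] con_norm[of "a N" N k] LS_car[OF assms] by simp
    qed
    have "dist (nrm m (a m)) (nrm n (a n)) < e" if "m \<ge> N" "n \<ge> N" for m n
      using *[of "m - N"] *[of "n - N"] that by (simp add: dist_real_def) (smt (verit) field_sum_of_halves)
    then show "\<exists>M. \<forall>m\<ge>M. \<forall>n\<ge>M. dist (nrm m (a m)) (nrm n (a n)) < e" by blast
  qed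
  then show ?thesis by (simp add: Cauchy_convergent)
qed

lemma LS_bounded:
  assumes "a \<in> LS"
  obtains K where "K > 0" "\<And>n. nrm n (a n) \<le> K"
proof -
  have "Bseq (\<lambda>n. nrm n (a n))"
    using LS_norm_convergent[OF assms] by (rule convergent_imp_Bseq)
  then obtain K where K: "K > 0" "\<And>n. norm (nrm n (a n)) \<le> K" by (rule BseqE) blast
  have "nrm n (a n) \<le> K" for n using K(2)[of n] by simp
  then show ?thesis using K(1) that by blast
qed

text \<open>All operations preserve coherent sequences for the same reason: the coherence defect of
  the result is Lipschitz in the defects of the arguments. Unary operations use it with
  \<open>a = b\<close>.\<close>

lemma LS_op:
  assumes LS: "a \<in> LS" "b \<in> LS" and car: "\<And>n. f n \<in> car n" and K: "K > 0"
    and le: "\<And>n k. d (n + k) (f (n + k)) (con n k (f n)) \<le>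
      K * d (n + k) (a (n + k)) (con n k (a n)) + K * d (n + k) (b (n + k)) (con n k (b n))"
  shows "f \<in> LS"
  unfolding LS_iff
proof (intro conjI allI impI car)
  fix e :: real assume e: "e > 0"
  have e': "e / (2 * K) > 0" using e K by simp
  obtain N where N: "\<And>n k. n \<ge> N \<Longrightarrow> d (n + k) (a (n + k)) (con n k (a n)) < e / (2 * K)"
    by (rule LS_coherent[OF LS(1) e']) blast
  obtain M where M: "\<And>n k. n \<ge> M \<Longrightarrow> d (n + k) (b (n + k)) (con n k (b n)) < e / (2 * K)"
    by (rule LS_coherent[OF LS(2) e']) blast
  show "\<exists>N. \<forall>n\<ge>N. \<forall>k. d (n + k) (f (n + k)) (con n k (f n)) < e"
  proof (intro exI[of _ "max N M"] allI impI)
    fix n k assume n: "n \<ge> max N M"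
    have "K * d (n + k) (a (n + k)) (con n k (a n)) + K * d (n + k) (b (n + k)) (con n k (b n)) < e / 2 + e / 2"
      using N[of n k] M[of n k] n K by (intro add_strict_mono) (auto simp: field_simps)
    then show "d (n + k) (f (n + k)) (con n k (f n)) < e" using le[of n k] by simp
  qed
qed

lemma LS_add:
  assumes "a \<in> LS" "b \<in> LS"
  shows "(\<lambda>n. cs_add (A n) (a n) (b n)) \<in> LS"
  by (rule LS_op[OF assms _ zero_less_one])
    (simp_all add: con_add add_closed dist_add con_closed LS_car[OF assms(1)] LS_car[OF assms(2)])

lemma LS_scale:
  assumes "a \<in> LS"
  shows "(\<lambda>n. cs_scale (A n) c (a n)) \<in> LS"
\<comment> \<open>The added 1 keeps the constant positive when \<open>c = 0\<close>.\<close>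
proof (rule LS_op[OF assms assms, of _ "cmod c + 1"])
  fix n k
  have "0 \<le> d (n + k) (a (n + k)) (con n k (a n))" by (intro dist_nonneg con_closed LS_car assms)
  moreover have "d (n + k) (cs_scale (A (n + k)) c (a (n + k))) (con n k (cs_scale (A n) c (a n)))
      \<le> cmod c * d (n + k) (a (n + k)) (con n k (a n))"
    by (simp add: con_scale dist_scale con_closed LS_car[OF assms])
  moreover have "0 \<le> cmod c * d (n + k) (a (n + k)) (con n k (a n))" using calculation(1) by simp
  ultimately show "d (n + k) (cs_scale (A (n + k)) c (a (n + k))) (con n k (cs_scale (A n) c (a n)))
      \<le> (cmod c + 1) * d (n + k) (a (n + k)) (con n k (a n)) + (cmod c + 1) * d (n + k) (a (n + k)) (con n k (a n))"
    unfolding distrib_right mult_1 by linarith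
qed (auto intro: scale_closed LS_car assms add_nonneg_pos)

lemma LS_star:
  assumes "a \<in> LS"
  shows "(\<lambda>n. cs_star (A n) (a n)) \<in> LS"
proof (rule LS_op[OF assms assms _ zero_less_one])
  fix n k
  show "d (n + k) (cs_star (A (n + k)) (a (n + k))) (con n k (cs_star (A n) (a n)))
      \<le> 1 * d (n + k) (a (n + k)) (con n k (a n)) + 1 * d (n + k) (a (n + k)) (con n k (a n))"
    using dist_star[of "a (n + k)" "n + k" "con n k (a n)"] dist_nonneg[of "a (n + k)" "n + k" "con n k (a n)"]
    by (simp add: con_star con_closed LS_car[OF assms])
qed (auto intro: star_closed LS_car assms)

text \<open>Multiplication is Lipschitz only on bounded sets; coherent sequences are bounded, and
  the sum of the two bounds serves as a common constant.\<close>

lemma LS_mult: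
  assumes "a \<in> LS" "b \<in> LS"
  shows "(\<lambda>n. cs_mult (A n) (a n) (b n)) \<in> LS"
proof -
  obtain K where K: "K > 0" "\<And>n. nrm n (a n) \<le> K" by (rule LS_bounded[OF assms(1)]) blast
  obtain L where L: "L > 0" "\<And>n. nrm n (b n) \<le> L" by (rule LS_bounded[OF assms(2)]) blast
  show ?thesis
  proof (rule LS_op[OF assms, of _ "K + L"])
    fix n k
    let ?Da = "d (n + k) (a (n + k)) (con n k (a n))" and ?Db = "d (n + k) (b (n + k)) (con n k (b n))"
    have D: "0 \<le> ?Da" "0 \<le> ?Db"
      by (rule dist_nonneg; auto intro: LS_car assms con_closed)+
    have "d (n + k) (cs_mult (A (n+k)) (a (n+k)) (b (n+k))) (con n k (cs_mult (A n) (a n) (b n)))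
        \<le> nrm (n+k) (a (n+k)) * ?Db + ?Da * nrm n (b n)"
      using dist_mult[of "a (n+k)" "n+k" "b (n+k)" "con n k (a n)" "con n k (b n)"]
      by (simp add: con_mult con_norm LS_car[OF assms(1)] LS_car[OF assms(2)] con_closed)
    also have "\<dots> \<le> (K + L) * ?Db + ?Da * (K + L)"
      using D K(1) K(2)[of "n+k"] L(1) L(2)[of n] by (intro add_mono mult_right_mono mult_left_mono) auto
    finally show "d (n + k) (cs_mult (A (n+k)) (a (n+k)) (b (n+k))) (con n k (cs_mult (A n) (a n) (b n)))
        \<le> (K + L) * ?Da + (K + L) * ?Db"
      by (simp add: algebra_simps)
  qed (use K L in \<open>auto intro: mult_closed LS_car assms\<close>)
qed

text \<open>Equality in the limit at the level of representatives. Both memberships are part of it,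
  so symmetry and transitivity hold without side conditions.\<close>

definition near :: "(nat \<Rightarrow> 'a) \<Rightarrow> (nat \<Rightarrow> 'a) \<Rightarrow> bool" where
  "near a b \<longleftrightarrow> a \<in> LS \<and> b \<in> LS \<and> (\<lambda>n. d n (a n) (b n)) \<longlonglongrightarrow> 0"

lemma near_refl: "a \<in> LS \<Longrightarrow> near a a"
  by (simp add: near_def dist_refl LS_car)

lemma near_sym: "near a b \<Longrightarrow> near b a"
  unfolding near_def by (simp add: dist_commute LS_car)

lemma near_trans:
  assumes "near a b" "near b c"
  shows "near a c"
proof -
  have LS: "a \<in> LS" "b \<in> LS" "c \<in> LS" using assms by (auto simp: near_def)
  have "(\<lambda>n. d n (a n) (b n) + d n (b n) (c n)) \<longlonglongrightarrow> 0"
    using assms by (intro tendsto_add_zero) (auto simp: near_def)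
  then have "(\<lambda>n. d n (a n) (c n)) \<longlonglongrightarrow> 0"
    by (rule tendsto_0_sandwich) (auto intro!: dist_nonneg dist_triangle LS_car LS)
  then show ?thesis using LS by (simp add: near_def)
qed

lemma cls_eq_near: "a \<in> LS \<Longrightarrow> cls a = {b. near a b}"
  unfolding limit_class_def near_def d_def by auto

lemma cls_eqI: "near a b \<Longrightarrow> cls a = cls b"
proof -
  assume n: "near a b"
  have "near a c \<longleftrightarrow> near b c" for c
    using near_trans[OF n] near_trans[OF near_sym[OF n]] by blast
  moreover have "a \<in> LS" "b \<in> LS" using n by (auto simp: near_def)
  ultimately show ?thesis by (simp add: cls_eq_near)
qed

text \<open>The operations of \<open>cstar_limit\<close> work on chosen representatives. This fact,
  with the compatibility of \<open>near\<close> with the operations, lets any representative be used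
  instead.\<close>

lemma limit_rep_near: "a \<in> LS \<Longrightarrow> near a (limit_rep (cls a))"
  unfolding limit_rep_def
  by (rule someI2[of _ a]) (auto simp: cls_eq_near near_refl)

lemma LA_carrier: "cs_carrier LA = cls ` LS"
  by (simp add: cstar_limit_def)

lemma LA_cases:
  assumes "U \<in> cs_carrier LA"
  obtains a where "a \<in> LS" "U = cls a"
  using assms by (auto simp: LA_carrier)

lemma near_op:
  assumes "near a a'" "near b b'" "f \<in> LS" "g \<in> LS"
    and "\<And>n. d n (f n) (g n) \<le> K * d n (a n) (a' n) + L * d n (b n) (b' n)"
  shows "near f g"
proof -
  have "(\<lambda>n. K * d n (a n) (a' n) + L * d n (b n) (b' n)) \<longlonglongrightarrow> 0"
    using assms(1,2) by (intro tendsto_add_zero tendsto_mult_right_zero) (auto simp: near_def)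
  then have "(\<lambda>n. d n (f n) (g n)) \<longlonglongrightarrow> 0"
    by (rule tendsto_0_sandwich) (auto intro!: dist_nonneg assms(5) LS_car[OF assms(3)] LS_car[OF assms(4)])
  then show ?thesis using assms(3,4) by (simp add: near_def)
qed

lemma nearD: "near a b \<Longrightarrow> a \<in> LS" "near a b \<Longrightarrow> b \<in> LS"
  by (simp_all add: near_def)

lemma near_add:
  assumes "near a a'" "near b b'"
  shows "near (\<lambda>n. cs_add (A n) (a n) (b n)) (\<lambda>n. cs_add (A n) (a' n) (b' n))"
  using dist_add[OF LS_car[OF nearD(1)[OF assms(1)]] LS_car[OF nearD(1)[OF assms(2)]]
      LS_car[OF nearD(2)[OF assms(1)]] LS_car[OF nearD(2)[OF assms(2)]]]
  by (intro near_op[OF assms LS_add[OF assms[THEN nearD(1)]] LS_add[OF assms[THEN nearD(2)]], of 1 1]) simp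

lemma near_scale:
  assumes "near a a'"
  shows "near (\<lambda>n. cs_scale (A n) c (a n)) (\<lambda>n. cs_scale (A n) c (a' n))"
  using dist_scale[OF LS_car[OF nearD(1)[OF assms]] LS_car[OF nearD(2)[OF assms]]]
  by (intro near_op[OF assms assms LS_scale[OF nearD(1)[OF assms]] LS_scale[OF nearD(2)[OF assms]], where K = "cmod c" and L = 0]) simp

lemma near_star:
  assumes "near a a'"
  shows "near (\<lambda>n. cs_star (A n) (a n)) (\<lambda>n. cs_star (A n) (a' n))"
  using dist_star[OF LS_car[OF nearD(1)[OF assms]] LS_car[OF nearD(2)[OF assms]]]
  by (intro near_op[OF assms assms LS_star[OF nearD(1)[OF assms]] LS_star[OF nearD(2)[OF assms]], of 1 0]) simp

lemma near_mult:
  assumes "near a a'" "near b b'"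
  shows "near (\<lambda>n. cs_mult (A n) (a n) (b n)) (\<lambda>n. cs_mult (A n) (a' n) (b' n))"
proof -
  note LS = assms[THEN nearD(1)] assms[THEN nearD(2)]
  obtain K where K: "K > 0" "\<And>n. nrm n (a n) \<le> K" by (rule LS_bounded[OF LS(1)]) blast
  obtain L where L: "L > 0" "\<And>n. nrm n (b' n) \<le> L" by (rule LS_bounded[OF LS(4)]) blast
  show ?thesis
  proof (rule near_op[OF assms LS_mult[OF LS(1,2)] LS_mult[OF LS(3,4)], of L K])
    fix n
    have "d n (cs_mult (A n) (a n) (b n)) (cs_mult (A n) (a' n) (b' n))
      \<le> nrm n (a n) * d n (b n) (b' n) + d n (a n) (a' n) * nrm n (b' n)"
      by (intro dist_mult LS_car LS)
    also have "\<dots> \<le> K * d n (b n) (b' n) + d n (a n) (a' n) * L"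
      using K L by (intro add_mono mult_right_mono mult_left_mono) (auto intro!: dist_nonneg LS_car LS)
    finally show "d n (cs_mult (A n) (a n) (b n)) (cs_mult (A n) (a' n) (b' n))
      \<le> L * d n (a n) (a' n) + K * d n (b n) (b' n)" by (simp add: algebra_simps)
  qed
qed

lemma LA_add: "a \<in> LS \<Longrightarrow> b \<in> LS \<Longrightarrow> cs_add LA (cls a) (cls b) = cls (\<lambda>n. cs_add (A n) (a n) (b n))"
  by (auto simp: cstar_limit_def intro!: cls_eqI near_add near_sym[OF limit_rep_near])

lemma LA_mult: "a \<in> LS \<Longrightarrow> b \<in> LS \<Longrightarrow> cs_mult LA (cls a) (cls b) = cls (\<lambda>n. cs_mult (A n) (a n) (b n))"
  by (auto simp: cstar_limit_def intro!: cls_eqI near_mult near_sym[OF limit_rep_near])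

lemma LA_scale: "a \<in> LS \<Longrightarrow> cs_scale LA c (cls a) = cls (\<lambda>n. cs_scale (A n) c (a n))"
  by (auto simp: cstar_limit_def intro!: cls_eqI near_scale near_sym[OF limit_rep_near])

lemma LA_star: "a \<in> LS \<Longrightarrow> cs_star LA (cls a) = cls (\<lambda>n. cs_star (A n) (a n))"
  by (auto simp: cstar_limit_def intro!: cls_eqI near_star near_sym[OF limit_rep_near])

lemma cls_in: "a \<in> LS \<Longrightarrow> cls a \<in> cs_carrier LA"
  by (simp add: LA_carrier)

lemma LA_closed:
  assumes "U \<in> cs_carrier LA"
  shows "cs_star LA U \<in> cs_carrier LA"
    and "V \<in> cs_carrier LA \<Longrightarrow> cs_mult LA U V \<in> cs_carrier LA"
  using assms by (auto simp: LA_carrier LA_star LA_mult intro!: imageI LS_star LS_mult)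

lemma LA_norm:
  assumes "a \<in> LS"
  shows "(\<lambda>n. nrm n (a n)) \<longlonglongrightarrow> cs_norm LA (cls a)"
proof -
  let ?r = "limit_rep (cls a)"
  have n: "near a ?r" using assms by (rule limit_rep_near)
  have rLS: "?r \<in> LS" using n by (simp add: near_def)
  have r: "(\<lambda>n. nrm n (?r n)) \<longlonglongrightarrow> cs_norm LA (cls a)"
    using LS_norm_convergent[OF rLS] by (simp add: cstar_limit_def convergent_LIMSEQ_iff nrm_def)
  have "(\<lambda>n. nrm n (a n) - nrm n (?r n)) \<longlonglongrightarrow> 0"
  proof (rule Lim_null_comparison)
    show "\<forall>\<^sub>F n in sequentially. norm (nrm n (a n) - nrm n (?r n)) \<le> d n (a n) (?r n)"
      using norm_dist[OF LS_car[OF assms] LS_car[OF rLS]] by simp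
    show "(\<lambda>n. d n (a n) (?r n)) \<longlonglongrightarrow> 0" using n by (simp add: near_def)
  qed
  from tendsto_add[OF this r] show ?thesis by simp
qed

text \<open>The canonical representative of the image of a stage element: exactly coherent from
  stage \<open>n\<close> on, while the zeros before that do not affect its class.\<close>

definition lift_seq :: "nat \<Rightarrow> 'a \<Rightarrow> nat \<Rightarrow> 'a" where
  "lift_seq n a m = (if m < n then cs_zero (A m) else con n (m - n) a)"

lemma limit_map_eq: "limit_map A \<phi> n a = cls (lift_seq n a)"
  by (simp add: limit_map_def lift_seq_def[abs_def])

lemma lift_seq_LS:
  assumes "a \<in> car n"
  shows "lift_seq n a \<in> LS"
  unfolding LS_iff
proof (intro conjI allI impI)
  show car: "lift_seq n a m \<in> car m" for m
    using con_closed[OF assms, of "m - n"] by (auto simp: lift_seq_def zero_closed)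
  fix e :: real assume "e > 0"
  show "\<exists>N. \<forall>m\<ge>N. \<forall>k. d (m + k) (lift_seq n a (m + k)) (con m k (lift_seq n a m)) < e"
  proof (intro exI[of _ n] allI impI)
    fix m k assume "m \<ge> n"
    then have "con m k (lift_seq n a m) = lift_seq n a (m + k)"
      using con_con[of n "m - n" k a] by (simp add: lift_seq_def)
    then show "d (m + k) (lift_seq n a (m + k)) (con m k (lift_seq n a m)) < e"
      using \<open>e > 0\<close> dist_refl[OF car] by simp
  qed
qed

text \<open>The approximation condition in \<open>AH_diagonal\<close> concerns the norm of a
  difference in the limit; this turns it into a condition on representatives.\<close>

lemma LA_diff:
  assumes "a \<in> LS" "b \<in> LS"
  shows "(\<lambda>n. d n (a n) (b n)) \<longlonglongrightarrow> cs_norm LA (cs_diff LA (cls a) (cls b))"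
proof -
  have "cs_diff LA (cls a) (cls b) = cls (\<lambda>n. cs_diff (A n) (a n) (b n))"
    using assms by (simp add: cs_diff_def LA_scale LA_add LS_scale)
  moreover have "(\<lambda>n. cs_diff (A n) (a n) (b n)) \<in> LS"
    using assms by (simp add: cs_diff_def LS_scale LS_add)
  ultimately show ?thesis using LA_norm by (simp add: d_def nrm_def)
qed

end

section \<open>Operator norms of matrices indexed by words\<close>

lemma finite_words [simp]: "finite (words n)"
  unfolding words_def using finite_lists_length_eq[OF finite[of "UNIV :: bool set"], of n] by simp

lemma words_Suc_cases:
  assumes "p \<in> words (Suc n)"
  obtains p' b where "p = p' @ [b]" "p' \<in> words n"
  using assms by (cases p rule: rev_cases) (auto simp: words_def)

lemma sum_words_Suc:
  fixes f :: "bool list \<Rightarrow> 'b::comm_monoid_add"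
  shows "(\<Sum>p\<in>words (Suc n). f p) = (\<Sum>p\<in>words n. f (p @ [False])) + (\<Sum>p\<in>words n. f (p @ [True]))"
proof -
  have eq: "words (Suc n) = (\<lambda>p. p @ [False]) ` words n \<union> (\<lambda>p. p @ [True]) ` words n"
  proof (intro set_eqI iffI)
    fix p assume "p \<in> words (Suc n)"
    then obtain p' b where "p = p' @ [b]" "p' \<in> words n" by (rule words_Suc_cases)
    then show "p \<in> (\<lambda>p. p @ [False]) ` words n \<union> (\<lambda>p. p @ [True]) ` words n"
      by (cases b) auto
  qed (auto simp: words_def)
  show ?thesis unfolding eq
    by (subst sum.union_disjoint) (auto simp: sum.reindex inj_on_def)
qed

definition vnorm :: "nat \<Rightarrow> (bool list \<Rightarrow> complex) \<Rightarrow> real" where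
  "vnorm n v = L2_set (\<lambda>q. cmod (v q)) (words n)"

definition mv :: "nat \<Rightarrow> (bool list \<Rightarrow> bool list \<Rightarrow> complex) \<Rightarrow> (bool list \<Rightarrow> complex) \<Rightarrow> bool list \<Rightarrow> complex" where
  "mv n m v p = (\<Sum>q\<in>words n. m p q * v q)"

lemma vnorm_nonneg [simp]: "0 \<le> vnorm n v"
  by (simp add: vnorm_def)

lemma vnorm_cong: "(\<And>p. p \<in> words n \<Longrightarrow> v p = w p) \<Longrightarrow> vnorm n v = vnorm n w"
  unfolding vnorm_def by (rule L2_set_cong) auto

lemma vnorm_entry: "p \<in> words n \<Longrightarrow> cmod (v p) \<le> vnorm n v"
  unfolding vnorm_def by (rule member_le_L2_set) auto

lemma vnorm_le_sum: "vnorm n v \<le> (\<Sum>p\<in>words n. cmod (v p))"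
  unfolding vnorm_def by (rule L2_set_le_sum) auto

lemma vnorm_mono: "(\<And>p. p \<in> words n \<Longrightarrow> cmod (v p) \<le> cmod (w p)) \<Longrightarrow> vnorm n v \<le> vnorm n w"
  unfolding vnorm_def by (rule L2_set_mono) auto

lemma vnorm_add: "vnorm n (\<lambda>p. v p + w p) \<le> vnorm n v + vnorm n w"
proof -
  have "vnorm n (\<lambda>p. v p + w p) \<le> L2_set (\<lambda>p. cmod (v p) + cmod (w p)) (words n)"
    unfolding vnorm_def by (rule L2_set_mono) (auto intro: norm_triangle_ineq)
  also have "\<dots> \<le> vnorm n v + vnorm n w"
    unfolding vnorm_def by (rule L2_set_triangle_ineq)
  finally show ?thesis .
qed

lemma vnorm_scale: "vnorm n (\<lambda>p. c * v p) = cmod c * vnorm n v"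
  unfolding vnorm_def by (simp add: norm_mult L2_set_right_distrib)

lemma vnorm_0_iff: "vnorm n v = 0 \<longleftrightarrow> (\<forall>p\<in>words n. v p = 0)"
  unfolding vnorm_def by (simp add: L2_set_eq_0_iff)

lemma vnorm_sq: "(vnorm n v)\<^sup>2 = (\<Sum>p\<in>words n. (cmod (v p))\<^sup>2)"
  unfolding vnorm_def L2_set_def by (simp add: sum_nonneg)

lemma vnorm_Suc: "(vnorm (Suc n) v)\<^sup>2 = (vnorm n (\<lambda>p. v (p @ [False])))\<^sup>2 + (vnorm n (\<lambda>p. v (p @ [True])))\<^sup>2"
  by (simp add: vnorm_sq sum_words_Suc)

lemma vnorm_inner: "cmod (\<Sum>p\<in>words n. v p * w p) \<le> vnorm n v * vnorm n w"
proof -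
  have "cmod (\<Sum>p\<in>words n. v p * w p) \<le> (\<Sum>p\<in>words n. \<bar>cmod (v p)\<bar> * \<bar>cmod (w p)\<bar>)"
    by (rule order_trans[OF norm_sum]) (simp add: norm_mult)
  also have "\<dots> \<le> vnorm n v * vnorm n w" unfolding vnorm_def by (rule L2_set_mult_ineq)
  finally show ?thesis .
qed

lemma mv_scale: "mv n m (\<lambda>q. c * v q) = (\<lambda>p. c * mv n m v p)"
  by (auto simp: mv_def sum_distrib_left algebra_simps)

lemma mv_mult: "mv n (\<lambda>p q. \<Sum>r\<in>words n. a p r * b r q) v = mv n a (mv n b v)"
proof
  fix p
  have "mv n (\<lambda>p q. \<Sum>r\<in>words n. a p r * b r q) v p = (\<Sum>q\<in>words n. \<Sum>r\<in>words n. a p r * b r q * v q)"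
    by (simp add: mv_def sum_distrib_right)
  also have "\<dots> = (\<Sum>r\<in>words n. \<Sum>q\<in>words n. a p r * b r q * v q)" by (rule sum.swap)
  also have "\<dots> = mv n a (mv n b v) p"
    by (simp add: mv_def sum_distrib_left mult.assoc)
  finally show "mv n (\<lambda>p q. \<Sum>r\<in>words n. a p r * b r q) v p = mv n a (mv n b v) p" .
qed

lemma mv_le_sum: "vnorm n (mv n m v) \<le> (\<Sum>p\<in>words n. \<Sum>q\<in>words n. cmod (m p q)) * vnorm n v"
proof -
  have "vnorm n (mv n m v) \<le> (\<Sum>p\<in>words n. cmod (mv n m v p))" by (rule vnorm_le_sum)
  also have "\<dots> \<le> (\<Sum>p\<in>words n. \<Sum>q\<in>words n. cmod (m p q) * vnorm n v)"
  proof (rule sum_mono)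
    fix p
    have "cmod (mv n m v p) \<le> (\<Sum>q\<in>words n. cmod (m p q) * cmod (v q))"
      unfolding mv_def by (rule order_trans[OF norm_sum]) (simp add: norm_mult)
    also have "\<dots> \<le> (\<Sum>q\<in>words n. cmod (m p q) * vnorm n v)"
      by (intro sum_mono mult_left_mono vnorm_entry) auto
    finally show "cmod (mv n m v p) \<le> (\<Sum>q\<in>words n. cmod (m p q) * vnorm n v)" .
  qed
  finally show ?thesis by (simp add: sum_distrib_right)
qed

lemma mat_norm_alt: "mat_norm n m = Sup {vnorm n (mv n m v) | v. vnorm n v \<le> 1}"
proof -
  have "(\<Sum>q\<in>words n. (cmod (v q))\<^sup>2) \<le> 1 \<longleftrightarrow> vnorm n v \<le> 1" for v
    unfolding vnorm_def L2_set_def by simp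
  then show ?thesis unfolding mat_norm_def by (simp add: vnorm_def L2_set_def mv_def)
qed

text \<open>Together with \<open>mat_norm_bound\<close> this characterises the operator norm as the
  least admissible constant \<open>K\<close>, so the supremum disappears from later
  arguments.\<close>

lemma mat_norm_least:
  assumes "\<And>v. vnorm n (mv n m v) \<le> K * vnorm n v" and "0 \<le> K"
  shows "mat_norm n m \<le> K"
  unfolding mat_norm_alt
proof (rule cSup_least)
  have "vnorm n (\<lambda>_. 0) \<le> 1" using vnorm_0_iff[of n "\<lambda>_. 0"] by simp
  then show "{vnorm n (mv n m v) | v. vnorm n v \<le> 1} \<noteq> {}" by blast
  fix y assume "y \<in> {vnorm n (mv n m v) | v. vnorm n v \<le> 1}"
  then obtain v where v: "y = vnorm n (mv n m v)" "vnorm n v \<le> 1" by blast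
  have "K * vnorm n v \<le> K" using assms(2) v(2) by (simp add: mult_left_le)
  then show "y \<le> K" using assms(1)[of v] v by linarith
qed

lemma mat_norm_bound: "vnorm n (mv n m v) \<le> mat_norm n m * vnorm n v"
proof (cases "vnorm n v = 0")
  case True
  then have "mv n m v p = 0" for p by (simp add: vnorm_0_iff mv_def)
  then have "vnorm n (mv n m v) = 0" by (simp add: vnorm_0_iff)
  then show ?thesis using True by simp
next
  case False
  then have pos: "vnorm n v > 0" using vnorm_nonneg[of n v] by linarith
  \<comment> \<open>Rescales \<open>v\<close> into the unit ball, over which the supremum
    runs.\<close>
  define c where "c = complex_of_real (1 / vnorm n v)"
  have cm: "cmod c = 1 / vnorm n v" using pos unfolding c_def norm_of_real by simp
  have c1: "vnorm n (\<lambda>q. c * v q) \<le> 1" using pos by (simp add: vnorm_scale cm)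
  let ?S = "\<Sum>p\<in>words n. \<Sum>q\<in>words n. cmod (m p q)"
  \<comment> \<open>The sum of the moduli of all entries bounds the operator, so the supremum really
    is an upper bound.\<close>
  have "bdd_above {vnorm n (mv n m v) | v. vnorm n v \<le> 1}"
  proof (rule bdd_aboveI)
    fix y assume "y \<in> {vnorm n (mv n m v) | v. vnorm n v \<le> 1}"
    then obtain v where v: "y = vnorm n (mv n m v)" "vnorm n v \<le> 1" by blast
    have "?S * vnorm n v \<le> ?S" using v(2) by (intro mult_left_le sum_nonneg) auto
    then show "y \<le> ?S" using mv_le_sum[of n m v] v by linarith
  qed
  then have "vnorm n (mv n m (\<lambda>q. c * v q)) \<le> mat_norm n m"
    unfolding mat_norm_alt by (rule cSup_upper[rotated]) (use c1 in blast)
  then show ?thesis using pos by (simp add: mv_scale vnorm_scale cm field_simps)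
qed

text \<open>An operator and its adjoint have the same bounds:
  \<open>\<parallel>m\<^sup>* v\<parallel>\<^sup>2 = \<langle>m m\<^sup>* v, v\<rangle> \<le> K \<parallel>m\<^sup>* v\<parallel> \<parallel>v\<parallel>\<close>.\<close>

lemma mv_adjoint_bound:
  assumes "\<And>v. vnorm n (mv n m v) \<le> K * vnorm n v"
  shows "vnorm n (mv n (\<lambda>p q. cnj (m q p)) v) \<le> K * vnorm n v"
proof -
  let ?w = "mv n (\<lambda>p q. cnj (m q p)) v"
  have "complex_of_real ((vnorm n ?w)\<^sup>2) = (\<Sum>p\<in>words n. ?w p * cnj (?w p))"
    by (simp add: vnorm_sq complex_norm_square del: of_real_power)
  also have "\<dots> = (\<Sum>p\<in>words n. \<Sum>q\<in>words n. cnj (m q p) * v q * cnj (?w p))"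
    unfolding mv_def[of n "\<lambda>p q. cnj (m q p)" v] by (simp only: sum_distrib_right)
  also have "\<dots> = (\<Sum>q\<in>words n. \<Sum>p\<in>words n. cnj (m q p) * v q * cnj (?w p))" by (rule sum.swap)
  also have "\<dots> = (\<Sum>q\<in>words n. v q * cnj (mv n m ?w q))"
    by (simp add: mv_def[of n m ?w] sum_distrib_left mult_ac)
  finally have "(vnorm n ?w)\<^sup>2 = cmod (\<Sum>q\<in>words n. v q * cnj (mv n m ?w q))"
    by (metis abs_power2 norm_of_real)
  also have "\<dots> \<le> vnorm n v * vnorm n (\<lambda>q. cnj (mv n m ?w q))" by (rule vnorm_inner)
  also have "vnorm n (\<lambda>q. cnj (mv n m ?w q)) = vnorm n (mv n m ?w)" by (simp add: vnorm_def)
  also have "vnorm n v * \<dots> \<le> vnorm n v * (K * vnorm n ?w)"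
    by (intro mult_left_mono assms) auto
  finally have *: "vnorm n ?w * vnorm n ?w \<le> (K * vnorm n v) * vnorm n ?w"
    by (simp add: power2_eq_square mult_ac)
  show ?thesis
  proof (cases "vnorm n ?w = 0")
    case True
    have "0 \<le> K * vnorm n v" using assms[of v] vnorm_nonneg[of n "mv n m v"] by linarith
    then show ?thesis using True by simp
  next
    case False
    then have "vnorm n ?w > 0" using vnorm_nonneg[of n ?w] by linarith
    then show ?thesis using * by simp
  qed
qed

section \<open>The stages of the AH-algebra\<close>

lemma continuous_map_compact_bounded:
  fixes f :: "'x \<Rightarrow> 'b::real_normed_vector"
  assumes "compact_space X" "continuous_map X euclidean f"
  obtains B where "\<And>x. x \<in> topspace X \<Longrightarrow> norm (f x) \<le> B"
proof -
  have "compactin euclidean (f ` topspace X)"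
    using assms image_compactin unfolding compact_space_def by blast
  then have "bounded (f ` topspace X)" by (simp add: compact_imp_bounded)
  then show ?thesis using that by (auto simp: bounded_iff)
qed

lemma continuous_map_cmult:
  fixes f g :: "'x \<Rightarrow> complex"
  shows "continuous_map X euclidean f \<Longrightarrow> continuous_map X euclidean g \<Longrightarrow>
    continuous_map X euclidean (\<lambda>x. f x * g x)"
  by (simp add: continuous_map_atin tendsto_mult)

lemma continuous_map_cnj:
  shows "continuous_map X euclidean f \<Longrightarrow> continuous_map X euclidean (\<lambda>x. cnj (f x))"
  by (simp add: continuous_map_atin tendsto_cnj)

text \<open>The inverse is a parameter because the coordinates of a point at later stages involve
  negative powers of \<open>\<sigma>\<close>.\<close>

locale dynamical_system =
  fixes X :: "'x topology" and \<sigma> \<sigma>i :: "'x \<Rightarrow> 'x"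
  assumes compact: "compact_space X" and Hausdorff: "Hausdorff_space X"
    and homeo: "homeomorphic_maps X X \<sigma> \<sigma>i"
begin

abbreviation "St \<equiv> AH_stage X"
abbreviation "Xc \<equiv> topspace X"
abbreviation "Con \<equiv> AH_connect X \<sigma>"
abbreviation "Car n \<equiv> cs_carrier (St n)"
abbreviation "nm n \<equiv> cs_norm (St n)"
abbreviation "df n \<equiv> cs_diff (St n)"
abbreviation "mul n \<equiv> cs_mult (St n)"
abbreviation "adj n \<equiv> cs_star (St n)"

lemma sigma_cont: "continuous_map X X \<sigma>" and sigmai_cont: "continuous_map X X \<sigma>i"
  and sigma_sigmai [simp]: "x \<in> Xc \<Longrightarrow> \<sigma> (\<sigma>i x) = x"
  and sigmai_sigma [simp]: "x \<in> Xc \<Longrightarrow> \<sigma>i (\<sigma> x) = x"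
  using homeo by (auto simp: homeomorphic_maps_def)

lemma sigma_in [simp]: "x \<in> Xc \<Longrightarrow> \<sigma> x \<in> Xc"
  and sigmai_in [simp]: "x \<in> Xc \<Longrightarrow> \<sigma>i x \<in> Xc"
  using sigma_cont sigmai_cont by (auto simp: continuous_map_def)

lemma stage_carrier: "f \<in> Car n \<longleftrightarrow>
    (\<forall>p q. continuous_map X euclidean (\<lambda>x. f x p q)) \<and>
    (\<forall>x p q. f x p q \<noteq> 0 \<longrightarrow> x \<in> Xc \<and> p \<in> words n \<and> q \<in> words n)"
  by (simp add: AH_stage_def)

lemma stage_ops:
  "cs_zero (St n) = (\<lambda>x p q. 0)"
  "cs_add (St n) f g = (\<lambda>x p q. f x p q + g x p q)"
  "cs_scale (St n) c f = (\<lambda>x p q. c * f x p q)"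
  "mul n f g = (\<lambda>x p q. \<Sum>r\<in>words n. f x p r * g x r q)"
  "adj n f = (\<lambda>x p q. cnj (f x q p))"
  "df n f g = (\<lambda>x p q. f x p q - g x p q)"
  by (auto simp: AH_stage_def cs_diff_def)

text \<open>With \<open>stage_norm_bound\<close> it describes the norm of a stage as the least
  uniform operator bound. The condition \<open>0 \<le> K\<close> answers for the 0 put into the
  supremum, which gives the norm a value when \<open>X\<close> is empty.\<close>

lemma stage_norm_least:
  assumes "0 \<le> K" "\<And>x v. x \<in> Xc \<Longrightarrow> vnorm n (mv n (f x) v) \<le> K * vnorm n v"
  shows "nm n f \<le> K"
  using assms by (auto simp: AH_stage_def intro!: cSup_least mat_norm_least)

lemma stage_norm_bdd:
  assumes "f \<in> Car n"
  shows "bdd_above (insert 0 ((\<lambda>x. mat_norm n (f x)) ` Xc))"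
proof -
  have "\<exists>B. \<forall>x\<in>Xc. cmod (f x p q) \<le> B" for p q
    using assms continuous_map_compact_bounded[OF compact, of "\<lambda>x. f x p q"]
    by (metis stage_carrier)
  then obtain B where B: "\<And>p q x. x \<in> Xc \<Longrightarrow> cmod (f x p q) \<le> B p q" by metis
  let ?S = "\<Sum>p\<in>words n. \<Sum>q\<in>words n. max 0 (B p q)"
  have "mat_norm n (f x) \<le> ?S" if "x \<in> Xc" for x
  proof (rule mat_norm_least)
    fix v
    have "(\<Sum>p\<in>words n. \<Sum>q\<in>words n. cmod (f x p q)) \<le> ?S"
      by (intro sum_mono) (use B[OF that] in \<open>simp add: max.coboundedI2\<close>)
    then show "vnorm n (mv n (f x) v) \<le> ?S * vnorm n v"
      by (rule order_trans[OF mv_le_sum mult_right_mono]) auto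
  qed (auto intro!: sum_nonneg)
  moreover have "0 \<le> ?S" by (auto intro!: sum_nonneg)
  ultimately show ?thesis by (intro bdd_aboveI[of _ ?S]) auto
qed

lemma stage_norm_bound:
  assumes "f \<in> Car n" "x \<in> Xc"
  shows "vnorm n (mv n (f x) v) \<le> nm n f * vnorm n v"
proof -
  have "mat_norm n (f x) \<le> nm n f"
    unfolding AH_stage_def using stage_norm_bdd[OF assms(1)] assms(2)
    by (auto intro!: cSup_upper)
  then show ?thesis
    by (rule order_trans[OF mat_norm_bound mult_right_mono]) auto
qed

lemma stage_norm_nonneg:
  assumes "f \<in> Car n"
  shows "0 \<le> nm n f"
  using cSup_upper[OF _ stage_norm_bdd[OF assms], of 0] by (simp add: AH_stage_def)

lemma stage_add_closed:
  "f \<in> Car n \<Longrightarrow> g \<in> Car n \<Longrightarrow> cs_add (St n) f g \<in> Car n"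
  by (auto simp: stage_carrier stage_ops intro!: continuous_map_add) (metis add_0)+

lemma stage_scale_closed: "f \<in> Car n \<Longrightarrow> cs_scale (St n) c f \<in> Car n"
  by (auto simp: stage_carrier stage_ops intro!: continuous_map_cmult)

lemma stage_star_closed: "f \<in> Car n \<Longrightarrow> adj n f \<in> Car n"
  by (auto simp: stage_carrier stage_ops intro!: continuous_map_cnj)

lemma stage_mult_closed:
  assumes "f \<in> Car n" "g \<in> Car n"
  shows "mul n f g \<in> Car n"
  unfolding stage_carrier stage_ops
proof (intro conjI allI impI)
  fix p q
  show "continuous_map X euclidean (\<lambda>x. \<Sum>r\<in>words n. f x p r * g x r q)"
    using assms by (intro continuous_map_sum continuous_map_cmult) (auto simp: stage_carrier)
next
  fix x p q assume "(\<Sum>r\<in>words n. f x p r * g x r q) \<noteq> 0"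
  then obtain r where "f x p r * g x r q \<noteq> 0" by (meson sum.not_neutral_contains_not_neutral)
  then have "f x p r \<noteq> 0" "g x r q \<noteq> 0" by auto
  then show "x \<in> Xc" "p \<in> words n" "q \<in> words n" using assms by (auto simp: stage_carrier)
qed

lemma stage_diff_closed:
  "f \<in> Car n \<Longrightarrow> g \<in> Car n \<Longrightarrow> df n f g \<in> Car n"
  by (simp add: cs_diff_def stage_add_closed stage_scale_closed)

text \<open>The free function \<open>h\<close> lets differences of sums, differences of products and
  three-point distances be inserted directly once they are split pointwise on
  \<open>X\<close>.\<close>

lemma stage_norm_add:
  assumes "f \<in> Car n" "g \<in> Car n"
    and "\<And>x p q. x \<in> Xc \<Longrightarrow> h x p q = f x p q + g x p q"
  shows "nm n h \<le> nm n f + nm n g"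
proof (rule stage_norm_least)
  fix x v assume x: "x \<in> Xc"
  have "mv n (h x) v = (\<lambda>p. mv n (f x) v p + mv n (g x) v p)"
    using assms(3)[OF x] by (auto simp: mv_def algebra_simps sum.distrib)
  then have "vnorm n (mv n (h x) v) \<le> vnorm n (mv n (f x) v) + vnorm n (mv n (g x) v)"
    by (simp add: vnorm_add)
  also have "\<dots> \<le> nm n f * vnorm n v + nm n g * vnorm n v"
    by (intro add_mono stage_norm_bound assms x)
  finally show "vnorm n (mv n (h x) v) \<le> (nm n f + nm n g) * vnorm n v"
    by (simp add: algebra_simps)
qed (use assms in \<open>auto intro!: add_nonneg_nonneg stage_norm_nonneg\<close>)

lemma stage_norm_scale:
  assumes "f \<in> Car n"
    and "\<And>x p q. x \<in> Xc \<Longrightarrow> h x p q = c * f x p q"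
  shows "nm n h \<le> cmod c * nm n f"
proof (rule stage_norm_least)
  fix x v assume x: "x \<in> Xc"
  have "mv n (h x) v = (\<lambda>p. c * mv n (f x) v p)"
    using assms(2)[OF x] by (auto simp: mv_def algebra_simps sum_distrib_left)
  then show "vnorm n (mv n (h x) v) \<le> (cmod c * nm n f) * vnorm n v"
    using mult_left_mono[OF stage_norm_bound[OF assms(1) x], of "cmod c" v]
    by (simp add: vnorm_scale mult.assoc)
qed (use assms in \<open>auto intro!: mult_nonneg_nonneg stage_norm_nonneg\<close>)

lemma stage_norm_mult:
  assumes "f \<in> Car n" "g \<in> Car n"
  shows "nm n (mul n f g) \<le> nm n f * nm n g"
proof (rule stage_norm_least)
  fix x v assume x: "x \<in> Xc"
  have "vnorm n (mv n (mul n f g x) v) = vnorm n (mv n (f x) (mv n (g x) v))"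
    by (simp add: stage_ops mv_mult)
  also have "\<dots> \<le> nm n f * vnorm n (mv n (g x) v)"
    by (rule stage_norm_bound[OF assms(1) x])
  also have "\<dots> \<le> nm n f * (nm n g * vnorm n v)"
    by (intro mult_left_mono stage_norm_bound assms x stage_norm_nonneg)
  finally show "vnorm n (mv n (mul n f g x) v) \<le> nm n f * nm n g * vnorm n v"
    by (simp add: mult.assoc)
qed (use assms in \<open>auto intro!: mult_nonneg_nonneg stage_norm_nonneg\<close>)

lemma stage_norm_star:
  assumes "f \<in> Car n"
  shows "nm n (adj n f) \<le> nm n f"
proof (rule stage_norm_least)
  fix x v assume x: "x \<in> Xc"
  show "vnorm n (mv n (adj n f x) v) \<le> nm n f * vnorm n v"
    unfolding stage_ops by (rule mv_adjoint_bound) (rule stage_norm_bound[OF assms x])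
qed (use assms stage_norm_nonneg in auto)

lemma mv_delta: "q \<in> words n \<Longrightarrow> mv n m (\<lambda>r. if r = q then 1 else 0) p = m p q"
  by (simp add: mv_def if_distrib sum.delta cong: if_cong)

lemma vnorm_delta: "q \<in> words n \<Longrightarrow> vnorm n (\<lambda>r. if r = q then 1 else 0) = 1"
proof -
  assume q: "q \<in> words n"
  have "(vnorm n (\<lambda>r. if r = q then 1 else 0))\<^sup>2 = (\<Sum>p\<in>words n. if p = q then 1 else 0)"
    unfolding vnorm_sq by (rule sum.cong) auto
  also have "\<dots> = 1" using q by simp
  finally show ?thesis by (simp add: power2_eq_1_iff) (metis vnorm_nonneg not_one_le_zero neg_0_le_iff_le)
qed

text \<open>A column is the image of a standard unit vector. This is the dimension-free bound behind
  the later error estimate.\<close>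

lemma stage_column_bound:
  assumes "f \<in> Car n" "x \<in> Xc" "q \<in> words n"
  shows "vnorm n (\<lambda>p. f x p q) \<le> nm n f"
  using stage_norm_bound[OF assms(1,2), of "\<lambda>r. if r = q then 1 else 0"]
  by (simp add: mv_delta[OF assms(3), abs_def] vnorm_delta[OF assms(3)])

lemma stage_entry_bound:
  assumes "f \<in> Car n" "x \<in> Xc" "p \<in> words n" "q \<in> words n"
  shows "cmod (f x p q) \<le> nm n f"
  using stage_column_bound[OF assms(1,2,4)] vnorm_entry[OF assms(3), of "\<lambda>p. f x p q"] by linarith

text \<open>A diagonal matrix only rescales coordinates, so a common bound for the entries bounds
  its operator norm.\<close>

lemma stage_diagonal_norm_le:
  assumes "0 \<le> K" "\<And>x p q. x \<in> Xc \<Longrightarrow> p \<noteq> q \<Longrightarrow> f x p q = 0"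
    "\<And>x p. x \<in> Xc \<Longrightarrow> p \<in> words n \<Longrightarrow> cmod (f x p p) \<le> K"
  shows "nm n f \<le> K"
proof (rule stage_norm_least)
  fix x v assume x: "x \<in> Xc"
  have "mv n (f x) v p = f x p p * v p" if "p \<in> words n" for p
  proof -
    have "mv n (f x) v p = (\<Sum>q\<in>words n. if q = p then f x p p * v p else 0)"
      unfolding mv_def by (rule sum.cong) (auto simp: assms(2)[OF x])
    then show ?thesis using that by simp
  qed
  then have "vnorm n (mv n (f x) v) \<le> vnorm n (\<lambda>p. of_real K * v p)"
    using assms(1) by (intro vnorm_mono) (auto simp: norm_mult intro!: mult_right_mono assms(3)[OF x])
  then show "vnorm n (mv n (f x) v) \<le> K * vnorm n v" using assms(1) by (simp add: vnorm_scale)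
qed (rule assms)

lemma connect_snoc:
  assumes "x \<in> Xc" "p \<in> words n" "q \<in> words n"
  shows "Con n f x (p @ [b]) (q @ [c]) = (if b = c then f (if b then \<sigma> x else x) p q else 0)"
  using assms by (auto simp: AH_connect_def words_def)

lemma connect_closed:
  assumes "f \<in> Car n"
  shows "Con n f \<in> Car (Suc n)"
  unfolding stage_carrier
proof (intro conjI allI impI)
  fix p q
  have f: "continuous_map X euclidean (\<lambda>x. f x p q)" for p q using assms by (simp add: stage_carrier)
  have "continuous_map X euclidean (\<lambda>x. f (if last p then \<sigma> x else x) (butlast p) (butlast q))"
    using f[of "butlast p" "butlast q"] continuous_map_compose[OF sigma_cont f[of "butlast p" "butlast q"]]
    by (cases "last p") (auto simp: o_def)
  then have "continuous_map X euclidean (\<lambda>x. if p \<in> words (Suc n) \<and> q \<in> words (Suc n) \<and> last p = last q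
      then f (if last p then \<sigma> x else x) (butlast p) (butlast q) else 0)" by auto
  then show "continuous_map X euclidean (\<lambda>x. Con n f x p q)"
    by (rule continuous_map_eq) (auto simp: AH_connect_def)
qed (auto simp: AH_connect_def split: if_splits)

lemma connect_mult:
  "Con n (mul n f g) = mul (Suc n) (Con n f) (Con n g)"
proof (intro ext)
  fix x p q
  show "Con n (mul n f g) x p q = mul (Suc n) (Con n f) (Con n g) x p q"
  proof (cases "x \<in> Xc \<and> p \<in> words (Suc n) \<and> q \<in> words (Suc n)")
    case True
    then obtain p' b q' c where "p = p' @ [b]" "p' \<in> words n" "q = q' @ [c]" "q' \<in> words n"
      by (metis words_Suc_cases)
    then show ?thesis using True by (auto simp: stage_ops connect_snoc sum_words_Suc)
  next
    case False
    then show ?thesis by (auto simp: stage_ops AH_connect_def)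
  qed
qed

text \<open>The words with last letter \<open>b\<close> span a block on which the image of
  \<open>f\<close> acts as \<open>f\<close> itself or as \<open>f\<close> composed with
  \<open>\<sigma>\<close>.\<close>

lemma mv_connect:
  assumes "x \<in> Xc" "p \<in> words n"
  shows "mv (Suc n) (Con n f x) v (p @ [b]) = mv n (f (if b then \<sigma> x else x)) (\<lambda>q. v (q @ [b])) p"
  using assms by (cases b) (auto simp: mv_def sum_words_Suc connect_snoc)

lemma connect_norm:
  assumes "f \<in> Car n"
  shows "nm (Suc n) (Con n f) = nm n f"
proof (rule antisym)
  let ?K = "nm n f"
  have K: "0 \<le> ?K" by (rule stage_norm_nonneg[OF assms])
  \<comment> \<open>Both blocks obey the bound of \<open>f\<close>, and their squared norms add
    up.\<close>
  show "nm (Suc n) (Con n f) \<le> ?K"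
  proof (rule stage_norm_least[OF K])
    fix x v assume x: "x \<in> Xc"
    let ?w = "mv (Suc n) (Con n f x) v"
    have *: "(vnorm n (\<lambda>p. ?w (p @ [b])))\<^sup>2 \<le> ?K\<^sup>2 * (vnorm n (\<lambda>q. v (q @ [b])))\<^sup>2" for b
    proof -
      have "vnorm n (\<lambda>p. ?w (p @ [b])) = vnorm n (mv n (f (if b then \<sigma> x else x)) (\<lambda>q. v (q @ [b])))"
        by (rule vnorm_cong) (simp add: mv_connect x)
      also have "\<dots> \<le> ?K * vnorm n (\<lambda>q. v (q @ [b]))"
        by (rule stage_norm_bound[OF assms]) (use x in auto)
      finally show ?thesis by (metis power_mono power_mult_distrib vnorm_nonneg)
    qed
    have "(vnorm (Suc n) ?w)\<^sup>2 \<le> (?K * vnorm (Suc n) v)\<^sup>2"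
      using *[of False] *[of True] by (simp add: vnorm_Suc power_mult_distrib algebra_simps)
    then show "vnorm (Suc n) ?w \<le> ?K * vnorm (Suc n) v"
      by (rule power2_le_imp_le) (use K in auto)
  qed
next
  let ?K = "nm (Suc n) (Con n f)"
  have K: "0 \<le> ?K" by (rule stage_norm_nonneg[OF connect_closed[OF assms]])
  show "nm n f \<le> ?K"
  proof (rule stage_norm_least[OF K])
    fix x v assume x: "x \<in> Xc"
    \<comment> \<open>Puts \<open>v\<close> into the block of words ending in 0, where the untwisted
      \<open>f\<close> acts; this recovers the norm of \<open>f\<close>.\<close>
    define u :: "bool list \<Rightarrow> complex" where "u q = (if last q then 0 else v (butlast q))" for q
    let ?w = "mv (Suc n) (Con n f x) u"
    have z: "vnorm n (\<lambda>_. 0) = 0" by (simp add: vnorm_0_iff)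
    have u: "vnorm (Suc n) u = vnorm n v"
      using vnorm_Suc[of n u] by (simp add: u_def z)
    have w: "vnorm n (\<lambda>p. ?w (p @ [False])) = vnorm n (mv n (f x) v)"
      by (rule vnorm_cong) (simp add: mv_connect x, simp add: u_def)
    have "(vnorm n (\<lambda>p. ?w (p @ [False])))\<^sup>2 \<le> (vnorm (Suc n) ?w)\<^sup>2"
      by (simp add: vnorm_Suc)
    then have "vnorm n (mv n (f x) v) \<le> vnorm (Suc n) ?w"
      unfolding w by (rule power2_le_imp_le) simp
    also have "\<dots> \<le> ?K * vnorm n v"
      using stage_norm_bound[OF connect_closed[OF assms] x, of u] u by simp
    finally show "vnorm n (mv n (f x) v) \<le> ?K * vnorm n v" .
  qed
qed

lemma stage_system: "normed_star_system St Con"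
proof
  fix n and f g f' g' :: "'x fmat" and c
  let ?C = "Car n" and ?d = "\<lambda>f g. nm n (df n f g)"
  show "cs_zero (St n) \<in> ?C" by (simp add: stage_carrier stage_ops)
  show "Con n (cs_add (St n) f g) = cs_add (St (Suc n)) (Con n f) (Con n g)"
    "Con n (cs_scale (St n) c f) = cs_scale (St (Suc n)) c (Con n f)"
    "Con n (adj n f) = adj (Suc n) (Con n f)"
    by (auto simp: stage_ops AH_connect_def fun_eq_iff)
  show "Con n (mul n f g) = mul (Suc n) (Con n f) (Con n g)"
    by (rule connect_mult)
  assume f: "f \<in> ?C"
  show "cs_scale (St n) c f \<in> ?C" "adj n f \<in> ?C" "Con n f \<in> Car (Suc n)" "nm (Suc n) (Con n f) = nm n f"
    by (rule stage_scale_closed stage_star_closed connect_closed connect_norm; fact)+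
  have z: "nm n (\<lambda>x p q. 0) = 0"
    by (rule antisym[OF stage_diagonal_norm_le stage_norm_nonneg]) (auto simp: stage_carrier)
  then show "?d f f = 0" by (simp add: stage_ops)
  assume g: "g \<in> ?C"
  note fg = stage_diff_closed[OF f g] and gf = stage_diff_closed[OF g f]
  show "cs_add (St n) f g \<in> ?C" "mul n f g \<in> ?C"
    by (rule stage_add_closed stage_mult_closed; fact)+
  show comm: "?d f g = ?d g f"
    using stage_norm_scale[OF gf, of "df n f g" "-1"] stage_norm_scale[OF fg, of "df n g f" "-1"]
    by (simp add: stage_ops)
  show "\<bar>nm n f - nm n g\<bar> \<le> ?d f g"
    using stage_norm_add[OF fg g, of f] stage_norm_add[OF gf f, of g] comm by (simp add: stage_ops)
  show "nm n (df n (cs_scale (St n) c f) (cs_scale (St n) c g))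
      \<le> cmod c * ?d f g"
    by (rule stage_norm_scale[OF fg]) (simp add: stage_ops algebra_simps)
  have "df n (adj n f) (adj n g) = adj n (df n f g)"
    by (simp add: stage_ops)
  then show "nm n (df n (adj n f) (adj n g))
      \<le> ?d f g"
    using stage_norm_star[OF fg] by simp
  assume f': "f' \<in> ?C"
  show "?d f f' \<le> ?d f g + ?d g f'"
    by (rule stage_norm_add[OF fg stage_diff_closed[OF g f']]) (simp add: stage_ops)
  assume g': "g' \<in> ?C"
  note ff' = stage_diff_closed[OF f f'] and gg' = stage_diff_closed[OF g g']
  show "nm n (df n (cs_add (St n) f g) (cs_add (St n) f' g'))
    \<le> ?d f f' + ?d g g'"
    by (rule stage_norm_add[OF ff' gg']) (simp add: stage_ops)
  \<comment> \<open>Splits \<open>fg - f'g'\<close> as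
    \<open>f(g - g') + (f - f')g'\<close>.\<close>
  have "nm n (df n (mul n f g) (mul n f' g'))
    \<le> nm n (mul n f (df n g g')) + nm n (mul n (df n f f') g')"
    by (rule stage_norm_add[OF stage_mult_closed[OF f gg'] stage_mult_closed[OF ff' g']])
      (simp add: stage_ops algebra_simps sum_subtractf)
  then show "nm n (df n (mul n f g) (mul n f' g'))
    \<le> nm n f * ?d g g' + ?d f f' * nm n g'"
    using stage_norm_mult[OF f gg'] stage_norm_mult[OF ff' g'] by linarith
qed

end

section \<open>Diagonal matrix coefficients on the limit\<close>

text \<open>The exponent of \<open>\<sigma>\<close> accumulated along a word: each letter 1
  contributes one application.\<close>

definition ones :: "bool list \<Rightarrow> nat" where
  "ones p = length (filter id p)"

lemma ones_simps [simp]: "ones [] = 0" "ones (b # p) = of_bool b + ones p" "ones (p @ q) = ones p + ones q"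
  by (auto simp: ones_def)

lemma length_prefix_of [simp]: "length (prefix_of n t) = n"
  by (simp add: prefix_of_def)

lemma prefix_of_in_words [simp]: "prefix_of n t \<in> words n"
  by (simp add: words_def)

lemma prefix_of_Suc: "prefix_of (Suc n) t = prefix_of n t @ [t n]"
  by (simp add: prefix_of_def)

lemma prefix_of_eq_iff: "prefix_of n t = prefix_of n s \<longleftrightarrow> (\<forall>i<n. t i = s i)"
  by (auto simp: prefix_of_def)

lemma take_prefix_of [simp]: "n \<le> m \<Longrightarrow> take n (prefix_of m t) = prefix_of n t"
  by (simp add: prefix_of_def take_map)

lemma prefix_of_split: "prefix_of (n + k) t = prefix_of n t @ drop n (prefix_of (n + k) t)"
  by (metis append_take_drop_id le_add1 take_prefix_of)

text \<open>Continues a word by zeros; it supplies a sample point in every cylinder.\<close>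

definition ext :: "bool list \<Rightarrow> nat \<Rightarrow> bool" where
  "ext p i \<longleftrightarrow> i < length p \<and> p ! i"

lemma prefix_of_ext: "n \<le> length p \<Longrightarrow> prefix_of n (ext p) = take n p"
  by (rule nth_equalityI) (auto simp: prefix_of_def ext_def)

lemma prefix_of_ext_prefix: "N \<le> n \<Longrightarrow> prefix_of N (ext (prefix_of n t)) = prefix_of N t"
  by (simp add: prefix_of_ext)

lemma topspace_cantor [simp]: "topspace cantor = UNIV"
  by (simp add: cantor_def)

lemma openin_cantor_coordinate: "openin cantor {t. t i = b}"
proof -
  have "continuous_map cantor (discrete_topology UNIV) (\<lambda>t. t i)"
    unfolding cantor_def using continuous_map_product_coordinates[of i UNIV "\<lambda>_. discrete_topology UNIV"] by simp
  then have "openin cantor {t \<in> topspace cantor. t i \<in> {b}}"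
    by (rule openin_continuous_map_preimage) simp
  then show ?thesis by simp
qed

lemma openin_cylinder: "openin cantor {t. prefix_of n t = p}"
proof (induction n arbitrary: p)
  case 0
  have "openin cantor (if p = [] then topspace cantor else {})" by (auto simp del: topspace_cantor)
  then show ?case by (auto simp: prefix_of_def split: if_splits)
next
  case (Suc n)
  have "{t. prefix_of (Suc n) t = p} = (if p = [] then {} else
      {t. prefix_of n t = butlast p} \<inter> {t. t n = last p})"
    by (cases p rule: rev_cases) (auto simp: prefix_of_Suc)
  then show ?case using Suc openin_cantor_coordinate by auto
qed

lemma openin_cantor_cylinder_subset:
  assumes "openin cantor U" "t \<in> U"
  obtains n where "\<And>s. prefix_of n s = prefix_of n t \<Longrightarrow> s \<in> U"
proof -
  have "\<forall>t\<in>U. \<exists>V. finite {i \<in> UNIV. V i \<noteq> topspace (discrete_topology UNIV)} \<and>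
      (\<forall>i\<in>UNIV. openin (discrete_topology UNIV) (V i)) \<and> t \<in> Pi\<^sub>E UNIV V \<and> Pi\<^sub>E UNIV V \<subseteq> U"
    using assms(1) unfolding cantor_def openin_product_topology_alt .
  from bspec[OF this assms(2)]
  obtain V where V: "finite {i. V i \<noteq> (UNIV :: bool set)}" "t \<in> Pi\<^sub>E UNIV V" "Pi\<^sub>E UNIV V \<subseteq> U"
    by (elim exE conjE) simp
  obtain n where n: "\<And>i. V i \<noteq> UNIV \<Longrightarrow> i < n"
    using V(1) unfolding finite_nat_set_iff_bounded by blast
  have "s \<in> U" if "prefix_of n s = prefix_of n t" for s
  proof -
    have "s i \<in> V i" for i
      using that n[of i] V(2) by (cases "V i = UNIV") (auto simp: prefix_of_eq_iff)
    then have "s \<in> Pi\<^sub>E UNIV V" by (simp add: PiE_iff)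
    then show ?thesis using V(3) by blast
  qed
  then show ?thesis using that by blast
qed

lemma compact_space_cantor: "compact_space cantor"
  unfolding cantor_def by (simp add: compact_space_product_topology compact_space_discrete_topology)

lemma Hausdorff_space_cantor: "Hausdorff_space cantor"
  unfolding cantor_def by (simp add: Hausdorff_space_product_topology)

context dynamical_system
begin

sublocale sys: normed_star_system "AH_stage X" "AH_connect X \<sigma>" "\<lambda>n. cs_carrier (AH_stage X n)"
    "\<lambda>n. cs_norm (AH_stage X n)" "\<lambda>n a b. cs_norm (AH_stage X n) (cs_diff (AH_stage X n) a b)"
  by (rule stage_system)

abbreviation "LA \<equiv> sys.LA"
abbreviation "CA \<equiv> cs_carrier LA"

lemma pow_in [simp]: "x \<in> Xc \<Longrightarrow> (\<sigma> ^^ k) x \<in> Xc"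
  and powi_in [simp]: "x \<in> Xc \<Longrightarrow> (\<sigma>i ^^ k) x \<in> Xc"
  by (induction k; simp)+

lemma pow_powi [simp]: "x \<in> Xc \<Longrightarrow> (\<sigma> ^^ k) ((\<sigma>i ^^ k) x) = x"
  by (induction k arbitrary: x) (auto simp: funpow_swap1)

lemma powi_pow [simp]: "x \<in> Xc \<Longrightarrow> (\<sigma>i ^^ k) ((\<sigma> ^^ k) x) = x"
  by (induction k arbitrary: x) (auto simp: funpow_swap1)

lemma pow_cont: "continuous_map X X (\<sigma> ^^ k)" and powi_cont: "continuous_map X X (\<sigma>i ^^ k)"
  by (induction k) (auto intro: continuous_map_compose sigma_cont sigmai_cont)

text \<open>Iterating the connecting map gives a block diagonal matrix whose blocks are labelled by
  the appended word \<open>drop n p\<close>; the block of that word is \<open>f\<close> composed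
  with \<open>\<sigma>\<close> to the number of its ones.\<close>

lemma connect_explicit:
  assumes "f \<in> Car n"
  shows "sys.con n k f x p q = (if x \<in> Xc \<and> p \<in> words (n + k) \<and> q \<in> words (n + k) \<and>
    drop n p = drop n q then f ((\<sigma> ^^ ones (drop n p)) x) (take n p) (take n q) else 0)"
proof (induction k arbitrary: x p q)
  case 0
  have "f x p q = 0" if "\<not> (x \<in> Xc \<and> p \<in> words n \<and> q \<in> words n)"
    using assms that unfolding stage_carrier by blast
  then show ?case by (auto simp: words_def)
next
  case (Suc k)
  show ?case
  proof (cases "x \<in> Xc \<and> p \<in> words (Suc (n + k)) \<and> q \<in> words (Suc (n + k))")
    case True
    then obtain p' b q' c where pq: "p = p' @ [b]" "p' \<in> words (n + k)" "q = q' @ [c]" "q' \<in> words (n + k)"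
      by (metis words_Suc_cases)
    then show ?thesis using True
      by (auto simp: connect_snoc Suc.IH words_def funpow_swap1)
  next
    case False
    then show ?thesis by (auto simp: AH_connect_def)
  qed
qed

abbreviation Y :: "((nat \<Rightarrow> bool) \<times> 'x) topology" where
  "Y \<equiv> prod_topology cantor X"

abbreviation "Yc \<equiv> topspace Y"
abbreviation "pre n y \<equiv> prefix_of n (fst y)"

lemma topspace_Y: "y \<in> Yc \<longleftrightarrow> snd y \<in> Xc"
  by (cases y) auto

lemma compact_Y: "compact_space Y"
  using compact compact_space_cantor by (simp add: compact_space_prod_topology)

lemma Hausdorff_Y: "Hausdorff_space Y"
  using Hausdorff Hausdorff_space_cantor by (simp add: Hausdorff_space_prod_topology)

text \<open>The cylinders of a fixed length are finitely many disjoint clopen sets covering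
  \<open>Y\<close>, so a formula chosen by the prefix is continuous when each of its cases
  is.\<close>

lemma continuous_map_cylinders:
  assumes "\<And>p. p \<in> words n \<Longrightarrow> continuous_map Y Z (h p)"
  shows "continuous_map Y Z (\<lambda>y. h (pre n y) y)"
  unfolding continuous_map_def
proof (intro conjI allI impI)
  show "(\<lambda>y. h (pre n y) y) \<in> Yc \<rightarrow> topspace Z"
    using assms prefix_of_in_words by (auto simp: continuous_map_def Pi_iff simp del: prefix_of_in_words)
next
  fix U assume U: "openin Z U"
  have "openin Y {y \<in> Yc. fst y \<in> {t. prefix_of n t = p}}" for p
    by (rule openin_continuous_map_preimage[OF continuous_map_fst openin_cylinder])
  then have "openin Y ({y \<in> Yc. fst y \<in> {t. prefix_of n t = p}} \<inter> {y \<in> Yc. h p y \<in> U})"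
    if "p \<in> words n" for p
    using openin_continuous_map_preimage[OF assms[OF that] U] by (rule openin_Int)
  then have "openin Y (\<Union>p\<in>words n. {y \<in> Yc. fst y \<in> {t. prefix_of n t = p}} \<inter> {y \<in> Yc. h p y \<in> U})"
    by (intro openin_Union) blast
  also have "\<dots> = {y \<in> Yc. h (pre n y) y \<in> U}"
    by auto
  finally show "openin Y {y \<in> Yc. h (pre n y) y \<in> U}" .
qed

text \<open>A point \<open>(t, x)\<close> of \<open>Y\<close> stands for the character with stage-\<open>0\<close> coordinate \<open>x\<close>
  (the second component of \<open>b_map\<close> is the stage-\<open>1\<close> coordinate); \<open>pt n\<close> is its stage-\<open>n\<close> coordinate.\<close>

definition pt :: "nat \<Rightarrow> (nat \<Rightarrow> bool) \<times> 'x \<Rightarrow> 'x" where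
  "pt n y = (\<sigma>i ^^ ones (pre n y)) (snd y)"

lemma pt_in [simp]: "y \<in> Yc \<Longrightarrow> pt n y \<in> Xc"
  by (auto simp: pt_def)

text \<open>The coherence relation of the projective limit: going back from stage
  \<open>n + k\<close> to stage \<open>n\<close> applies \<open>\<sigma>\<close> once per 1 among
  the digits in between.\<close>

lemma pt_shift:
  assumes "y \<in> Yc"
  shows "(\<sigma> ^^ ones (drop n (pre (n + k) y))) (pt (n + k) y) = pt n y"
proof -
  have "ones (pre (n + k) y) = ones (drop n (pre (n + k) y)) + ones (pre n y)"
    by (subst prefix_of_split) simp
  then show ?thesis using assms by (auto simp: pt_def funpow_add)
qed

definition entry :: "(nat \<Rightarrow> bool) \<times> 'x \<Rightarrow> (nat \<Rightarrow> 'x fmat) \<Rightarrow> nat \<Rightarrow> complex" where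
  "entry y a n = a n (pt n y) (pre n y) (pre n y)"

text \<open>The character belonging to \<open>y\<close> composed with the conditional expectation
  onto the diagonal. It is thus available on all of \<open>A\<close>, also for products whose
  membership in the diagonal is still open.\<close>

definition ev :: "(nat \<Rightarrow> bool) \<times> 'x \<Rightarrow> (nat \<Rightarrow> 'x fmat) set \<Rightarrow> complex" where
  "ev y U = lim (entry y (limit_rep U))"

lemma entry_diff_le:
  assumes "a n \<in> Car n" "b n \<in> Car n" "y \<in> Yc"
  shows "cmod (entry y a n - entry y b n) \<le> nm n (df n (a n) (b n))"
  using stage_entry_bound[OF stage_diff_closed[OF assms(1,2)], of "pt n y" "pre n y" "pre n y"]
    assms(3) by (simp add: entry_def stage_ops)

lemma connect_entry:
  assumes "f \<in> Car n" "y \<in> Yc"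
  shows "sys.con n k f (pt (n + k) y) (pre (n + k) y) (pre (n + k) y) =
    f (pt n y) (pre n y) (pre n y)"
  using assms by (simp add: connect_explicit pt_shift)

text \<open>The bound is uniform in \<open>y\<close> because every entry is dominated by the
  operator norm; this uniformity is what makes \<open>ev\<close> continuous in
  \<open>y\<close>.\<close>

lemma entry_coherent:
  assumes "a \<in> sys.LS" "\<epsilon> > 0"
  obtains N where "\<And>n k y. n \<ge> N \<Longrightarrow> y \<in> Yc \<Longrightarrow> cmod (entry y a (n + k) - entry y a n) < \<epsilon>"
proof -
  obtain N where N: "\<And>n k. n \<ge> N \<Longrightarrow> nm (n+k) (df (n+k) (a (n + k)) (sys.con n k (a n))) < \<epsilon>"
    by (rule sys.LS_coherent[OF assms]) blast
  show ?thesis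
  proof (rule that[of N])
    fix n k y assume n: "n \<ge> N" and y: "y \<in> Yc"
    have an: "a n \<in> Car n" by (rule sys.LS_car[OF assms(1)])
    have "entry y a n = entry y (\<lambda>_. sys.con n k (a n)) (n + k)"
      using connect_entry[OF an y] by (simp add: entry_def)
    then show "cmod (entry y a (n + k) - entry y a n) < \<epsilon>"
      using entry_diff_le[of a "n + k" "\<lambda>_. sys.con n k (a n)" y] N[OF n, of k]
        sys.LS_car[OF assms(1)] sys.con_closed[OF an] y by fastforce
  qed
qed

lemma entry_convergent:
  assumes "a \<in> sys.LS" "y \<in> Yc"
  shows "convergent (entry y a)"
proof -
  have "Cauchy (entry y a)"
  proof (rule metric_CauchyI)
    fix e :: real assume "e > 0"
    then obtain N where N: "\<And>n k y. n \<ge> N \<Longrightarrow> y \<in> Yc \<Longrightarrow> cmod (entry y a (n + k) - entry y a n) < e/2"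
      by (rule entry_coherent[OF assms(1) half_gt_zero]) blast
    have *: "dist (entry y a m) (entry y a N) < e/2" if "m \<ge> N" for m
      using N[of N y "m - N"] that assms(2) by (simp add: dist_norm)
    show "\<exists>M. \<forall>m\<ge>M. \<forall>n\<ge>M. dist (entry y a m) (entry y a n) < e"
      using dist_triangle_half_l[OF * *] by blast
  qed
  then show ?thesis by (simp add: Cauchy_convergent)
qed

lemma entry_tendsto:
  assumes "a \<in> sys.LS" "y \<in> Yc"
  shows "entry y a \<longlonglongrightarrow> ev y (sys.cls a)"
proof -
  let ?r = "limit_rep (sys.cls a)"
  have n: "sys.near a ?r" by (rule sys.limit_rep_near[OF assms(1)])
  then have r: "?r \<in> sys.LS" by (simp add: sys.near_def)
  have lim: "entry y ?r \<longlonglongrightarrow> ev y (sys.cls a)"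
    using entry_convergent[OF r assms(2)] by (simp add: ev_def convergent_LIMSEQ_iff)
  have "(\<lambda>n. entry y a n - entry y ?r n) \<longlonglongrightarrow> 0"
  proof (rule Lim_null_comparison)
    show "\<forall>\<^sub>F n in sequentially. cmod (entry y a n - entry y ?r n) \<le> nm n (df n (a n) (?r n))"
      by (intro always_eventually allI entry_diff_le sys.LS_car assms r)
    show "(\<lambda>n. nm n (df n (a n) (?r n))) \<longlonglongrightarrow> 0" using n by (simp add: sys.near_def)
  qed
  from tendsto_add[OF this lim] show ?thesis by simp
qed

lemma entry_uniform:
  assumes "a \<in> sys.LS" "\<epsilon> > 0"
  obtains N where "\<And>n y. n \<ge> N \<Longrightarrow> y \<in> Yc \<Longrightarrow> cmod (ev y (sys.cls a) - entry y a n) \<le> \<epsilon>"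
proof -
  obtain N where N: "\<And>n k y. n \<ge> N \<Longrightarrow> y \<in> Yc \<Longrightarrow> cmod (entry y a (n + k) - entry y a n) < \<epsilon>"
    by (rule entry_coherent[OF assms]) blast
  have "cmod (ev y (sys.cls a) - entry y a n) \<le> \<epsilon>" if "n \<ge> N" and y: "y \<in> Yc" for n y
  proof (rule tendsto_le[OF sequentially_bot tendsto_const])
    have "(\<lambda>k. entry y a (k + n)) \<longlonglongrightarrow> ev y (sys.cls a)"
      using entry_tendsto[OF assms(1) y] by (rule LIMSEQ_ignore_initial_segment)
    then show "(\<lambda>k. cmod (entry y a (k + n) - entry y a n)) \<longlonglongrightarrow> cmod (ev y (sys.cls a) - entry y a n)"
      by (intro tendsto_intros)
    show "\<forall>\<^sub>F k in sequentially. cmod (entry y a (k + n) - entry y a n) \<le> \<epsilon>"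
      using N[OF that] by (intro always_eventually allI) (metis add.commute less_imp_le)
  qed
  then show ?thesis using that by blast
qed

lemma pt_cont: "continuous_map Y X (pt n)"
proof -
  have "continuous_map Y X (\<lambda>y. (\<lambda>p y. (\<sigma>i ^^ ones p) (snd y)) (pre n y) y)"
    by (rule continuous_map_cylinders)
      (use continuous_map_compose[OF continuous_map_snd powi_cont] in \<open>auto simp: o_def\<close>)
  then show ?thesis by (simp add: pt_def[abs_def])
qed

lemma entry_cont:
  assumes "a n \<in> Car n"
  shows "continuous_map Y euclidean (\<lambda>y. entry y a n)"
proof -
  have "continuous_map Y euclidean (\<lambda>y. (\<lambda>p y. a n (pt n y) p p) (pre n y) y)"
  proof (rule continuous_map_cylinders)
    fix p
    have "continuous_map X euclidean (\<lambda>x. a n x p p)" using assms by (simp add: stage_carrier)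
    from continuous_map_compose[OF pt_cont this]
    show "continuous_map Y euclidean (\<lambda>y. a n (pt n y) p p)" by (simp add: o_def)
  qed
  then show ?thesis by (simp add: entry_def)
qed

lemma ev_cont:
  assumes "U \<in> CA"
  shows "continuous_map Y euclidean (\<lambda>y. ev y U)"
proof -
  obtain a where a: "a \<in> sys.LS" "U = sys.cls a" using assms by (rule sys.LA_cases)
  have "continuous_map Y (Met_TC.mtopology) (\<lambda>y. ev y U)"
  proof (rule Met_TC.continuous_map_uniform_limit[where F = sequentially and f = "\<lambda>n y. entry y a n"])
    show "\<forall>\<^sub>F n in sequentially. continuous_map Y Met_TC.mtopology (\<lambda>y. entry y a n)"
      using entry_cont sys.LS_car[OF a(1)] by simp
    fix e :: real assume "e > 0"
    then obtain N where "\<And>n y. n \<ge> N \<Longrightarrow> y \<in> Yc \<Longrightarrow> cmod (ev y (sys.cls a) - entry y a n) \<le> e/2"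
      by (rule entry_uniform[OF a(1) half_gt_zero]) blast
    then have *: "\<forall>y\<in>Yc. dist (entry y a n) (ev y U) < e" if "n \<ge> N" for n
      using that \<open>e > 0\<close> a(2) by (fastforce simp: dist_norm norm_minus_commute)
    then show "\<forall>\<^sub>F n in sequentially. \<forall>y\<in>Yc. ev y U \<in> UNIV \<and> dist (entry y a n) (ev y U) < e"
      unfolding eventually_sequentially by auto
  qed auto
  then show ?thesis by simp
qed

lemma ev_eqI:
  assumes "a \<in> sys.LS" "y \<in> Yc" "entry y a \<longlonglongrightarrow> l"
  shows "ev y (sys.cls a) = l"
  using entry_tendsto[OF assms(1,2)] assms(3) by (rule LIMSEQ_unique)

section \<open>The diagonal as an algebra of continuous functions\<close>

definition Cont :: "((nat \<Rightarrow> bool) \<times> 'x \<Rightarrow> complex) set" where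
  "Cont = {g. continuous_map Y euclidean g}"

lemma Cont_const [simp]: "(\<lambda>_. c) \<in> Cont"
  by (simp add: Cont_def)

lemma Cont_add: "g \<in> Cont \<Longrightarrow> h \<in> Cont \<Longrightarrow> (\<lambda>y. g y + h y) \<in> Cont"
  by (simp add: Cont_def continuous_map_add)

lemma Cont_mult: "g \<in> Cont \<Longrightarrow> h \<in> Cont \<Longrightarrow> (\<lambda>y. g y * h y) \<in> Cont"
  by (simp add: Cont_def continuous_map_cmult)

lemma Cont_cnj: "g \<in> Cont \<Longrightarrow> (\<lambda>y. cnj (g y)) \<in> Cont"
  by (simp add: Cont_def continuous_map_cnj)

lemma Cont_inverse:
  assumes "g \<in> Cont" "\<And>y. y \<in> Yc \<Longrightarrow> g y \<noteq> 0"
  shows "(\<lambda>y. inverse (g y)) \<in> Cont"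
  using assms by (simp add: Cont_def continuous_map_atin tendsto_inverse)

text \<open>By compactness finitely many boxes, cylinder times open set, control the oscillation, so
  up to \<open>e\<close> a continuous function depends on a finite prefix only, uniformly over
  \<open>X\<close>.\<close>

lemma Cont_uniform:
  assumes g: "g \<in> Cont" and e: "e > 0"
  obtains N where "\<And>t s x. x \<in> Xc \<Longrightarrow> prefix_of N t = prefix_of N s \<Longrightarrow> cmod (g (t, x) - g (s, x)) < e"
proof -
  define good where "good n W \<longleftrightarrow> openin Y W \<and> (\<forall>t x s. (t, x) \<in> W \<longrightarrow>
      prefix_of n t = prefix_of n s \<longrightarrow> cmod (g (t, x) - g (s, x)) < e)" for n W
  have "\<exists>W n. good n W \<and> y \<in> W" if y: "y \<in> Yc" for y
  proof -
    obtain t0 x0 where y0: "y = (t0, x0)" by (cases y)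
    have "openin Y {z \<in> Yc. g z \<in> ball (g y) (e/2)}"
      using g unfolding Cont_def by (intro openin_continuous_map_preimage[where Y = euclidean]) auto
    moreover have "(t0, x0) \<in> {z \<in> Yc. g z \<in> ball (g y) (e/2)}" using y e by (simp add: y0)
    ultimately have "\<exists>U V. openin cantor U \<and> openin X V \<and> t0 \<in> U \<and> x0 \<in> V \<and>
      U \<times> V \<subseteq> {z \<in> Yc. g z \<in> ball (g y) (e/2)}"
      by (simp only: openin_prod_topology_alt)
    then obtain U V where UV: "openin cantor U" "openin X V" "t0 \<in> U" "x0 \<in> V"
      "U \<times> V \<subseteq> {z \<in> Yc. g z \<in> ball (g y) (e/2)}"
      by (elim exE conjE)
    obtain n where n: "\<And>s. prefix_of n s = prefix_of n t0 \<Longrightarrow> s \<in> U"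
      by (rule openin_cantor_cylinder_subset[OF UV(1,3)]) blast
    \<comment> \<open>Shrinking \<open>U\<close> to a cylinder makes membership in \<open>W\<close>
      invariant under changes beyond the first \<open>n\<close> digits.\<close>
    define W where "W = {t. prefix_of n t = prefix_of n t0} \<times> V"
    have "openin Y W" unfolding W_def using openin_cylinder UV(2) by (simp add: openin_prod_Times_iff)
    moreover have "cmod (g (t, x) - g (s, x)) < e"
      if "(t, x) \<in> W" "prefix_of n t = prefix_of n s" for t x s
    proof -
      have "(t, x) \<in> U \<times> V" "(s, x) \<in> U \<times> V" using that n by (auto simp: W_def)
      then have "g (t, x) \<in> ball (g y) (e/2)" "g (s, x) \<in> ball (g y) (e/2)" using UV(5) by blast+
      then show ?thesis using dist_triangle_half_r[of "g y" "g (t, x)" e "g (s, x)"]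
        by (simp add: dist_norm)
    qed
    ultimately have "good n W" unfolding good_def by blast
    moreover have "y \<in> W" using UV(4) by (simp add: W_def y0)
    ultimately show ?thesis by blast
  qed
  then have "Yc \<subseteq> \<Union>{W. \<exists>n. good n W}" by blast
  moreover have "\<forall>W\<in>{W. \<exists>n. good n W}. openin Y W" by (auto simp: good_def)
  ultimately obtain \<F> where \<F>: "finite \<F>" "\<F> \<subseteq> {W. \<exists>n. good n W}" "Yc \<subseteq> \<Union>\<F>"
    using compact_Y unfolding compact_space_alt by meson
  have "\<forall>W\<in>\<F>. \<exists>n. good n W" using \<F>(2) by blast
  then obtain n where n: "\<And>W. W \<in> \<F> \<Longrightarrow> good (n W) W" by metis
  define N where "N = Max (insert 0 (n ` \<F>))"
  show ?thesis
  proof (rule that[of N])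
    fix t s x assume x: "x \<in> Xc" and ts: "prefix_of N t = prefix_of N s"
    have "(t, x) \<in> Yc" using x by simp
    then obtain W where W: "W \<in> \<F>" "(t, x) \<in> W" using \<F>(3) by blast
    have "n W \<le> N" unfolding N_def using \<F>(1) W(1) by (intro Max_ge) auto
    then have "prefix_of (n W) t = prefix_of (n W) s" using ts by (auto simp: prefix_of_eq_iff)
    then show "cmod (g (t, x) - g (s, x)) < e" using n[OF W(1)] W(2) unfolding good_def by blast
  qed
qed

text \<open>Samples \<open>g\<close> at the point of the cylinder of \<open>p\<close> whose digits
  after \<open>p\<close> vanish and whose stage-\<open>n\<close> coordinate is \<open>x\<close>; the
  power of \<open>\<sigma>\<close> undoes the negative power in \<open>pt\<close>.\<close>

definition dg :: "((nat \<Rightarrow> bool) \<times> 'x \<Rightarrow> complex) \<Rightarrow> nat \<Rightarrow> 'x fmat" where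
  "dg g n x p q = (if x \<in> Xc \<and> p \<in> words n \<and> p = q then g (ext p, (\<sigma> ^^ ones p) x) else 0)"

text \<open>The inverse Gelfand map from continuous functions on \<open>Y\<close> to the diagonal;
  see \<open>ev_CC\<close> and \<open>D_eq\<close>.\<close>

definition CC :: "((nat \<Rightarrow> bool) \<times> 'x \<Rightarrow> complex) \<Rightarrow> (nat \<Rightarrow> 'x fmat) set" where
  "CC g = sys.cls (dg g)"

lemma dg_diag:
  assumes "g \<in> Cont"
  shows "dg g n \<in> diag_stage X n"
proof -
  have "continuous_map X euclidean (\<lambda>x. dg g n x p q)" for p q
  proof -
    have "continuous_map X Y (\<lambda>x. (ext p, (\<sigma> ^^ ones p) x))"
      by (intro continuous_map_pairedI pow_cont) simp
    from continuous_map_compose[OF this] assms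
    have "continuous_map X euclidean (\<lambda>x. g (ext p, (\<sigma> ^^ ones p) x))"
      by (auto simp: Cont_def o_def)
    then have "continuous_map X euclidean (\<lambda>x. if p \<in> words n \<and> p = q then g (ext p, (\<sigma> ^^ ones p) x) else 0)"
      by auto
    then show ?thesis by (rule continuous_map_eq) (auto simp: dg_def)
  qed
  then show ?thesis by (auto simp: diag_stage_def stage_carrier dg_def)
qed

lemma dg_car: "g \<in> Cont \<Longrightarrow> dg g n \<in> Car n"
  using dg_diag by (auto simp: diag_stage_def)

lemma connect_diagonal:
  assumes "f \<in> diag_stage X n"
  shows "sys.con n k f x p q = (if x \<in> Xc \<and> p \<in> words (n + k) \<and> p = q
    then f ((\<sigma> ^^ ones (drop n p)) x) (take n p) (take n p) else 0)"
proof -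
  have f: "f \<in> Car n" "\<And>x p q. p \<noteq> q \<Longrightarrow> f x p q = 0"
    using assms by (auto simp: diag_stage_def)
  have "p = q" if "drop n p = drop n q" "take n p = take n q"
    using that by (metis append_take_drop_id)
  then show ?thesis unfolding connect_explicit[OF f(1)] using f(2) by auto
qed

lemma pow_split: "(\<sigma> ^^ ones (take n p)) ((\<sigma> ^^ ones (drop n p)) x) = (\<sigma> ^^ ones p) x"
proof -
  have "ones p = ones (take n p) + ones (drop n p)" by (metis append_take_drop_id ones_simps(3))
  then show ?thesis by (simp add: funpow_add)
qed

text \<open>Pushing stage \<open>n\<close> forward to stage \<open>n + k\<close> replaces each
  sample point by one with the same first \<open>n\<close> digits and the same component in
  \<open>X\<close>. The error is diagonal, so uniform continuity in the prefix bounds its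
  norm.\<close>

lemma dg_LS:
  assumes "g \<in> Cont"
  shows "dg g \<in> sys.LS"
  unfolding sys.LS_iff
proof (intro conjI allI impI dg_car assms)
  fix e :: real assume e: "e > 0"
  obtain N where N: "\<And>t s x. x \<in> Xc \<Longrightarrow> prefix_of N t = prefix_of N s \<Longrightarrow> cmod (g (t, x) - g (s, x)) < e/2"
    by (rule Cont_uniform[OF assms half_gt_zero[OF e]]) blast
  show "\<exists>N. \<forall>n\<ge>N. \<forall>k. nm (n + k) (df (n + k) (dg g (n + k)) (sys.con n k (dg g n))) < e"
  proof (intro exI[of _ N] allI impI)
    fix n k assume n: "N \<le> n"
    have "nm (n + k) (df (n + k) (dg g (n + k)) (sys.con n k (dg g n))) \<le> e/2"
    proof (rule stage_diagonal_norm_le)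
      fix x p assume x: "x \<in> Xc" and p: "p \<in> words (n + k)"
      have "df (n + k) (dg g (n + k)) (sys.con n k (dg g n)) x p p
          = g (ext p, (\<sigma> ^^ ones p) x) - g (ext (take n p), (\<sigma> ^^ ones p) x)"
        using x p pow_split[of n p x] by (auto simp: stage_ops connect_diagonal[OF dg_diag[OF assms]] dg_def words_def)
      moreover have "prefix_of N (ext p) = prefix_of N (ext (take n p))"
        using n p by (simp add: prefix_of_ext words_def)
      ultimately show "cmod (df (n + k) (dg g (n + k)) (sys.con n k (dg g n)) x p p) \<le> e/2"
        using N[of "(\<sigma> ^^ ones p) x" "ext p" "ext (take n p)"] x by simp
    qed (use e in \<open>auto simp: stage_ops connect_diagonal[OF dg_diag[OF assms]] dg_def\<close>)
    then show "nm (n + k) (df (n + k) (dg g (n + k)) (sys.con n k (dg g n))) < e"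
      using e by linarith
  qed
qed

lemma entry_dg: "y \<in> Yc \<Longrightarrow> entry y (dg g) n = g (ext (pre n y), snd y)"
  by (auto simp: entry_def dg_def pt_def)

lemma ext_prefix_tendsto:
  assumes "g \<in> Cont" "y \<in> Yc"
  shows "(\<lambda>n. g (ext (pre n y), snd y)) \<longlonglongrightarrow> g y"
proof (rule metric_LIMSEQ_I)
  fix e :: real assume e: "e > 0"
  obtain N where N: "\<And>t s x. x \<in> Xc \<Longrightarrow> prefix_of N t = prefix_of N s \<Longrightarrow> cmod (g (t, x) - g (s, x)) < e"
    by (rule Cont_uniform[OF assms(1) e]) blast
  show "\<exists>no. \<forall>n\<ge>no. dist (g (ext (pre n y), snd y)) (g y) < e"
    using N[of "snd y" _ "fst y"] assms(2)
    by (intro exI[of _ N]) (auto simp: dist_norm prefix_of_ext_prefix topspace_Y)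
qed

lemma CC_in: "g \<in> Cont \<Longrightarrow> CC g \<in> CA"
  unfolding CC_def by (intro sys.cls_in dg_LS)

lemma ev_CC:
  assumes "g \<in> Cont" "y \<in> Yc"
  shows "ev y (CC g) = g y"
  unfolding CC_def
  by (rule ev_eqI[OF dg_LS[OF assms(1)] assms(2)])
    (use ext_prefix_tendsto[OF assms] in \<open>simp add: entry_dg[OF assms(2), abs_def]\<close>)

lemma CC_cong:
  assumes "\<And>y. y \<in> Yc \<Longrightarrow> g y = h y"
  shows "CC g = CC h"
proof -
  have "dg g = dg h" by (intro ext) (auto simp: dg_def assms)
  then show ?thesis by (simp add: CC_def)
qed

lemma CC_add: "g \<in> Cont \<Longrightarrow> h \<in> Cont \<Longrightarrow> cs_add LA (CC g) (CC h) = CC (\<lambda>y. g y + h y)"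
  unfolding CC_def by (subst sys.LA_add)
    (auto intro!: dg_LS arg_cong[of _ _ sys.cls] simp: stage_ops dg_def fun_eq_iff)

lemma CC_scale: "g \<in> Cont \<Longrightarrow> cs_scale LA c (CC g) = CC (\<lambda>y. c * g y)"
  unfolding CC_def by (subst sys.LA_scale)
    (auto intro!: dg_LS arg_cong[of _ _ sys.cls] simp: stage_ops dg_def fun_eq_iff)

lemma CC_star: "g \<in> Cont \<Longrightarrow> cs_star LA (CC g) = CC (\<lambda>y. cnj (g y))"
  unfolding CC_def by (subst sys.LA_star)
    (auto intro!: dg_LS arg_cong[of _ _ sys.cls] simp: stage_ops dg_def fun_eq_iff)

lemma CC_mult:
  assumes "g \<in> Cont" "h \<in> Cont"
  shows "cs_mult LA (CC g) (CC h) = CC (\<lambda>y. g y * h y)"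
proof -
  have "mul n (dg g n) (dg h n) x p q = dg (\<lambda>y. g y * h y) n x p q" for n x p q
  proof -
    have "mul n (dg g n) (dg h n) x p q = (\<Sum>r\<in>words n. if r = p then dg g n x p p * dg h n x p q else 0)"
      unfolding stage_ops by (rule sum.cong) (auto simp: dg_def)
    also have "\<dots> = dg (\<lambda>y. g y * h y) n x p q" by (auto simp: dg_def)
    finally show ?thesis .
  qed
  then have "(\<lambda>n. mul n (dg g n) (dg h n)) = dg (\<lambda>y. g y * h y)" by (intro ext)
  then show ?thesis unfolding CC_def using assms by (simp add: sys.LA_mult dg_LS)
qed

abbreviation D :: "(nat \<Rightarrow> 'x fmat) set set" where
  "D \<equiv> AH_diagonal X \<sigma>"

abbreviation "\<iota> \<equiv> AH_map X \<sigma>"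
abbreviation "mun \<equiv> mat_unit X \<sigma>"
abbreviation "cj \<equiv> conj_by LA"
abbreviation "Nor \<equiv> normalisers LA D"
abbreviation "\<alpha> \<equiv> weyl_map LA D"
abbreviation "dm \<equiv> weyl_dom LA D"

lemma AH_algebra_eq: "AH_algebra X \<sigma> = LA"
  by (simp add: AH_algebra_def)

lemma AH_map_eq: "\<iota> n f = sys.cls (sys.lift_seq n f)"
  by (simp add: AH_map_def sys.limit_map_eq)

lemma lift_seq_shift: "sys.lift_seq n f (n + k) = sys.con n k f"
  by (simp add: sys.lift_seq_def)

lemma CC_in_D:
  assumes "g \<in> Cont"
  shows "CC g \<in> D"
  unfolding AH_diagonal_def AH_algebra_eq
proof (intro CollectI conjI allI impI CC_in[OF assms])
  fix e :: real assume e: "e > 0"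
  obtain N where N: "\<And>n k. n \<ge> N \<Longrightarrow>
      nm (n + k) (df (n + k) (dg g (n + k)) (sys.con n k (dg g n))) < e/2"
    by (rule sys.LS_coherent[OF dg_LS[OF assms] half_gt_zero[OF e]]) blast
  have lift: "sys.lift_seq N (dg g N) \<in> sys.LS" by (intro sys.lift_seq_LS dg_car assms)
  have "cs_norm LA (cs_diff LA (CC g) (\<iota> N (dg g N))) \<le> e/2"
    unfolding AH_map_eq CC_def
  proof (rule LIMSEQ_le_const2[OF sys.LA_diff[OF dg_LS[OF assms] lift]], intro exI[of _ N] allI impI)
    fix n assume "N \<le> n"
    then obtain k where "n = N + k" by (metis le_Suc_ex)
    then show "nm n (df n (dg g n) (sys.lift_seq N (dg g N) n)) \<le> e/2"
      using N[of N k] by (simp add: lift_seq_shift)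
  qed
  then show "\<exists>n. \<exists>f\<in>diag_stage X n. cs_norm LA (cs_diff LA (CC g) (\<iota> n f)) < e"
    using e dg_diag[OF assms] by (intro exI[of _ N] bexI[of _ "dg g N"]) auto
qed

text \<open>For \<open>U\<close> in \<open>D\<close> the candidate is the function \<open>g\<close>
  of values \<open>ev y U\<close>. A diagonal stage element \<open>f\<close> near \<open>U\<close>
  has entries near the values of \<open>g\<close>; as \<open>f\<close> and the samples of
  \<open>g\<close> are both diagonal, nearness of entries is nearness in norm, and \<open>f\<close>
  links \<open>U\<close> to \<open>CC g\<close>.\<close>

lemma D_eq: "D = CC ` Cont"
proof (intro set_eqI iffI)
  fix U assume U: "U \<in> D"
  have U': "\<forall>\<epsilon>>0. \<exists>n. \<exists>f\<in>diag_stage X n. cs_norm LA (cs_diff LA U (\<iota> n f)) < \<epsilon>"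
    and UA: "U \<in> CA"
    using U unfolding AH_diagonal_def AH_algebra_eq by simp_all
  obtain a where a: "a \<in> sys.LS" "U = sys.cls a" using UA by (rule sys.LA_cases)
  define g where "g = (\<lambda>y. ev y U)"
  have g: "g \<in> Cont" using ev_cont[OF UA] by (simp add: Cont_def g_def)
  have "(\<lambda>m. nm m (df m (a m) (dg g m))) \<longlonglongrightarrow> 0"
  proof (rule metric_LIMSEQ_I)
    fix e :: real assume e: "e > 0"
    then have "e/3 > 0" by simp
    then obtain n f where f: "f \<in> diag_stage X n" "cs_norm LA (cs_diff LA U (\<iota> n f)) < e/3"
      using U' by blast
    have fc: "f \<in> Car n" using f(1) by (simp add: diag_stage_def)
    have lift: "sys.lift_seq n f \<in> sys.LS" by (rule sys.lift_seq_LS[OF fc])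
    have "(\<lambda>m. nm m (df m (a m) (sys.lift_seq n f m))) \<longlonglongrightarrow>
        cs_norm LA (cs_diff LA U (\<iota> n f))"
      unfolding AH_map_eq a(2) by (rule sys.LA_diff[OF a(1) lift])
    from order_tendstoD(2)[OF this f(2)] obtain M where
      M: "\<And>m. m \<ge> M \<Longrightarrow> nm m (df m (a m) (sys.lift_seq n f m)) < e/3"
      unfolding eventually_sequentially by blast
    let ?f = "\<lambda>y. f (pt n y) (pre n y) (pre n y)"
    \<comment> \<open>Entries are dominated by norms at each stage, and the bound survives the limit
      that defines \<open>g\<close>, the strict inequality becoming weak.\<close>
    have gf: "cmod (g y - ?f y) \<le> e/3" if y: "y \<in> Yc" for y
    proof (rule LIMSEQ_le_const2)
      show "(\<lambda>m. cmod (entry y a m - ?f y)) \<longlonglongrightarrow>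
          cmod (g y - ?f y)"
        unfolding g_def a(2) by (intro tendsto_intros entry_tendsto a(1) y)
      show "\<exists>N. \<forall>m\<ge>N. cmod (entry y a m - ?f y) \<le> e/3"
      proof (intro exI[of _ "max M n"] allI impI)
        fix m assume m: "max M n \<le> m"
        then obtain k where k: "m = n + k" by (metis le_Suc_ex max.bounded_iff)
        have "entry y (sys.lift_seq n f) m = ?f y"
          unfolding k entry_def lift_seq_shift by (rule connect_entry[OF fc y])
        then show "cmod (entry y a m - ?f y) \<le> e/3"
          using entry_diff_le[of a m "sys.lift_seq n f" y, OF sys.LS_car[OF a(1)] sys.LS_car[OF lift] y] M[of m] m
          by simp
      qed
    qed
    have fg: "nm m (df m (sys.lift_seq n f m) (dg g m)) \<le> e/3" if mn: "m \<ge> n" for m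
    proof (rule stage_diagonal_norm_le)
      obtain k where k: "m = n + k" using mn by (metis le_Suc_ex)
      fix x p assume x: "x \<in> Xc" and p: "p \<in> words m"
      \<comment> \<open>The sample point that \<open>dg g m\<close> uses at the entry
        \<open>p\<close>; its stage-\<open>n\<close> coordinate is the point at which the lifted
        \<open>f\<close> is read.\<close>
      let ?y = "(ext p, (\<sigma> ^^ ones p) x)"
      have "pt n ?y = (\<sigma> ^^ ones (drop n p)) x"
      proof -
        have "prefix_of n (fst ?y) = take n p" using mn p by (simp add: prefix_of_ext words_def)
        then have "pt n ?y = (\<sigma>i ^^ ones (take n p)) ((\<sigma> ^^ ones p) x)" by (simp add: pt_def)
        also have "\<dots> = (\<sigma>i ^^ ones (take n p)) ((\<sigma> ^^ ones (take n p)) ((\<sigma> ^^ ones (drop n p)) x))"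
          by (simp only: pow_split)
        finally show ?thesis using x by simp
      qed
      then have "df m (sys.lift_seq n f m) (dg g m) x p p =
        f (pt n ?y) (prefix_of n (fst ?y)) (prefix_of n (fst ?y)) - g ?y"
        using x p by (auto simp: k lift_seq_shift stage_ops connect_diagonal[OF f(1)] dg_def prefix_of_ext words_def)
      then show "cmod (df m (sys.lift_seq n f m) (dg g m) x p p) \<le> e/3"
        using gf[of ?y] x by (simp add: norm_minus_commute)
    next
      obtain k where k: "m = n + k" using mn by (metis le_Suc_ex)
      fix x p q assume "p \<noteq> (q :: bool list)"
      then show "df m (sys.lift_seq n f m) (dg g m) x p q = 0"
        by (auto simp: k lift_seq_shift stage_ops connect_diagonal[OF f(1)] dg_def)
    qed (use e in auto)
    show "\<exists>no. \<forall>m\<ge>no. dist (nm m (df m (a m) (dg g m))) 0 < e"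
    proof (intro exI[of _ "max M n"] allI impI)
      fix m assume m: "max M n \<le> m"
      have "nm m (df m (a m) (dg g m)) \<le> e/3 + e/3"
        using sys.dist_triangle[OF sys.LS_car[OF a(1)] sys.LS_car[OF lift] dg_car[OF g], of m] M[of m] fg[of m] m
        by simp
      then show "dist (nm m (df m (a m) (dg g m))) 0 < e"
        using e stage_norm_nonneg[OF stage_diff_closed[OF sys.LS_car[OF a(1)] dg_car[OF g]], of m]
        by simp
    qed
  qed
  then have "sys.near a (dg g)" using a(1) dg_LS[OF g] by (simp add: sys.near_def)
  then have "U = CC g" unfolding a(2) CC_def by (rule sys.cls_eqI)
  then show "U \<in> CC ` Cont" using g by blast
qed (auto intro: CC_in_D)

lemma D_sub: "U \<in> D \<Longrightarrow> U \<in> CA"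
  using CC_in by (auto simp: D_eq)

section \<open>Points of \<open>Y\<close> as the characters of the diagonal\<close>

lemma normal_Y: "normal_space Y"
  using compact_Hausdorff_or_regular_imp_normal_space compact_Y Hausdorff_Y by blast

lemma Cont_separation:
  assumes "y \<in> Yc" "F \<subseteq> Yc" "finite F" "y \<notin> F"
  obtains g where "(\<lambda>y. complex_of_real (g y)) \<in> Cont" "g y = 1" "\<And>z. z \<in> F \<Longrightarrow> g z = 0"
    "\<And>z. z \<in> Yc \<Longrightarrow> 0 \<le> g z \<and> g z \<le> 1"
proof -
  have "closedin Y F" "closedin Y {y}"
    using closedin_Hausdorff_finite[OF Hausdorff_Y] assms(1-3) by blast+
  moreover have "disjnt F {y}" using assms(4) by simp
  ultimately obtain g where g: "continuous_map Y (top_of_set {0..1::real}) g" "g ` F \<subseteq> {0}" "g ` {y} \<subseteq> {1}"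
    by (rule Urysohn_lemma[OF normal_Y, of F "{y}" 0 1]) auto
  have g': "continuous_map Y euclideanreal g" "\<And>z. z \<in> Yc \<Longrightarrow> g z \<in> {0..1}"
    using g(1) unfolding continuous_map_in_subtopology by blast+
  have "(\<lambda>y. complex_of_real (g y)) \<in> Cont"
    using g'(1) by (simp add: Cont_def continuous_map_atin tendsto_of_real)
  then show ?thesis using g g'(2) by (intro that[of g]) auto
qed

text \<open>Restricted to \<open>D\<close> because \<open>characters\<close> asks for extensional
  functions.\<close>

definition chi :: "(nat \<Rightarrow> bool) \<times> 'x \<Rightarrow> (nat \<Rightarrow> 'x fmat) set \<Rightarrow> complex" where
  "chi y = restrict (ev y) D"

lemma chi_CC: "g \<in> Cont \<Longrightarrow> y \<in> Yc \<Longrightarrow> chi y (CC g) = g y"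
  by (simp add: chi_def CC_in_D ev_CC)

lemma chi_in_characters:
  assumes y: "y \<in> Yc"
  shows "chi y \<in> characters LA D"
proof -
  have "\<exists>c\<in>D. chi y c \<noteq> 0"
    using chi_CC[OF Cont_const[of 1] y] CC_in_D[OF Cont_const[of 1]] by (intro bexI[of _ "CC (\<lambda>_. 1)"]) auto
  then show ?thesis unfolding characters_def D_eq
    using y by (auto simp: chi_CC CC_add CC_mult CC_scale CC_star Cont_add Cont_mult Cont_cnj)
      (auto simp: chi_def D_eq)
qed

lemma chi_inj:
  assumes "y \<in> Yc" "z \<in> Yc" "\<And>g. g \<in> Cont \<Longrightarrow> g y = g z"
  shows "y = z"
proof (rule ccontr)
  assume "y \<noteq> z"
  then obtain g where g: "(\<lambda>y. complex_of_real (g y)) \<in> Cont" "g y = 1" "\<And>w. w \<in> {z} \<Longrightarrow> g w = 0"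
    using assms(1,2) by (rule_tac Cont_separation[of y "{z}"]) auto
  show False using assms(3)[OF g(1)] g(2) g(3)[of z] by simp
qed

lemma chi_eq_iff:
  assumes "y \<in> Yc" "z \<in> Yc"
  shows "chi y = chi z \<longleftrightarrow> y = z"
proof
  assume *: "chi y = chi z"
  show "y = z"
  proof (rule chi_inj[OF assms])
    fix g assume g: "g \<in> Cont"
    show "g y = g z" using chi_CC[OF g assms(1)] chi_CC[OF g assms(2)] * by simp
  qed
qed simp

text \<open>If a character differed from every evaluation, a finite sum of squares \<open>\<Sum>f\<^sup>*f\<close> of elements of
  its kernel would be nowhere zero on the compact space \<open>Y\<close>, hence invertible.\<close>

lemma characters_eq: "characters LA D = chi ` Yc"
proof (intro set_eqI iffI)
  fix \<omega> assume w: "\<omega> \<in> characters LA D"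
  define m where "m g = \<omega> (CC g)" for g
  have m_add: "m (\<lambda>y. g y + h y) = m g + m h" if "g \<in> Cont" "h \<in> Cont" for g h
    using w CC_in_D[OF that(1)] CC_in_D[OF that(2)]
    unfolding characters_def m_def CC_add[OF that, symmetric] by simp
  have m_mult: "m (\<lambda>y. g y * h y) = m g * m h" if "g \<in> Cont" "h \<in> Cont" for g h
    using w CC_in_D[OF that(1)] CC_in_D[OF that(2)]
    unfolding characters_def m_def CC_mult[OF that, symmetric] by simp
  have m_scale: "m (\<lambda>y. c * g y) = c * m g" if "g \<in> Cont" for g c
    using w CC_in_D[OF that(1)]
    unfolding characters_def m_def CC_scale[OF that, symmetric] by simp
  obtain g0 where g0: "g0 \<in> Cont" "m g0 \<noteq> 0" using w unfolding characters_def D_eq m_def by auto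
  have m1: "m (\<lambda>_. 1) = 1" using m_mult[OF g0(1) Cont_const[of 1]] g0(2) by simp
  have "\<exists>y\<in>Yc. \<forall>g\<in>Cont. m g = g y"
  proof (rule ccontr)
    assume neg: "\<not> ?thesis"
    define Z where "Z = {f \<in> Cont. m f = 0}"
    have "\<exists>f\<in>Z. f y \<noteq> 0" if y: "y \<in> Yc" for y
    proof -
      obtain g where g: "g \<in> Cont" "m g \<noteq> g y" using neg y by blast
      have "m (\<lambda>_. - m g) = - m g" using m_scale[OF Cont_const[of 1], of "- m g"] m1 by simp
      \<comment> \<open>Subtracting the scalar \<open>m g\<close> gives an element of the kernel
        that does not vanish at \<open>y\<close>.\<close>
      then have "(\<lambda>y. g y + (- m g)) \<in> Z"
        using m_add[OF g(1) Cont_const[of "- m g"]] Cont_add[OF g(1) Cont_const[of "- m g"]] by (simp add: Z_def)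
      moreover have "g y + (- m g) \<noteq> 0" using g(2) by simp
      ultimately show ?thesis by (intro bexI[of _ "\<lambda>y. g y + - m g"])
    qed
    note Z = this
    define nz where "nz f = {y \<in> Yc. f y \<in> - {0}}" for f :: "_ \<Rightarrow> complex"
    have "Yc \<subseteq> \<Union>(nz ` Z)"
    proof
      fix y assume y: "y \<in> Yc"
      then obtain f where "f \<in> Z" "f y \<noteq> 0" using Z by blast
      then show "y \<in> \<Union>(nz ` Z)" using y by (intro UN_I[of f]) (simp_all add: nz_def)
    qed
    moreover have "\<forall>U\<in>nz ` Z. openin Y U"
    proof
      fix U assume "U \<in> nz ` Z"
      then obtain f where f: "f \<in> Cont" "U = nz f" unfolding Z_def by blast
      show "openin Y U" unfolding f(2) nz_def
        using f(1) open_delete[of UNIV "0::complex"] unfolding Cont_def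
        by (intro openin_continuous_map_preimage[where Y = euclidean]) (simp_all add: Compl_eq_Diff_UNIV)
    qed
    ultimately obtain \<F> where \<F>: "finite \<F>" "\<F> \<subseteq> nz ` Z" "Yc \<subseteq> \<Union>\<F>"
      using compact_Y unfolding compact_space_alt by meson
    obtain G where G: "finite G" "G \<subseteq> Z" "\<F> = nz ` G"
      using finite_subset_image[OF \<F>(1,2)] by blast
    define h where "h = (\<lambda>y. \<Sum>f\<in>G. f y * cnj (f y))"
    have "h \<in> Cont \<and> m h = 0"
      using G(1,2) unfolding h_def
    proof (induction G)
      case empty
      then show ?case using m_scale[OF Cont_const[of 1], of 0] by simp
    next
      case (insert f G)
      then have f: "f \<in> Cont" "m f = 0" and IH: "(\<lambda>y. \<Sum>f\<in>G. f y * cnj (f y)) \<in> Cont" "m (\<lambda>y. \<Sum>f\<in>G. f y * cnj (f y)) = 0"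
        by (auto simp: Z_def)
      have ff: "(\<lambda>y. f y * cnj (f y)) \<in> Cont" by (intro Cont_mult Cont_cnj f)
      have "m (\<lambda>y. f y * cnj (f y)) = 0" using m_mult[OF f(1) Cont_cnj[OF f(1)]] f(2) by simp
      then show ?case using m_add[OF ff IH(1)] Cont_add[OF ff IH(1)] IH(2) insert.hyps by simp
    qed
    then have h: "h \<in> Cont" "m h = 0" by auto
    have "h y \<noteq> 0" if y: "y \<in> Yc" for y
    proof -
      have "y \<in> \<Union>(nz ` G)" using \<F>(3) y unfolding G(3) by (rule subsetD)
      then obtain f where f: "f \<in> G" "f y \<noteq> 0" unfolding nz_def by blast
      have "h y = complex_of_real (\<Sum>f\<in>G. (cmod (f y))\<^sup>2)"
        by (simp add: h_def complex_norm_square del: of_real_power)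
      moreover have "(\<Sum>f\<in>G. (cmod (f y))\<^sup>2) > 0"
        using G(1) f by (intro sum_pos2[of G f]) auto
      ultimately show ?thesis by (metis less_irrefl of_real_eq_0_iff)
    qed
    note h0 = this
    have k: "(\<lambda>y. inverse (h y)) \<in> Cont" by (rule Cont_inverse[OF h(1) h0])
    have "CC (\<lambda>y. h y * inverse (h y)) = CC (\<lambda>_. 1)" by (rule CC_cong) (simp add: h0)
    then have "m h * m (\<lambda>y. inverse (h y)) = 1" using m_mult[OF h(1) k] m1 by (simp add: m_def)
    then show False using h(2) by simp
  qed
  then obtain y where y: "y \<in> Yc" "\<And>g. g \<in> Cont \<Longrightarrow> m g = g y" by blast
  have "\<omega> = chi y"
  proof
    fix c show "\<omega> c = chi y c"
    proof (cases "c \<in> D")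
      case True
      then obtain g where "g \<in> Cont" "c = CC g" by (auto simp: D_eq)
      then show ?thesis using y chi_CC by (simp add: m_def)
    next
      case False
      then show ?thesis using w by (auto simp: characters_def chi_def extensional_def)
    qed
  qed
  then show "\<omega> \<in> chi ` Yc" using y(1) by blast
qed (auto intro: chi_in_characters simp del: topspace_prod_topology)

lemma topspace_spectrum: "topspace (spectrum_top LA D) = chi ` Yc"
  unfolding spectrum_top_def topspace_subtopology characters_eq
  by (auto simp: chi_def)

text \<open>A continuous bijection from a compact space to a Hausdorff space; its continuity is that
  of \<open>ev\<close> for each fixed element of \<open>D\<close>.\<close>

lemma chi_homeomorphic: "homeomorphic_map Y (spectrum_top LA D) chi"
proof (rule continuous_imp_homeomorphic_map[OF _ compact_Y])
  have "continuous_map Y (product_topology (\<lambda>_. euclidean) D) chi"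
    unfolding continuous_map_componentwise
  proof (intro conjI ballI)
    show "chi ` Yc \<subseteq> extensional D" by (auto simp: chi_def)
    fix c assume c: "c \<in> D"
    then show "continuous_map Y euclidean (\<lambda>y. chi y c)"
      using ev_cont[OF D_sub[OF c]] by (simp add: chi_def)
  qed
  then show "continuous_map Y (spectrum_top LA D) chi"
    unfolding spectrum_top_def by (rule continuous_map_into_subtopology) (auto simp: characters_eq)
  show "Hausdorff_space (spectrum_top LA D)"
    unfolding spectrum_top_def by (intro Hausdorff_space_subtopology) (simp add: Hausdorff_space_product_topology)
  show "inj_on chi (Yc)" by (intro inj_onI) (simp add: chi_eq_iff del: topspace_prod_topology)
qed (simp add: topspace_spectrum)

end

section \<open>Matrix units and normalisers\<close>

context normed_star_system
begin

text \<open>Serves to ignore the stages before \<open>n\<close>, where lifted elements are set to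
  zero.\<close>

lemma near_eventually:
  assumes "a \<in> LS" "b \<in> LS" "\<And>m. m \<ge> n \<Longrightarrow> a m = b m"
  shows "near a b"
proof -
  have "\<forall>\<^sub>F m in sequentially. d m (a m) (b m) = 0"
    unfolding eventually_sequentially using assms(3) dist_refl[OF LS_car[OF assms(2)]] by (intro exI[of _ n]) auto
  then have "(\<lambda>m. d m (a m) (b m)) \<longlonglongrightarrow> 0" by (rule tendsto_eventually)
  then show ?thesis using assms by (simp add: near_def)
qed

end

abbreviation msq :: "complex \<Rightarrow> complex" where
  "msq z \<equiv> complex_of_real ((cmod z)\<^sup>2)"

text \<open>A difference of squared moduli factors into a difference and a sum of moduli, and
  Cauchy-Schwarz then leaves only l2-norms. The number of words does not enter, so the bound is the
  same at all stages.\<close>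

lemma weighted_square_diff:
  assumes "\<And>r. r \<in> words n \<Longrightarrow> cmod (w r) \<le> 1"
  shows "cmod ((\<Sum>r\<in>words n. w r * msq (a r)) - (\<Sum>r\<in>words n. w r * msq (b r)))
    \<le> vnorm n (\<lambda>r. a r - b r) * (vnorm n a + vnorm n b)"
proof -
  have "cmod ((\<Sum>r\<in>words n. w r * msq (a r)) - (\<Sum>r\<in>words n. w r * msq (b r)))
    = cmod (\<Sum>r\<in>words n. w r * complex_of_real ((cmod (a r))\<^sup>2 - (cmod (b r))\<^sup>2))"
    by (simp add: sum_subtractf algebra_simps)
  also have "\<dots> \<le> (\<Sum>r\<in>words n. \<bar>cmod (a r - b r)\<bar> * \<bar>cmod (a r)\<bar> + \<bar>cmod (a r - b r)\<bar> * \<bar>cmod (b r)\<bar>)"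
  proof (rule sum_norm_le)
    fix r assume r: "r \<in> words n"
    have "\<bar>(cmod (a r))\<^sup>2 - (cmod (b r))\<^sup>2\<bar> = \<bar>cmod (a r) - cmod (b r)\<bar> * (cmod (a r) + cmod (b r))"
      by (simp add: power2_eq_square square_diff_square_factored abs_mult)
    also have "\<dots> \<le> cmod (a r - b r) * (cmod (a r) + cmod (b r))"
      by (intro mult_right_mono norm_triangle_ineq3) auto
    finally have *: "\<bar>(cmod (a r))\<^sup>2 - (cmod (b r))\<^sup>2\<bar> \<le> cmod (a r - b r) * (cmod (a r) + cmod (b r))" .
    have "cmod (w r * complex_of_real ((cmod (a r))\<^sup>2 - (cmod (b r))\<^sup>2)) \<le> 1 * \<bar>(cmod (a r))\<^sup>2 - (cmod (b r))\<^sup>2\<bar>"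
      unfolding norm_mult norm_of_real by (intro mult_right_mono assms r) auto
    then show "cmod (w r * complex_of_real ((cmod (a r))\<^sup>2 - (cmod (b r))\<^sup>2))
        \<le> \<bar>cmod (a r - b r)\<bar> * \<bar>cmod (a r)\<bar> + \<bar>cmod (a r - b r)\<bar> * \<bar>cmod (b r)\<bar>"
      using * by (simp add: algebra_simps)
  qed
  also have "\<dots> \<le> vnorm n (\<lambda>r. a r - b r) * vnorm n a + vnorm n (\<lambda>r. a r - b r) * vnorm n b"
    unfolding sum.distrib vnorm_def by (intro add_mono L2_set_mult_ineq)
  finally show ?thesis by (simp add: algebra_simps)
qed

text \<open>Reduces a sum over long words to one over prefixes when only the block of the tail
  \<open>u\<close> contributes.\<close>

lemma sum_words_drop:
  fixes f :: "bool list \<Rightarrow> 'b::comm_monoid_add"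
  assumes "u \<in> words k"
  shows "(\<Sum>r\<in>words (n + k). if drop n r = u then f r else 0) = (\<Sum>p\<in>words n. f (p @ u))"
proof -
  have "(\<Sum>r\<in>words (n + k). if drop n r = u then f r else 0) = (\<Sum>r\<in>(\<lambda>p. p @ u) ` words n. f r)"
  proof (rule sum.mono_neutral_cong_right[OF finite_words])
    show "\<forall>i\<in>words (n + k) - (\<lambda>p. p @ u) ` words n. (if drop n i = u then f i else 0) = 0"
    proof
      fix r assume r: "r \<in> words (n + k) - (\<lambda>p. p @ u) ` words n"
      have "drop n r \<noteq> u"
      proof
        assume "drop n r = u"
        then have "r = take n r @ u" by (metis append_take_drop_id)
        moreover have "take n r \<in> words n" using r by (auto simp: words_def)
        ultimately show False using r by blast
      qed
      then show "(if drop n r = u then f r else 0) = 0" by simp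
    qed
  qed (use assms in \<open>auto simp: words_def\<close>)
  also have "\<dots> = (\<Sum>p\<in>words n. f (p @ u))"
    by (subst sum.reindex) (auto simp: inj_on_def)
  finally show ?thesis .
qed

context dynamical_system
begin

declare topspace_prod_topology [simp del]

text \<open>The powers of \<open>\<sigma>\<close> are those that keep the later stage coordinates
  fixed, see \<open>pt_theta\<close>. The formula does not test whether \<open>y\<close> begins with
  \<open>q\<close>; where that matters it is a hypothesis, or a cut-off as in
  \<open>cyl_pull\<close>.\<close>

definition theta :: "bool list \<Rightarrow> bool list \<Rightarrow> (nat \<Rightarrow> bool) \<times> 'x \<Rightarrow> (nat \<Rightarrow> bool) \<times> 'x" where
  "theta p q y = (\<lambda>i. if i < length p then p ! i else fst y i, (\<sigma> ^^ ones p) ((\<sigma>i ^^ ones q) (snd y)))"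

lemma theta_cont: "continuous_map Y Y (theta p q)"
proof -
  have "continuous_map cantor cantor (\<lambda>t i. if i < length p then p ! i else t i)"
    unfolding cantor_def continuous_map_componentwise
  proof (intro conjI ballI)
    fix k :: nat
    have "continuous_map (product_topology (\<lambda>_. discrete_topology UNIV) UNIV) (discrete_topology UNIV) (\<lambda>t :: nat \<Rightarrow> bool. t k)"
      using continuous_map_product_coordinates[of k UNIV "\<lambda>_. discrete_topology UNIV"] by simp
    then show "continuous_map (product_topology (\<lambda>_. discrete_topology UNIV) UNIV) (discrete_topology UNIV)
        (\<lambda>t. if k < length p then p ! k else t k)" by auto
  qed (auto simp: extensional_def)
  from continuous_map_compose[OF continuous_map_fst this]
  have 1: "continuous_map Y cantor (\<lambda>y i. if i < length p then p ! i else fst y i)" by (simp only: o_def)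
  have 2: "continuous_map Y X (\<lambda>y. (\<sigma> ^^ ones p) ((\<sigma>i ^^ ones q) (snd y)))"
    using continuous_map_compose[OF continuous_map_snd continuous_map_compose[OF powi_cont pow_cont]]
    by (simp add: o_def)
  show ?thesis unfolding theta_def[abs_def] by (intro continuous_map_pairedI 1 2)
qed

lemma theta_in [simp]: "y \<in> Yc \<Longrightarrow> theta p q y \<in> Yc"
  by (auto simp: theta_def topspace_Y)

lemma prefix_theta:
  assumes "length p \<le> n"
  shows "pre n (theta p q y) = p @ drop (length p) (pre n y)"
  by (rule nth_equalityI) (use assms in \<open>auto simp: prefix_of_def theta_def nth_append\<close>)

text \<open>The new prefix contributes \<open>ones p\<close> to the negative power in
  \<open>pt\<close>, which cancels the positive power in \<open>theta\<close>; what remains is the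
  exponent for \<open>q\<close> followed by the tail.\<close>

lemma pt_theta:
  assumes y: "y \<in> Yc" "pre (length p) y = q" and n: "length p \<le> n"
  shows "pt n (theta p q y) = pt n y"
proof -
  let ?u = "drop (length p) (pre n y)"
  have s: "pre n y = q @ ?u" using n y(2) by (metis append_take_drop_id take_prefix_of)
  have x: "(\<sigma>i ^^ ones q) (snd y) \<in> Xc" using y by (auto simp: topspace_Y)
  have "pt n (theta p q y) = (\<sigma>i ^^ (ones ?u + ones p)) ((\<sigma> ^^ ones p) ((\<sigma>i ^^ ones q) (snd y)))"
    unfolding pt_def prefix_theta[OF n] by (simp add: theta_def add.commute)
  also have "\<dots> = (\<sigma>i ^^ ones ?u) ((\<sigma>i ^^ ones q) (snd y))" unfolding funpow_add using x by simp
  also have "\<dots> = (\<sigma>i ^^ (ones ?u + ones q)) (snd y)" by (simp add: funpow_add)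
  also have "\<dots> = pt n y" unfolding pt_def using arg_cong[OF s, of ones] by (simp add: add.commute)
  finally show ?thesis .
qed

definition munit :: "bool list \<Rightarrow> bool list \<Rightarrow> 'x fmat" where
  "munit p q x p' q' = (if x \<in> Xc \<and> p' = p \<and> q' = q then 1 else 0)"

lemma mat_unit_eq: "mun p q = sys.cls (sys.lift_seq (length p) (munit p q))"
  by (simp add: mat_unit_def AH_map_eq munit_def[abs_def])

lemma munit_car:
  assumes "length p = n" "length q = n"
  shows "munit p q \<in> Car n"
proof -
  have "continuous_map X euclidean (\<lambda>x. munit p q x p' q')" for p' q'
    by (rule continuous_map_eq[of _ _ "\<lambda>_. if p' = p \<and> q' = q then 1 else 0"]) (auto simp: munit_def)
  then show ?thesis using assms by (auto simp: stage_carrier munit_def words_def)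
qed

lemma munit_LS: "length p = length q \<Longrightarrow> sys.lift_seq (length p) (munit p q) \<in> sys.LS"
  by (intro sys.lift_seq_LS munit_car) auto

lemma munit_star:
  assumes "length p = length q"
  shows "cs_star LA (mun p q) = mun q p"
proof -
  have "adj m (sys.lift_seq (length p) (munit p q) m) = sys.lift_seq (length q) (munit q p) m" for m
  proof (cases "m < length p")
    case True
    then show ?thesis using assms by (simp add: sys.lift_seq_def stage_ops)
  next
    case False
    have star: "adj (length p) (munit p q) = munit q p"
      by (auto simp: stage_ops munit_def fun_eq_iff)
    have "munit p q \<in> Car (length p)" using assms by (intro munit_car) auto
    from sys.con_star[OF this, of "m - length p"] False show ?thesis
      unfolding sys.lift_seq_def star assms[symmetric] by simp
  qed
  then show ?thesis unfolding mat_unit_eq sys.LA_star[OF munit_LS[OF assms]] by (simp only:)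
qed

text \<open>Each column \<open>r\<close> of \<open>e\<close> has at most one nonzero entry, in row
  \<open>p @ drop n r\<close>, present when \<open>r\<close> begins with \<open>q\<close>; so both
  sums in the triple product collapse.\<close>

lemma conj_munit_stage:
  fixes c :: "'x fmat" and k :: nat
  assumes "length p = n" "length q = n"
  defines "e \<equiv> sys.con n k (munit p q)"
  shows "mul (n + k) (mul (n + k) (adj (n + k) e) c) e x r r' =
    (if x \<in> Xc \<and> r \<in> words (n + k) \<and> r' \<in> words (n + k) \<and> take n r = q \<and> take n r' = q
     then c x (p @ drop n r) (p @ drop n r') else 0)"
proof -
  have e: "e x b r = (if b = p @ drop n r then of_bool (x \<in> Xc \<and> r \<in> words (n + k) \<and> take n r = q) else 0)"
    if b: "b \<in> words (n + k)" for b r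
  proof -
    have "drop n b = drop n r \<and> take n b = p \<longleftrightarrow> b = p @ drop n r"
      using assms(1) by (metis append_eq_conv_conj append_take_drop_id)
    then show ?thesis using b unfolding e_def connect_explicit[OF munit_car[OF assms(1,2)]]
      by (auto simp: munit_def)
  qed
  have pd: "p @ drop n r \<in> words (n + k)" if "r \<in> words (n + k)" for r
    using that assms(1) by (simp add: words_def)
  define \<beta> where "\<beta> r = (of_bool (x \<in> Xc \<and> r \<in> words (n + k) \<and> take n r = q) :: complex)" for r
  have inner: "(\<Sum>b\<in>words (n + k). cnj (e x b r) * c x b a) = \<beta> r * c x (p @ drop n r) a" for a
  proof -
    have "(\<Sum>b\<in>words (n + k). cnj (e x b r) * c x b a) = (\<Sum>b\<in>words (n + k). if b = p @ drop n r then \<beta> r * c x (p @ drop n r) a else 0)"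
      by (rule sum.cong) (auto simp: e \<beta>_def)
    then show ?thesis using pd by (auto simp: \<beta>_def)
  qed
  have "(\<Sum>a\<in>words (n + k). (\<Sum>b\<in>words (n + k). cnj (e x b r) * c x b a) * e x a r') =
      (\<Sum>a\<in>words (n + k). if a = p @ drop n r' then \<beta> r * c x (p @ drop n r) (p @ drop n r') * \<beta> r' else 0)"
    unfolding inner by (rule sum.cong) (auto simp: e \<beta>_def)
  also have "\<dots> = \<beta> r * c x (p @ drop n r) (p @ drop n r') * \<beta> r'"
    using pd by (auto simp: \<beta>_def)
  finally show ?thesis unfolding stage_ops by (auto simp: \<beta>_def)
qed

text \<open>Pull-back along \<open>theta p q\<close>, extended by zero off the cylinder of
  \<open>q\<close>; as the cylinder is clopen, continuity is kept.\<close>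

definition cyl_pull :: "bool list \<Rightarrow> bool list \<Rightarrow> ((nat \<Rightarrow> bool) \<times> 'x \<Rightarrow> complex) \<Rightarrow> (nat \<Rightarrow> bool) \<times> 'x \<Rightarrow> complex" where
  "cyl_pull p q g y = (if pre (length q) y = q then g (theta p q y) else 0)"

lemma cyl_pull_Cont:
  assumes "g \<in> Cont"
  shows "cyl_pull p q g \<in> Cont"
proof -
  have "continuous_map Y euclidean (\<lambda>y. (\<lambda>r y. if r = q then g (theta p q y) else 0) (pre (length q) y) y)"
  proof (rule continuous_map_cylinders)
    fix r
    have "continuous_map Y euclidean (\<lambda>y. g (theta p q y))"
      using assms continuous_map_compose[OF theta_cont, of euclidean g p q] by (simp add: Cont_def o_def)
    then show "continuous_map Y euclidean (\<lambda>y. if r = q then g (theta p q y) else 0)" by auto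
  qed
  then show ?thesis by (simp add: Cont_def cyl_pull_def[abs_def])
qed

text \<open>The stage formula for the triple product, read on sample points, is an exchange of
  prefixes. From stage \<open>length p\<close> on the two representing sequences agree
  exactly.\<close>

lemma conj_munit:
  assumes "length p = length q" "g \<in> Cont"
  shows "cj (mun p q) (CC g) = CC (cyl_pull p q g)"
proof -
  let ?n = "length p"
  let ?e = "sys.lift_seq ?n (munit p q)"
  let ?S = "\<lambda>m. mul m (mul m (adj m (?e m)) (dg g m)) (?e m)"
  note LS = munit_LS[OF assms(1)] dg_LS[OF assms(2)] sys.LS_star[OF munit_LS[OF assms(1)]]
  have "cj (mun p q) (CC g) =
      sys.cls ?S"
    unfolding conj_by_def mat_unit_eq CC_def using LS by (simp add: sys.LA_star sys.LA_mult sys.LS_mult)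
  also have "\<dots> = CC (cyl_pull p q g)" unfolding CC_def
  proof (rule sys.cls_eqI[OF sys.near_eventually[of _ _ ?n]])
    show "?S \<in> sys.LS"
      using LS by (simp add: sys.LS_mult)
    show "dg (cyl_pull p q g) \<in> sys.LS" by (intro dg_LS cyl_pull_Cont assms)
    fix m assume "m \<ge> ?n"
    then obtain k where m: "m = ?n + k" by (metis le_Suc_ex)
    show "?S m = dg (cyl_pull p q g) m"
    proof (intro ext)
      fix x r r'
      have "?S m x r r' =
        (if x \<in> Xc \<and> r \<in> words m \<and> r' \<in> words m \<and> take ?n r = q \<and> take ?n r' = q
         then dg g m x (p @ drop ?n r) (p @ drop ?n r') else 0)"
        unfolding m lift_seq_shift by (rule conj_munit_stage) (use assms in auto)
      also have "\<dots> = (if x \<in> Xc \<and> r \<in> words m \<and> r = r' \<and> take ?n r = q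
         then g (ext (p @ drop ?n r), (\<sigma> ^^ ones (p @ drop ?n r)) x) else 0)"
        by (auto simp: dg_def m words_def) (metis append_take_drop_id)
      also have "\<dots> = dg (cyl_pull p q g) m x r r'"
      proof (cases "x \<in> Xc \<and> r \<in> words m \<and> r = r' \<and> take ?n r = q")
        case True
        then have x: "x \<in> Xc" and r: "length r = m" "take ?n r = q" "r = r'" by (auto simp: words_def)
        have o: "ones r = ones q + ones (drop ?n r)" using r(2) by (metis append_take_drop_id ones_simps(3))
        \<comment> \<open>\<open>theta\<close> exchanges prefixes and keeps the zero tail, so it
          carries the sample point of \<open>r\<close> to that of
          \<open>p @ drop ?n r\<close>.\<close>
        have "theta p q (ext r, (\<sigma> ^^ ones r) x) = (ext (p @ drop ?n r), (\<sigma> ^^ ones (p @ drop ?n r)) x)"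
          using x r(1) by (auto simp: theta_def o funpow_add ext_def nth_append m fun_eq_iff)
        then show ?thesis using True assms by (simp add: dg_def cyl_pull_def prefix_of_ext words_def m)
      next
        case False
        then show ?thesis using assms by (auto simp: dg_def cyl_pull_def prefix_of_ext words_def m)
      qed
      finally show "?S m x r r' = dg (cyl_pull p q g) m x r r'" .
    qed
  qed
  finally show ?thesis .
qed

lemma munit_in: "length p = length q \<Longrightarrow> mun p q \<in> CA"
  unfolding mat_unit_eq by (intro sys.cls_in munit_LS)

lemma munit_normaliser:
  assumes "length p = length q"
  shows "mun p q \<in> Nor"
  unfolding normalisers_def
  using munit_in[OF assms] conj_munit[OF assms] conj_munit[OF assms[symmetric]]
  by (auto simp: D_eq cyl_pull_Cont munit_star[OF assms])

section \<open>Algebraic identities for conjugation by normalisers\<close>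

lemma LA_one_right:
  assumes "U \<in> CA"
  shows "cs_mult LA U (CC (\<lambda>_. 1)) = U"
proof -
  obtain a where a: "a \<in> sys.LS" "U = sys.cls a" using assms by (rule sys.LA_cases)
  have "mul n (a n) (dg (\<lambda>_. 1) n) x p q = a n x p q" for n x p q
  proof -
    have z: "a n x p q = 0" if "\<not> (x \<in> Xc \<and> q \<in> words n)"
      using sys.LS_car[OF a(1), of n] that unfolding stage_carrier by blast
    have "mul n (a n) (dg (\<lambda>_. 1) n) x p q = (\<Sum>r\<in>words n. if r = q then a n x p q else 0)"
      unfolding stage_ops by (rule sum.cong) (use z in \<open>auto simp: dg_def\<close>)
    then show ?thesis using z by auto
  qed
  then have "(\<lambda>n. mul n (a n) (dg (\<lambda>_. 1) n)) = a" by (intro ext)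
  then show ?thesis unfolding a CC_def by (simp add: sys.LA_mult a dg_LS)
qed

lemma LA_assoc:
  assumes "U \<in> CA" "V \<in> CA" "W \<in> CA"
  shows "cs_mult LA (cs_mult LA U V) W = cs_mult LA U (cs_mult LA V W)"
proof -
  obtain a b c where abc: "a \<in> sys.LS" "U = sys.cls a" "b \<in> sys.LS" "V = sys.cls b" "c \<in> sys.LS" "W = sys.cls c"
    using assms by (elim sys.LA_cases) blast
  have "mul n (mul n (a n) (b n)) (c n) = mul n (a n) (mul n (b n) (c n))" for n
  proof (intro ext)
    fix x p q
    have "mul n (mul n (a n) (b n)) (c n) x p q = (\<Sum>r\<in>words n. \<Sum>s\<in>words n. a n x p s * b n x s r * c n x r q)"
      unfolding stage_ops by (simp add: sum_distrib_right)
    also have "\<dots> = (\<Sum>s\<in>words n. \<Sum>r\<in>words n. a n x p s * b n x s r * c n x r q)" by (rule sum.swap)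
    also have "\<dots> = mul n (a n) (mul n (b n) (c n)) x p q"
      unfolding stage_ops by (simp add: sum_distrib_left mult.assoc)
    finally show "mul n (mul n (a n) (b n)) (c n) x p q = mul n (a n) (mul n (b n) (c n)) x p q" .
  qed
  then show ?thesis unfolding abc(2,4,6) using abc(1,3,5) by (simp add: sys.LA_mult sys.LS_mult)
qed

lemma LA_star_star:
  assumes "U \<in> CA"
  shows "cs_star LA (cs_star LA U) = U"
proof -
  obtain a where a: "a \<in> sys.LS" "U = sys.cls a" using assms by (rule sys.LA_cases)
  then show ?thesis by (simp add: sys.LA_star sys.LS_star) (simp add: stage_ops)
qed

lemma star_mult_self:
  assumes "n \<in> CA"
  shows "cs_mult LA (cs_star LA n) n = cj n (CC (\<lambda>_. 1))"
  unfolding conj_by_def by (simp add: LA_one_right sys.LA_closed assms)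

text \<open>The product of \<open>n\<close> with its adjoint lies in the commutative algebra
  \<open>D\<close>, hence commutes with \<open>c\<close> and can be moved to the left of it. After
  division by weights this is the multiplicativity of the image of a character.\<close>

lemma normaliser_mult:
  assumes n: "n \<in> Nor" and c: "c \<in> D" and d: "d \<in> D"
  shows "cs_mult LA (cj n c) (cj n d) =
    cs_mult LA (cs_mult LA (cs_star LA n) n) (cj n (cs_mult LA c d))"
proof -
  let ?m = "cs_mult LA" and ?s = "cs_star LA n"
  have nA: "n \<in> CA" using n by (simp add: normalisers_def)
  have sA: "?s \<in> CA" by (simp add: sys.LA_closed nA)
  have cA: "c \<in> CA" and dA: "d \<in> CA" using c d D_sub by auto
  have "cj ?s (CC (\<lambda>_. 1)) \<in> D" using n CC_in_D[OF Cont_const[of 1]] by (simp add: normalisers_def)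
  then have ns: "?m n ?s \<in> D" unfolding conj_by_def by (simp add: LA_star_star LA_one_right nA)
  have comm: "?m c (?m n ?s) = ?m (?m n ?s) c"
  proof -
    obtain g h where "g \<in> Cont" "c = CC g" "h \<in> Cont" "?m n ?s = CC h" using c ns by (auto simp: D_eq)
    then show ?thesis by (simp add: CC_mult mult.commute)
  qed
  note cl = sys.LA_closed(2)
  have "?m (?m (?m ?s c) n) (?m (?m ?s d) n) = ?m ?s (?m (?m c (?m n ?s)) (?m d n))"
    by (simp add: LA_assoc cl nA sA cA dA)
  also have "\<dots> = ?m (?m ?s n) (?m (?m ?s (?m c d)) n)"
    unfolding comm by (simp add: LA_assoc cl nA sA cA dA)
  finally show ?thesis by (simp add: conj_by_def)
qed

text \<open>A diagonal entry of the triple product is a sum over one column with squared moduli as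
  weights, so evaluation after conjugation is a limit of combinations of samples of \<open>g\<close>
  with nonnegative weights.\<close>

lemma conj_tendsto:
  assumes a: "a \<in> sys.LS" and g: "g \<in> Cont" and y: "y \<in> Yc"
  shows "(\<lambda>m. \<Sum>r\<in>words m. dg g m (pt m y) r r * msq (a m (pt m y) r (pre m y)))
    \<longlonglongrightarrow> ev y (cj (sys.cls a) (CC g))"
proof -
  let ?S = "\<lambda>m. mul m (mul m (adj m (a m)) (dg g m)) (a m)"
  note LS = a sys.LS_star[OF a] dg_LS[OF g]
  have S: "?S \<in> sys.LS" using LS by (simp add: sys.LS_mult)
  have "cj (sys.cls a) (CC g) = sys.cls ?S"
    unfolding conj_by_def CC_def using LS by (simp add: sys.LA_star sys.LA_mult sys.LS_mult)
  moreover have "entry y ?S m = (\<Sum>r\<in>words m. dg g m (pt m y) r r * msq (a m (pt m y) r (pre m y)))" for m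
  proof -
    have "(\<Sum>b\<in>words m. cnj (a m x b s) * dg g m x b r) = cnj (a m x r s) * dg g m x r r" if "r \<in> words m" for x s r
    proof -
      have "(\<Sum>b\<in>words m. cnj (a m x b s) * dg g m x b r) = (\<Sum>b\<in>words m. if b = r then cnj (a m x r s) * dg g m x r r else 0)"
        by (rule sum.cong) (auto simp: dg_def)
      then show ?thesis using that by simp
    qed
    then have "entry y ?S m = (\<Sum>r\<in>words m. cnj (a m (pt m y) r (pre m y)) * dg g m (pt m y) r r * a m (pt m y) r (pre m y))"
      unfolding entry_def stage_ops by (intro sum.cong refl) (simp only:)
    then show ?thesis by (simp add: complex_norm_square mult_ac del: of_real_power)
  qed
  then have "entry y ?S = (\<lambda>m. \<Sum>r\<in>words m. dg g m (pt m y) r r * msq (a m (pt m y) r (pre m y)))"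
    by (rule ext)
  ultimately show ?thesis using entry_tendsto[OF S y] by (simp only:)
qed

lemma conj_add:
  assumes "n \<in> CA" "g \<in> Cont" "h \<in> Cont" "y \<in> Yc"
  shows "ev y (cj n (CC (\<lambda>z. g z + h z))) = ev y (cj n (CC g)) + ev y (cj n (CC h))"
proof -
  obtain a where a: "a \<in> sys.LS" "n = sys.cls a" using assms(1) by (rule sys.LA_cases)
  have "dg (\<lambda>z. g z + h z) m x r r = dg g m x r r + dg h m x r r" for m x r by (simp add: dg_def)
  then show ?thesis unfolding a
    using tendsto_add[OF conj_tendsto[OF a(1) assms(2,4)] conj_tendsto[OF a(1) assms(3,4)]]
    by (intro LIMSEQ_unique[OF conj_tendsto[OF a(1) Cont_add[OF assms(2,3)] assms(4)]])
      (simp add: sum.distrib distrib_right)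
qed

lemma conj_scale:
  assumes "n \<in> CA" "g \<in> Cont" "y \<in> Yc"
  shows "ev y (cj n (CC (\<lambda>z. c * g z))) = c * ev y (cj n (CC g))"
proof -
  obtain a where a: "a \<in> sys.LS" "n = sys.cls a" using assms(1) by (rule sys.LA_cases)
  have "dg (\<lambda>z. c * g z) m x r r = c * dg g m x r r" for m x r by (simp add: dg_def)
  then show ?thesis unfolding a
    using tendsto_mult_left[OF conj_tendsto[OF a(1) assms(2,3)], of c]
    by (intro LIMSEQ_unique[OF conj_tendsto[OF a(1) Cont_mult[OF Cont_const assms(2)] assms(3)]])
      (simp add: sum_distrib_left mult.assoc)
qed

lemma conj_cnj:
  assumes "n \<in> CA" "g \<in> Cont" "y \<in> Yc"
  shows "ev y (cj n (CC (\<lambda>z. cnj (g z)))) = cnj (ev y (cj n (CC g)))"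
proof -
  obtain a where a: "a \<in> sys.LS" "n = sys.cls a" using assms(1) by (rule sys.LA_cases)
  have "dg (\<lambda>z. cnj (g z)) m x r r = cnj (dg g m x r r)" for m x r by (simp add: dg_def)
  then show ?thesis unfolding a
    using tendsto_cnj[OF conj_tendsto[OF a(1) assms(2,3)]]
    by (intro LIMSEQ_unique[OF conj_tendsto[OF a(1) Cont_cnj[OF assms(2)] assms(3)]]) simp
qed

lemma normaliser_conj_D: "n \<in> Nor \<Longrightarrow> c \<in> D \<Longrightarrow> cj n c \<in> D"
  by (simp add: normalisers_def)

lemma normaliser_in: "n \<in> Nor \<Longrightarrow> n \<in> CA"
  by (simp add: normalisers_def)

lemma chi_conj: "n \<in> Nor \<Longrightarrow> c \<in> D \<Longrightarrow> chi y (cj n c) = ev y (cj n c)"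
  by (simp add: chi_def normaliser_conj_D)

text \<open>The value at \<open>y\<close> of the adjoint of \<open>n\<close> times \<open>n\<close>,
  which is the denominator in \<open>weyl_map\<close>; the value is real since the constant function
  1 equals its conjugate.\<close>

definition wt :: "(nat \<Rightarrow> 'x fmat) set \<Rightarrow> (nat \<Rightarrow> bool) \<times> 'x \<Rightarrow> real" where
  "wt n y = Re (ev y (cj n (CC (\<lambda>_. 1))))"

lemma ev_conj_one:
  assumes "n \<in> CA" "y \<in> Yc"
  shows "ev y (cj n (CC (\<lambda>_. 1))) = complex_of_real (wt n y)"
  using conj_cnj[OF assms(1) Cont_const[of 1] assms(2)] by (simp add: wt_def complex_eq_iff)

lemma weyl_dom_iff:
  assumes "n \<in> Nor" "y \<in> Yc"
  shows "chi y \<in> dm n \<longleftrightarrow> wt n y > 0"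
  using assms unfolding weyl_dom_def
  by (simp add: star_mult_self normaliser_in chi_conj CC_in_D wt_def chi_in_characters)

lemma weyl_map_CC:
  assumes "n \<in> Nor" "y \<in> Yc" "g \<in> Cont"
  shows "\<alpha> n (chi y) (CC g) = ev y (cj n (CC g)) / complex_of_real (wt n y)"
  using assms unfolding weyl_map_def
  by (simp add: star_mult_self normaliser_in chi_conj CC_in_D ev_conj_one)

lemma weyl_map_eqI:
  assumes "n \<in> Nor" "y \<in> Yc" "z \<in> Yc"
    "\<And>g. g \<in> Cont \<Longrightarrow> ev y (cj n (CC g)) / complex_of_real (wt n y) = g z"
  shows "\<alpha> n (chi y) = chi z"
proof
  fix c show "\<alpha> n (chi y) c = chi z c"
  proof (cases "c \<in> D")
    case True
    then obtain g where "g \<in> Cont" "c = CC g" by (auto simp: D_eq)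
    then show ?thesis using weyl_map_CC[OF assms(1,2)] assms(4) chi_CC[OF _ assms(3)] by simp
  qed (simp add: weyl_map_def chi_def)
qed

text \<open>Linearity and compatibility with the adjoint hold for conjugation by any element;
  multiplicativity is \<open>normaliser_mult\<close> divided by the square of the weight. As all
  characters are evaluations, the image is one at some point \<open>z\<close>.\<close>

lemma weyl_map_character:
  assumes n: "n \<in> Nor" and y: "y \<in> Yc" and pos: "wt n y > 0"
  obtains z where "z \<in> Yc" "\<alpha> n (chi y) = chi z"
    "\<And>g. g \<in> Cont \<Longrightarrow> ev y (cj n (CC g)) = complex_of_real (wt n y) * g z"
proof -
  let ?w = "complex_of_real (wt n y)"
  let ?W = "\<alpha> n (chi y)"
  note nA = normaliser_in[OF n]
  have w0: "?w \<noteq> 0" using pos by simp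
  have W: "?W (CC g) = ev y (cj n (CC g)) / ?w" if "g \<in> Cont" for g
    by (rule weyl_map_CC[OF n y that])
  have mult: "?W (CC (\<lambda>z. g z * h z)) = ?W (CC g) * ?W (CC h)" if "g \<in> Cont" "h \<in> Cont" for g h
  proof -
    note gD = CC_in_D[OF that(1)] and hD = CC_in_D[OF that(2)] and ghD = CC_in_D[OF Cont_mult[OF that]]
    obtain g' where g': "g' \<in> Cont" "cj n (CC g) = CC g'"
      using normaliser_conj_D[OF n gD] unfolding D_eq by blast
    obtain h' where h': "h' \<in> Cont" "cj n (CC h) = CC h'"
      using normaliser_conj_D[OF n hD] unfolding D_eq by blast
    obtain k' where k': "k' \<in> Cont" "cj n (CC (\<lambda>z. g z * h z)) = CC k'"
      using normaliser_conj_D[OF n ghD] unfolding D_eq by blast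
    obtain l' where l': "l' \<in> Cont" "cj n (CC (\<lambda>_. 1)) = CC l'"
      using normaliser_conj_D[OF n CC_in_D[OF Cont_const[of 1]]] unfolding D_eq by blast
    \<comment> \<open>\<open>normaliser_mult\<close> read as an identity of functions, to be
      evaluated at \<open>y\<close>.\<close>
    have "CC (\<lambda>z. g' z * h' z) = CC (\<lambda>z. l' z * k' z)"
      using normaliser_mult[OF n gD hD] that g' h' k' l' by (simp add: CC_mult star_mult_self nA)
    then have "g' y * h' y = l' y * k' y"
      using ev_CC[OF Cont_mult[OF g'(1) h'(1)] y] ev_CC[OF Cont_mult[OF l'(1) k'(1)] y] by simp
    moreover have "l' y = ?w" using ev_conj_one[OF nA y] l' ev_CC[OF l'(1) y] by simp
    ultimately show ?thesis using w0 that g' h' k' by (simp add: W Cont_mult ev_CC[OF _ y] field_simps)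
  qed
  have "?W \<in> characters LA D"
    unfolding characters_def
  proof (intro CollectI conjI allI ballI)
    show "?W \<in> extensional D" by (simp add: weyl_map_def)
    have "?W (CC (\<lambda>_. 1)) = 1" using W[OF Cont_const[of 1]] ev_conj_one[OF nA y] w0 by simp
    then show "\<exists>c\<in>D. ?W c \<noteq> 0" using CC_in_D[OF Cont_const[of 1]] by (intro bexI[of _ "CC (\<lambda>_. 1)"]) auto
    fix c assume "c \<in> D"
    then obtain g where g: "g \<in> Cont" "c = CC g" by (auto simp: D_eq)
    show "?W (cs_scale LA k c) = k * ?W c" for k
      using g by (simp add: CC_scale W Cont_mult conj_scale nA y)
    show "?W (cs_star LA c) = cnj (?W c)"
      using g by (simp add: CC_star W Cont_cnj conj_cnj nA y)
    fix d assume "d \<in> D"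
    then obtain h where h: "h \<in> Cont" "d = CC h" by (auto simp: D_eq)
    show "?W (cs_add LA c d) = ?W c + ?W d"
      using g h by (simp add: CC_add W Cont_add conj_add nA y add_divide_distrib)
    show "?W (cs_mult LA c d) = ?W c * ?W d"
      using g h by (simp add: CC_mult mult)
  qed
  then obtain z where z: "z \<in> Yc" "?W = chi z" unfolding characters_eq by blast
  have "ev y (cj n (CC g)) = ?w * g z" if "g \<in> Cont" for g
    using W[OF that] z chi_CC[OF that z(1)] w0 by (simp add: field_simps)
  then show ?thesis using that z by blast
qed

text \<open>Only one column of \<open>a\<close> and of its stage-\<open>m0\<close> approximation enters, so Cauchy-Schwarz bounds the error.\<close>

lemma conj_approx:
  assumes a: "a \<in> sys.LS" and K: "\<And>m. nm m (a m) \<le> K"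
    and eps: "\<And>k. nm (m0 + k) (df (m0 + k) (a (m0 + k)) (sys.con m0 k (a m0))) \<le> \<epsilon>"
    and g: "g \<in> Cont" "\<And>z. z \<in> Yc \<Longrightarrow> cmod (g z) \<le> 1" and y: "y \<in> Yc"
  shows "cmod (ev y (cj (sys.cls a) (CC g)) -
    (\<Sum>p\<in>words m0. g (theta p (pre m0 y) y) * msq (a m0 (pt m0 y) p (pre m0 y))))
    \<le> \<epsilon> * (2 * K)"
proof (rule LIMSEQ_le_const2)
  let ?q = "pre m0 y"
  let ?x = "\<lambda>k. pt (m0 + k) y" and ?s = "\<lambda>k. pre (m0 + k) y"
  let ?\<xi> = "\<lambda>k r. a (m0 + k) (?x k) r (?s k)" and ?\<eta> = "\<lambda>k r. sys.con m0 k (a m0) (?x k) r (?s k)"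
  let ?F = "\<lambda>k. \<Sum>r\<in>words (m0 + k). dg g (m0 + k) (?x k) r r * msq (?\<xi> k r)"
  let ?G = "\<lambda>k. \<Sum>p\<in>words m0. entry (theta p ?q y) (dg g) (m0 + k) * msq (a m0 (pt m0 y) p ?q)"
  have "(\<lambda>k. ?F k) \<longlonglongrightarrow> ev y (cj (sys.cls a) (CC g))"
    using LIMSEQ_ignore_initial_segment[OF conj_tendsto[OF a g(1) y], of m0] by (simp add: add.commute)
  moreover have "?G \<longlonglongrightarrow> (\<Sum>p\<in>words m0. g (theta p ?q y) * msq (a m0 (pt m0 y) p ?q))"
  proof (intro tendsto_sum tendsto_mult tendsto_const)
    fix p
    have "(\<lambda>k. entry (theta p ?q y) (dg g) (k + m0)) \<longlonglongrightarrow> ev (theta p ?q y) (CC g)"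
      unfolding CC_def by (intro LIMSEQ_ignore_initial_segment entry_tendsto dg_LS g theta_in y)
    then show "(\<lambda>k. entry (theta p ?q y) (dg g) (m0 + k)) \<longlonglongrightarrow> g (theta p ?q y)"
      by (simp only: ev_CC[OF g(1) theta_in[OF y]] add.commute)
  qed
  ultimately show "(\<lambda>k. cmod (?F k - ?G k)) \<longlonglongrightarrow> cmod (ev y (cj (sys.cls a) (CC g)) -
    (\<Sum>p\<in>words m0. g (theta p ?q y) * msq (a m0 (pt m0 y) p ?q)))"
    by (intro tendsto_norm tendsto_diff)
  have "cmod (?F k - ?G k) \<le> \<epsilon> * (2 * K)" for k
  proof -
    let ?u = "drop m0 (?s k)"
    have u: "?u \<in> words k" by (simp add: words_def)
    have am0: "a m0 \<in> Car m0" by (rule sys.LS_car[OF a])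
    note con = sys.con_closed[OF am0, of k]
    have x: "?x k \<in> Xc" using y by simp
    \<comment> \<open>In the image of \<open>a m0\<close>, the column of \<open>y\<close> is
      supported on the words with the tail of \<open>y\<close>, that is, on changes of the first
      \<open>m0\<close> digits.\<close>
    have eta: "?\<eta> k r = (if drop m0 r = ?u then a m0 (pt m0 y) (take m0 r) ?q else 0)" if "r \<in> words (m0 + k)" for r
      unfolding connect_explicit[OF am0] using that x pt_shift[OF y, of m0 k] by auto
    have "(\<Sum>r\<in>words (m0 + k). dg g (m0 + k) (?x k) r r * msq (?\<eta> k r)) =
      (\<Sum>r\<in>words (m0 + k). if drop m0 r = ?u then dg g (m0 + k) (?x k) r r * msq (a m0 (pt m0 y) (take m0 r) ?q) else 0)"
      by (rule sum.cong) (auto simp: eta)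
    also have "\<dots> = (\<Sum>p\<in>words m0. dg g (m0 + k) (?x k) (p @ ?u) (p @ ?u) * msq (a m0 (pt m0 y) (take m0 (p @ ?u)) ?q))"
      by (rule sum_words_drop[OF u])
    also have "\<dots> = ?G k"
    proof (rule sum.cong[OF refl])
      fix p assume "p \<in> words m0"
      then have p: "length p = m0" by (simp add: words_def)
      \<comment> \<open>Prefix exchange fixes the stage coordinate, so the entry at the word
        \<open>p @ ?u\<close> is the one seen from \<open>theta p ?q y\<close>.\<close>
      have "entry (theta p ?q y) (dg g) (m0 + k) = dg g (m0 + k) (?x k) (p @ ?u) (p @ ?u)"
        unfolding entry_def using p prefix_theta[of p "m0 + k" ?q y] pt_theta[OF y, of p ?q "m0 + k"] by simp
      then show "dg g (m0 + k) (?x k) (p @ ?u) (p @ ?u) * msq (a m0 (pt m0 y) (take m0 (p @ ?u)) ?q)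
        = entry (theta p ?q y) (dg g) (m0 + k) * msq (a m0 (pt m0 y) p ?q)"
        using p by simp
    qed
    finally have G: "(\<Sum>r\<in>words (m0 + k). dg g (m0 + k) (?x k) r r * msq (?\<eta> k r)) = ?G k" .
    have "cmod (?F k - ?G k) \<le> vnorm (m0 + k) (\<lambda>r. ?\<xi> k r - ?\<eta> k r) * (vnorm (m0 + k) (?\<xi> k) + vnorm (m0 + k) (?\<eta> k))"
      unfolding G[symmetric]
    proof (rule weighted_square_diff)
      fix r assume "r \<in> words (m0 + k)"
      then show "cmod (dg g (m0 + k) (?x k) r r) \<le> 1" using x g(2) by (simp add: dg_def topspace_Y)
    qed
    also have "\<dots> \<le> \<epsilon> * (K + K)"
    proof (intro mult_mono add_mono add_nonneg_nonneg vnorm_nonneg)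
      show "vnorm (m0 + k) (\<lambda>r. ?\<xi> k r - ?\<eta> k r) \<le> \<epsilon>"
        using stage_column_bound[OF stage_diff_closed[OF sys.LS_car[OF a, of "m0 + k"] con] x prefix_of_in_words[of "m0 + k" "fst y"]] eps[of k]
        by (simp add: stage_ops)
      show "vnorm (m0 + k) (?\<xi> k) \<le> K"
        using stage_column_bound[OF sys.LS_car[OF a, of "m0 + k"] x prefix_of_in_words[of "m0 + k" "fst y"]] K[of "m0 + k"] by simp
      show "vnorm (m0 + k) (?\<eta> k) \<le> K"
        using stage_column_bound[OF con x prefix_of_in_words[of "m0 + k" "fst y"]] K[of m0] sys.con_norm[OF am0, of k] by simp
      show "0 \<le> \<epsilon>" using eps[of 0] stage_norm_nonneg[OF stage_diff_closed[OF am0 am0]] by simp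
    qed
    finally show ?thesis by simp
  qed
  then show "\<exists>N. \<forall>k\<ge>N. cmod (?F k - ?G k) \<le> \<epsilon> * (2 * K)" by blast
qed

lemma wt_cont:
  assumes "n \<in> CA"
  shows "continuous_map Y euclideanreal (wt n)"
proof -
  have "continuous_map Y euclidean (\<lambda>y. ev y (cj n (CC (\<lambda>_. 1))))"
    unfolding conj_by_def by (intro ev_cont sys.LA_closed CC_in assms Cont_const)
  then show ?thesis by (simp add: wt_def[abs_def] continuous_map_atin tendsto_Re)
qed

text \<open>The weight of a matrix unit is 1 on its cylinder, so the quotient in
  \<open>weyl_map\<close> is just the pull-back along \<open>theta\<close>.\<close>

lemma weyl_munit:
  assumes "length p = length q" "y \<in> Yc" "pre (length q) y = q"
  shows "chi y \<in> dm (mun p q)"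
    and "\<alpha> (mun p q) (chi y) = chi (theta p q y)"
proof -
  have conj: "ev y (cj (mun p q) (CC g)) = g (theta p q y)" if "g \<in> Cont" for g
    using assms that by (simp add: conj_munit ev_CC cyl_pull_Cont cyl_pull_def)
  have wt: "wt (mun p q) y = 1" by (simp add: wt_def conj)
  show "chi y \<in> dm (mun p q)"
    using wt by (simp add: weyl_dom_iff munit_normaliser assms)
  show "\<alpha> (mun p q) (chi y) = chi (theta p q y)"
    by (rule weyl_map_eqI[OF munit_normaliser[OF assms(1)] assms(2) theta_in[OF assms(2)]])
      (simp add: wt conj)
qed

lemma openin_prefix: "openin Y {y \<in> Yc. pre n y = p}"
proof -
  have "openin Y {y \<in> Yc. fst y \<in> {t. prefix_of n t = p}}"
    by (rule openin_continuous_map_preimage[OF continuous_map_fst openin_cylinder])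
  then show ?thesis by simp
qed

text \<open>Stage \<open>N\<close> and prefix \<open>q\<close> are fixed by the estimate at
  \<open>y\<close> and serve every point of a neighbourhood on which the weight exceeds
  \<open>l/2\<close>. Evaluating against the indicator of a cylinder then selects a smaller
  neighbourhood on which the new prefix is constant.\<close>

lemma normaliser_local:
  assumes n: "n \<in> Nor" and y: "y \<in> Yc" and dom: "chi y \<in> dm n"
  obtains p q V where "length p = length q" "openin Y V" "y \<in> V"
    "\<And>z. z \<in> V \<Longrightarrow> pre (length q) z = q"
    "\<And>z. z \<in> V \<Longrightarrow> \<alpha> n (chi z) = chi (theta p q z)"
proof -
  note nA = normaliser_in[OF n]
  obtain a where a: "a \<in> sys.LS" "n = sys.cls a" using nA by (rule sys.LA_cases)
  obtain K where K: "K > 0" "\<And>m. nm m (a m) \<le> K" by (rule sys.LS_bounded[OF a(1)]) blast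
  define l where "l = wt n y"
  have l: "l > 0" using dom weyl_dom_iff[OF n y] by (simp add: l_def)
  \<comment> \<open>\<open>conj_approx\<close> turns this into the error
    \<open>l / (8 * K) * (2 * K) = l / 4\<close>, smaller than the bound \<open>l / 2\<close> for
    the weight on \<open>V0\<close>.\<close>
  obtain N where N: "\<And>m k. m \<ge> N \<Longrightarrow> nm (m + k) (df (m + k) (a (m + k)) (sys.con m k (a m))) < l / (8 * K)"
    by (rule sys.LS_coherent[OF a(1), of "l / (8 * K)"]) (use l K in auto)
  define q where "q = pre N y"
  have q: "length q = N" by (simp add: q_def)
  define V0 where "V0 = {z \<in> Yc. pre N z = q} \<inter> {z \<in> Yc. wt n z \<in> {l/2<..}}"
  have V0: "openin Y V0" unfolding V0_def
    by (intro openin_Int openin_prefix openin_continuous_map_preimage[OF wt_cont[OF nA]]) simp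
  have yV0: "y \<in> V0" using y l by (simp add: V0_def q_def l_def)
  have ex: "\<exists>p\<in>words N. \<alpha> n (chi z) = chi (theta p q z) \<and>
      (\<forall>g\<in>Cont. ev z (cj n (CC g)) = complex_of_real (wt n z) * g (theta p q z))" if zV0: "z \<in> V0" for z
  proof -
    have z: "z \<in> Yc" "pre N z = q" "wt n z > l/2"
      using zV0 by (simp_all add: V0_def)
    have "wt n z > 0" using z(3) l by linarith
    then obtain w where w: "w \<in> Yc" "\<alpha> n (chi z) = chi w"
      "\<And>g. g \<in> Cont \<Longrightarrow> ev z (cj n (CC g)) = complex_of_real (wt n z) * g w"
      by (rule weyl_map_character[OF n z(1)]) blast
    let ?F = "(\<lambda>p. theta p q z) ` words N"
    have "w \<in> ?F"
    proof (rule ccontr)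
      assume nw: "w \<notin> ?F"
      have sub: "?F \<subseteq> Yc" using theta_in[OF z(1)] by blast
      obtain g where g: "(\<lambda>y. complex_of_real (g y)) \<in> Cont" "g w = 1"
        "\<And>v. v \<in> ?F \<Longrightarrow> g v = 0" "\<And>v. v \<in> Yc \<Longrightarrow> 0 \<le> g v \<and> g v \<le> 1"
        by (rule Cont_separation[OF w(1) sub _ nw]) auto
      \<comment> \<open>All points in the approximating sum lie in \<open>?F\<close>, where
        \<open>g\<close> vanishes.\<close>
      have z0: "(\<Sum>p\<in>words N. complex_of_real (g (theta p (pre N z) z)) * msq (a N (pt N z) p (pre N z))) = 0"
        by (rule sum.neutral) (use g(3) z(2) in auto)
      have "cmod (ev z (cj (sys.cls a) (CC (\<lambda>y. complex_of_real (g y)))) -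
        (\<Sum>p\<in>words N. complex_of_real (g (theta p (pre N z) z)) * msq (a N (pt N z) p (pre N z))))
        \<le> l / (8 * K) * (2 * K)"
        by (rule conj_approx[OF a(1) K(2) _ g(1) _ z(1)]) (use N[of N] g(4) in \<open>auto intro: less_imp_le\<close>)
      then have "cmod (ev z (cj n (CC (\<lambda>y. complex_of_real (g y))))) \<le> l / 4"
        unfolding z0 a(2) using K(1) by simp
      \<comment> \<open>Since \<open>g w = 1\<close>, the evaluation bounded here equals the weight,
        which is above \<open>l / 2\<close>.\<close>
      then show False using w(3)[OF g(1)] g(2) z(3) l by simp
    qed
    then obtain p where "p \<in> words N" "w = theta p q z" by blast
    then show ?thesis using w by blast
  qed
  obtain p where p: "p \<in> words N"
    "\<And>g. g \<in> Cont \<Longrightarrow> ev y (cj n (CC g)) = complex_of_real (wt n y) * g (theta p q y)"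
    using ex[OF yV0] by blast
  have lp: "length p = N" using p by (simp add: words_def)
  \<comment> \<open>Detects the prefix: at \<open>theta p' q z\<close> it is 1 exactly if
    \<open>p' = p\<close>.\<close>
  define i where "i = (\<lambda>z :: (nat \<Rightarrow> bool) \<times> 'x. if pre N z = p then 1 else 0 :: complex)"
  have iC: "i \<in> Cont"
    using continuous_map_cylinders[of N euclidean "\<lambda>r z. if r = p then 1 else 0 :: complex"] by (simp add: Cont_def i_def)
  have i: "i (theta p' q z) = (if p' = p then 1 else 0)" if "p' \<in> words N" for p' z
    using that prefix_theta[of p' N q z] by (simp add: i_def words_def)
  \<comment> \<open>The first term is the full weight or zero according to the prefix. Comparing it
    with half the weight makes \<open>f > 0\<close> an open condition that singles out
    \<open>p\<close>.\<close>
  define f where "f z = Re (ev z (cj n (CC i))) - wt n z / 2" for z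
  have "continuous_map Y euclidean (\<lambda>z. ev z (cj n (CC i)))"
    unfolding conj_by_def by (intro ev_cont sys.LA_closed CC_in nA iC)
  then have "continuous_map Y euclideanreal (\<lambda>z. Re (ev z (cj n (CC i))))"
    by (simp add: continuous_map_atin tendsto_Re)
  then have f: "continuous_map Y euclideanreal f"
    unfolding f_def using continuous_map_real_mult_right[OF wt_cont[OF nA], of "1/2"]
    by (intro continuous_map_diff) simp_all
  define V where "V = V0 \<inter> {z \<in> Yc. f z \<in> {0<..}}"
  show ?thesis
  proof (rule that[of p q V])
    show "length p = length q" by (simp add: lp q)
    show "openin Y V" unfolding V_def
      by (intro openin_Int V0 openin_continuous_map_preimage[OF f]) simp
    have "f y > 0" using p(2)[OF iC] i[OF p(1)] l by (simp add: f_def l_def)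
    then show "y \<in> V" using yV0 y by (simp add: V_def)
    fix z assume z: "z \<in> V"
    then have zV0: "z \<in> V0" and fz: "f z > 0" by (simp_all add: V_def)
    show "pre (length q) z = q" using zV0 by (simp add: V0_def q)
    have "wt n z > 0" using zV0 l by (simp add: V0_def)
    obtain p' where p': "p' \<in> words N" "\<alpha> n (chi z) = chi (theta p' q z)"
      "ev z (cj n (CC i)) = complex_of_real (wt n z) * i (theta p' q z)"
      using ex[OF zV0] iC by blast
    have "p' = p"
    proof (rule ccontr)
      assume "p' \<noteq> p"
      then show False using p'(3) i[OF p'(1)] fz \<open>wt n z > 0\<close> by (simp add: f_def)
    qed
    then show "\<alpha> n (chi z) = chi (theta p q z)" using p'(2) by simp
  qed
qed

section \<open>The projective limit and the transported action\<close>

text \<open>Passes from the stage-1 coordinate, used by \<open>b_map\<close>, to the stage-0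
  coordinate, used by \<open>ev\<close>: they differ by one application of \<open>\<sigma>\<close>
  if the first digit, \<open>fst y 0\<close>, is 1.\<close>

definition kap :: "(nat \<Rightarrow> bool) \<times> 'x \<Rightarrow> (nat \<Rightarrow> bool) \<times> 'x" where
  "kap y = (fst y, if fst y 0 then \<sigma> (snd y) else snd y)"

definition kapi :: "(nat \<Rightarrow> bool) \<times> 'x \<Rightarrow> (nat \<Rightarrow> bool) \<times> 'x" where
  "kapi y = (fst y, if fst y 0 then \<sigma>i (snd y) else snd y)"

lemma fst_kap [simp]: "fst (kap y) = fst y" and fst_kapi [simp]: "fst (kapi y) = fst y"
  by (simp_all add: kap_def kapi_def)

lemma kap_in [simp]: "y \<in> Yc \<Longrightarrow> kap y \<in> Yc"
  and kapi_in [simp]: "y \<in> Yc \<Longrightarrow> kapi y \<in> Yc"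
  by (auto simp: kap_def kapi_def topspace_Y)

lemma kapi_kap [simp]: "y \<in> Yc \<Longrightarrow> kapi (kap y) = y"
  and kap_kapi [simp]: "y \<in> Yc \<Longrightarrow> kap (kapi y) = y"
  by (auto simp: kap_def kapi_def topspace_Y prod_eq_iff)

lemma continuous_map_first_digit:
  assumes "continuous_map Y Z f" "continuous_map Y Z g"
  shows "continuous_map Y Z (\<lambda>y. if fst y 0 then f y else g y)"
proof -
  have "continuous_map Y Z (\<lambda>y. (\<lambda>p. if p ! 0 then f else g) (pre 1 y) y)"
    by (rule continuous_map_cylinders) (use assms in auto)
  then show ?thesis by (simp add: prefix_of_def if_distribR)
qed

lemma kap_cont: "continuous_map Y Y kap"
  unfolding kap_def[abs_def] using continuous_map_compose[OF continuous_map_snd sigma_cont]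
  by (intro continuous_map_pairedI continuous_map_first_digit continuous_map_fst continuous_map_snd) (simp add: o_def)

lemma kapi_cont: "continuous_map Y Y kapi"
  unfolding kapi_def[abs_def] using continuous_map_compose[OF continuous_map_snd sigmai_cont]
  by (intro continuous_map_pairedI continuous_map_first_digit continuous_map_fst continuous_map_snd) (simp add: o_def)

abbreviation "PL \<equiv> proj_limit X \<sigma>"

lemma proj_limit_iff: "\<xi> \<in> topspace PL \<longleftrightarrow> \<xi> \<in> extensional {1..} \<and>
    (\<forall>n\<ge>1. fst (\<xi> n) \<in> words n \<and> snd (\<xi> n) \<in> Xc \<and> \<xi> n = dual_map \<sigma> (\<xi> (Suc n)))"
proof -
  have 1: "topspace PL = Pi\<^sub>E {1..} (\<lambda>n. words n \<times> Xc) \<inter> {\<xi>. \<forall>n\<ge>1. \<xi> n = dual_map \<sigma> (\<xi> (Suc n))}"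
    by (simp add: proj_limit_def topspace_prod_topology)
  have 2: "\<xi> \<in> Pi\<^sub>E {1..} (\<lambda>n. words n \<times> Xc) \<longleftrightarrow>
      \<xi> \<in> extensional {1..} \<and> (\<forall>n\<ge>1. fst (\<xi> n) \<in> words n \<and> snd (\<xi> n) \<in> Xc)"
    by (auto simp: PiE_iff mem_Times_iff)
  show ?thesis
    unfolding 1 Int_iff mem_Collect_eq 2 by (simp only: imp_conjR all_conj_distrib conj_assoc)
qed

text \<open>The application of \<open>\<sigma>\<close> in \<open>kap\<close> cancels the first digit
  in \<open>pt n\<close>, so the net negative exponent counts the ones among digits 2 to
  \<open>n\<close>, as in the formula for the inverse of \<open>b\<close>.\<close>

definition binv :: "(nat \<Rightarrow> bool) \<times> 'x \<Rightarrow> nat \<Rightarrow> bool list \<times> 'x" where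
  "binv y = restrict (\<lambda>n. (pre n y, pt n (kap y))) {1..}"

lemma pt_Suc: "pt (Suc n) y = (if fst y n then \<sigma>i (pt n y) else pt n y)"
  by (simp add: pt_def prefix_of_Suc)

lemma pt_1_kap: "y \<in> Yc \<Longrightarrow> pt (Suc 0) (kap y) = snd y"
  by (auto simp: pt_Suc topspace_Y) (auto simp: pt_def prefix_of_def kap_def topspace_Y)

lemma binv_in:
  assumes "y \<in> Yc"
  shows "binv y \<in> topspace PL"
  unfolding proj_limit_iff
proof (intro conjI allI impI)
  fix n :: nat assume n: "1 \<le> n"
  show "fst (binv y n) \<in> words n" "snd (binv y n) \<in> Xc"
    using n kap_in[OF assms] by (simp_all add: binv_def)
  show "binv y n = dual_map \<sigma> (binv y (Suc n))"
  proof -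
    have "pt n (kap y) \<in> Xc" by (rule pt_in[OF kap_in[OF assms]])
    then have "(if fst y n then \<sigma> (pt (Suc n) (kap y)) else pt (Suc n) (kap y)) = pt n (kap y)"
      by (cases "fst y n") (simp_all only: pt_Suc fst_kap sigma_sigmai if_True if_False)
    moreover have "binv y n = (pre n y, pt n (kap y))"
      "binv y (Suc n) = (pre n y @ [fst y n], pt (Suc n) (kap y))"
      using n by (simp_all add: binv_def prefix_of_Suc)
    ultimately show ?thesis by (simp only: dual_map_def split_conv butlast_snoc last_snoc)
  qed
qed (simp add: binv_def)

lemma b_map_binv:
  assumes "y \<in> Yc"
  shows "b_map (binv y) = y"
proof (rule prod_eqI)
  have "pre (Suc i) y ! i = fst y i" for i
    by (simp add: prefix_of_def nth_append)
  then show "fst (b_map (binv y)) = fst y" by (intro ext) (simp add: b_map_def binv_def)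
  show "snd (b_map (binv y)) = snd y"
    using pt_1_kap[OF assms] unfolding b_map_def binv_def by simp
qed

lemma b_map_in: "\<xi> \<in> topspace PL \<Longrightarrow> b_map \<xi> \<in> Yc"
  unfolding proj_limit_iff topspace_Y b_map_def snd_conv by blast

text \<open>The dual maps fix each coordinate from the preceding one and the next digit: the word
  grows by that digit, and the point of \<open>X\<close> is found by inverting
  \<open>\<sigma>\<close> if the digit is 1.\<close>

lemma binv_b_map:
  assumes x: "\<xi> \<in> topspace PL"
  shows "binv (b_map \<xi>) = \<xi>"
proof
  fix n
  let ?t = "\<lambda>i. fst (\<xi> (Suc i)) ! i"
  have x: "\<xi> \<in> extensional {1..}" "\<And>n. n \<ge> 1 \<Longrightarrow> fst (\<xi> n) \<in> words n"
    "\<And>n. n \<ge> 1 \<Longrightarrow> snd (\<xi> n) \<in> Xc" "\<And>n. n \<ge> 1 \<Longrightarrow> \<xi> n = dual_map \<sigma> (\<xi> (Suc n))"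
    using assms unfolding proj_limit_iff by blast+
  have dual: "fst (\<xi> n) = butlast (fst (\<xi> (Suc n)))"
    "snd (\<xi> n) = (if ?t n then \<sigma> (snd (\<xi> (Suc n))) else snd (\<xi> (Suc n)))" if "n \<ge> 1" for n
  proof -
    have l: "length (fst (\<xi> (Suc n))) = Suc n" using x(2)[of "Suc n"] by (simp add: words_def)
    then have "last (fst (\<xi> (Suc n))) = ?t n" by (subst last_conv_nth) auto
    then show "fst (\<xi> n) = butlast (fst (\<xi> (Suc n)))"
      "snd (\<xi> n) = (if ?t n then \<sigma> (snd (\<xi> (Suc n))) else snd (\<xi> (Suc n)))"
      unfolding x(4)[OF that] dual_map_def by (simp_all add: case_prod_beta)
  qed
  have "n \<ge> 1 \<Longrightarrow> prefix_of n ?t = fst (\<xi> n) \<and> pt n (kap (b_map \<xi>)) = snd (\<xi> n)"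
  proof (induction n rule: nat_induct_at_least)
    case base
    have "length (fst (\<xi> 1)) = 1" using x(2)[of 1] by (simp add: words_def)
    then have "fst (\<xi> 1) = [fst (\<xi> 1) ! 0]" by (intro nth_equalityI) auto
    then show ?case using pt_1_kap[OF b_map_in[OF assms]] by (simp add: prefix_of_def b_map_def)
  next
    case (Suc n)
    have l: "length (fst (\<xi> (Suc n))) = Suc n" using x(2)[of "Suc n"] by (simp add: words_def)
    have "fst (\<xi> (Suc n)) = butlast (fst (\<xi> (Suc n))) @ [last (fst (\<xi> (Suc n)))]"
      using l by (intro append_butlast_last_id[symmetric]) auto
    also have "last (fst (\<xi> (Suc n))) = ?t n" using l by (subst last_conv_nth) auto
    finally have "prefix_of (Suc n) ?t = fst (\<xi> (Suc n))"
      using Suc dual(1)[of n] by (simp add: prefix_of_Suc)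
    moreover have "pt (Suc n) (kap (b_map \<xi>)) = snd (\<xi> (Suc n))"
      using Suc dual(2)[of n] x(3)[of "Suc n"] by (auto simp: pt_Suc b_map_def)
    ultimately show ?case by blast
  qed
  then show "binv (b_map \<xi>) n = \<xi> n"
    using x(1) by (cases "n \<ge> 1") (auto simp: binv_def b_map_def extensional_def prod_eq_iff)
qed

lemma b_map_homeomorphic: "homeomorphic_map PL Y b_map"
  unfolding homeomorphic_map_maps homeomorphic_maps_def
proof (intro exI[of _ binv] conjI ballI)
  have coord: "continuous_map PL (prod_topology (discrete_topology (words n)) X) (\<lambda>\<xi>. \<xi> n)" if "n \<ge> 1" for n
    unfolding proj_limit_def
    using continuous_map_product_coordinates[of n "{1..}" "\<lambda>n. prod_topology (discrete_topology (words n)) X"] that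
    by (intro continuous_map_from_subtopology) simp
  have 1: "continuous_map PL cantor (\<lambda>\<xi> i. fst (\<xi> (Suc i)) ! i)"
    unfolding cantor_def continuous_map_componentwise
  proof (intro conjI ballI)
    fix i :: nat
    have "continuous_map (discrete_topology (words (Suc i))) (discrete_topology UNIV) (\<lambda>p. p ! i)" by simp
    from continuous_map_compose[OF continuous_map_compose[OF coord[of "Suc i"] continuous_map_fst] this]
    show "continuous_map PL (discrete_topology UNIV) (\<lambda>\<xi>. fst (\<xi> (Suc i)) ! i)" by (simp add: o_def)
  qed (auto simp: extensional_def)
  have 2: "continuous_map PL X (\<lambda>\<xi>. snd (\<xi> 1))"
    using continuous_map_compose[OF coord[of 1] continuous_map_snd] by (simp add: o_def)
  show "continuous_map PL Y b_map"
    unfolding b_map_def[abs_def] by (intro continuous_map_pairedI 1 2)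
  have pre: "continuous_map Y (discrete_topology (words n)) (\<lambda>y. pre n y)" for n
    by (rule continuous_map_cylinders[where h = "\<lambda>p _. p"]) simp
  show "continuous_map Y PL binv"
    unfolding proj_limit_def
  proof (rule continuous_map_into_subtopology)
    show "continuous_map Y (product_topology (\<lambda>n. prod_topology (discrete_topology (words n)) X) {1..}) binv"
      unfolding continuous_map_componentwise
    proof (intro conjI ballI)
      fix n :: nat assume n: "n \<in> {1..}"
      have "continuous_map Y X (\<lambda>y. pt n (kap y))"
        using continuous_map_compose[OF kap_cont pt_cont] by (simp add: o_def)
      then have "continuous_map Y (prod_topology (discrete_topology (words n)) X) (\<lambda>y. (pre n y, pt n (kap y)))"
        by (intro continuous_map_pairedI pre)
      then show "continuous_map Y (prod_topology (discrete_topology (words n)) X) (\<lambda>y. binv y n)"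
        using n by (simp add: binv_def)
    qed (auto simp: binv_def)
    show "binv \<in> Yc \<rightarrow> {\<xi>. \<forall>n\<ge>1. \<xi> n = dual_map \<sigma> (\<xi> (Suc n))}"
      using binv_in unfolding proj_limit_iff by blast
  qed
qed (auto simp: binv_b_map b_map_binv)

section \<open>The conjugation action in coordinates\<close>

lemma b_map_inj: "inj_on b_map (topspace PL)"
  by (rule inj_on_inverseI) (rule binv_b_map)

lemma b_inv_eq: "y \<in> Yc \<Longrightarrow> b_inv X \<sigma> y = binv y"
  unfolding b_inv_def by (rule inv_into_f_eq[OF b_map_inj]) (rule binv_in b_map_binv; assumption)+

lemma AH_map_in_D:
  assumes "f \<in> diag_stage X n"
  shows "\<iota> n f \<in> D"
proof -
  have f: "f \<in> Car n" using assms by (simp add: diag_stage_def)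
  note LS = sys.lift_seq_LS[OF f]
  have "(\<lambda>m. nm m (df m (sys.lift_seq n f m) (sys.lift_seq n f m))) \<longlonglongrightarrow> 0"
    using sys.near_refl[OF LS] by (simp add: sys.near_def)
  from LIMSEQ_unique[OF sys.LA_diff[OF LS LS] this]
  have "cs_norm LA (cs_diff LA (\<iota> n f) (\<iota> n f)) = 0" by (simp add: AH_map_eq)
  then have "cs_norm LA (cs_diff LA (\<iota> n f) (\<iota> n f)) < \<epsilon>" if "\<epsilon> > 0" for \<epsilon>
    using that by simp
  then show ?thesis unfolding AH_diagonal_def AH_algebra_eq
    using assms sys.cls_in[OF LS] unfolding AH_map_eq[symmetric] by blast
qed

lemma chi_AH_map:
  assumes "f \<in> diag_stage X n" "y \<in> Yc"
  shows "chi y (\<iota> n f) = f (pt n y) (pre n y) (pre n y)"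
proof -
  have f: "f \<in> Car n" using assms by (simp add: diag_stage_def)
  have "entry y (sys.lift_seq n f) (k + n) = f (pt n y) (pre n y) (pre n y)" for k
    using connect_entry[OF f assms(2), of k] by (simp add: entry_def lift_seq_shift add.commute[of k])
  then have "(\<lambda>k. entry y (sys.lift_seq n f) (k + n)) \<longlonglongrightarrow> f (pt n y) (pre n y) (pre n y)"
    by simp
  then have "ev y (\<iota> n f) = f (pt n y) (pre n y) (pre n y)"
    unfolding AH_map_eq by (intro ev_eqI sys.lift_seq_LS f assms) (rule LIMSEQ_offset)
  then show ?thesis by (simp add: chi_def AH_map_in_D assms)
qed

text \<open>Settles the definite description in \<open>char_of\<close>. For uniqueness, a character
  is evaluation at some \<open>z\<close>, and its values on the sampled stage elements
  \<open>dg g n\<close> with \<open>n \<ge> 1\<close> determine \<open>g z\<close> in the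
  limit.\<close>

lemma char_of_binv:
  assumes y: "y \<in> Yc"
  shows "char_of X \<sigma> (binv y) = chi (kap y)"
  unfolding char_of_def AH_algebra_eq
proof (rule the_equality)
  show "chi (kap y) \<in> characters LA D \<and> (\<forall>n\<ge>1. \<forall>f\<in>diag_stage X n.
      chi (kap y) (\<iota> n f) = f (snd (binv y n)) (fst (binv y n)) (fst (binv y n)))"
    using y by (simp add: chi_in_characters chi_AH_map binv_def)
next
  fix \<omega> assume w: "\<omega> \<in> characters LA D \<and> (\<forall>n\<ge>1. \<forall>f\<in>diag_stage X n.
      \<omega> (\<iota> n f) = f (snd (binv y n)) (fst (binv y n)) (fst (binv y n)))"
  then obtain z where z: "z \<in> Yc" "\<omega> = chi z" unfolding characters_eq by blast
  have "z = kap y"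
  proof (rule chi_inj[OF z(1) kap_in[OF y]])
    fix g assume g: "g \<in> Cont"
    have "entry z (dg g) n = entry (kap y) (dg g) n" if "n \<ge> 1" for n
    proof -
      have "chi z (\<iota> n (dg g n)) = dg g n (snd (binv y n)) (fst (binv y n)) (fst (binv y n))"
        using w that dg_diag[OF g] z(2) by blast
      then show ?thesis using that by (simp add: chi_AH_map[OF dg_diag[OF g] z(1)] entry_def binv_def)
    qed
    then have "\<forall>\<^sub>F n in sequentially. entry z (dg g) n = entry (kap y) (dg g) n"
      unfolding eventually_sequentially by blast
    from Lim_transform_eventually[OF entry_tendsto[OF dg_LS[OF g] z(1)] this]
    show "g z = g (kap y)"
      using LIMSEQ_unique entry_tendsto[OF dg_LS[OF g] kap_in[OF y]] ev_CC[OF g z(1)] ev_CC[OF g kap_in[OF y]]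
      unfolding CC_def by metis
  qed
  then show "\<omega> = chi (kap y)" using z by simp
qed

lemma char_inv_chi:
  assumes y: "y \<in> Yc"
  shows "char_inv X \<sigma> (chi y) = binv (kapi y)"
  unfolding char_inv_def
proof (rule inv_into_f_eq)
  show "inj_on (char_of X \<sigma>) (topspace PL)"
  proof (rule inj_onI)
    fix \<xi> \<zeta> assume a: "\<xi> \<in> topspace PL" "\<zeta> \<in> topspace PL" "char_of X \<sigma> \<xi> = char_of X \<sigma> \<zeta>"
    have "chi (kap (b_map \<xi>)) = chi (kap (b_map \<zeta>))"
      using a char_of_binv[OF b_map_in[OF a(1)]] char_of_binv[OF b_map_in[OF a(2)]] by (simp add: binv_b_map)
    then have "kap (b_map \<xi>) = kap (b_map \<zeta>)"
      using chi_eq_iff[OF kap_in[OF b_map_in[OF a(1)]] kap_in[OF b_map_in[OF a(2)]]] by simp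
    then have "b_map \<xi> = b_map \<zeta>" using b_map_in a by (metis kapi_kap)
    then show "\<xi> = \<zeta>" using b_map_inj a(1,2) by (auto dest: inj_onD)
  qed
  show "binv (kapi y) \<in> topspace PL" by (intro binv_in kapi_in y)
  show "char_of X \<sigma> (binv (kapi y)) = chi y" using y by (simp add: char_of_binv)
qed

lemma tail_cyl_theta:
  assumes "(t, s) \<in> tail_cyl p q" "length p = length q" "fst y = s"
  shows "fst (theta p q y) = t" "pre (length q) y = q"
proof -
  have "t i = (if i < length p then p ! i else s i)" for i
  proof -
    have p: "prefix_of (length p) t = p" and tail: "\<forall>i\<ge>length p. t i = s i"
      using assms(1) by (simp_all add: tail_cyl_def)
    show ?thesis
    proof (cases "i < length p")
      case True
      then have "prefix_of (length p) t ! i = t i" by (simp add: prefix_of_def)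
      then show ?thesis using True p by simp
    qed (use tail in simp)
  qed
  then show "fst (theta p q y) = t" using assms(3) by (auto simp: theta_def)
  show "pre (length q) y = q" using assms by (simp add: tail_cyl_def)
qed

text \<open>Both sides have first component \<open>t\<close>, and at a stage beyond both prefixes
  \<open>theta\<close> leaves the coordinate in \<open>X\<close> unchanged; equal digits and equal
  stage coordinates give equal points. This makes the requirement in \<open>conj_action\<close>
  consistent over all basic sets.\<close>

lemma theta_indep:
  assumes "(t, s) \<in> tail_cyl p q" "length p = length q" "(t, s) \<in> tail_cyl p' q'" "length p' = length q'"
    and y: "y \<in> Yc" "fst y = s"
  shows "theta p q y = theta p' q' y"
proof -
  let ?n = "max (length p) (length p')"
  have f: "fst (theta p q y) = t" "fst (theta p' q' y) = t" using assms by (auto intro: tail_cyl_theta)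
  have "pt ?n (theta p q y) = pt ?n y" "pt ?n (theta p' q' y) = pt ?n y"
    using assms tail_cyl_theta(2)[OF assms(1,2) y(2)] tail_cyl_theta(2)[OF assms(3,4) y(2)]
    by (auto intro!: pt_theta)
  then have "(\<sigma> ^^ ones (prefix_of ?n t)) (pt ?n (theta p q y)) = (\<sigma> ^^ ones (prefix_of ?n t)) (pt ?n (theta p' q' y))"
    by simp
  then have "snd (theta p q y) = snd (theta p' q' y)"
    using theta_in[OF y(1), of p q] theta_in[OF y(1), of p' q'] unfolding pt_def f topspace_Y by simp
  then show ?thesis using f by (simp add: prod_eq_iff)
qed

lemma conj_action_chi:
  assumes ts: "(t, s) \<in> tail_cyl p q" "length p = length q" and y: "y \<in> Yc" "fst y = s"
  shows "conj_action X \<sigma> (t, s) (chi y) = chi (theta p q y)"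
  unfolding conj_action_def AH_algebra_eq
proof (rule the_equality)
  have conj: "chi (theta p q y) c = chi y (cj (mun p' q') c)"
    if pq: "length p' = length q'" "(t, s) \<in> tail_cyl p' q'" and c: "c \<in> D" for p' q' c
  proof -
    obtain g where g: "g \<in> Cont" "c = CC g" using c by (auto simp: D_eq)
    have "theta p q y = theta p' q' y" by (rule theta_indep[OF ts pq(2,1) y])
    then show ?thesis using g y pq tail_cyl_theta(2)[OF pq(2,1) y(2)]
      by (simp add: conj_munit chi_CC cyl_pull_Cont cyl_pull_def)
  qed
  then show "chi (theta p q y) \<in> characters LA D \<and> (\<forall>p' q'. length p' = length q' \<longrightarrow> (t, s) \<in> tail_cyl p' q' \<longrightarrow>
      (\<forall>c\<in>D. chi (theta p q y) c = chi y (cj (mun p' q') c)))"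
    using chi_in_characters[OF theta_in[OF y(1)]] by blast
  fix \<omega> assume w: "\<omega> \<in> characters LA D \<and> (\<forall>p' q'. length p' = length q' \<longrightarrow> (t, s) \<in> tail_cyl p' q' \<longrightarrow>
      (\<forall>c\<in>D. \<omega> c = chi y (cj (mun p' q') c)))"
  show "\<omega> = chi (theta p q y)"
  proof
    fix c show "\<omega> c = chi (theta p q y) c"
    proof (cases "c \<in> D")
      case True
      then show ?thesis using w ts conj[OF ts(2,1) True] by metis
    next
      case False
      then show ?thesis using w by (auto simp: characters_def chi_def extensional_def)
    qed
  qed
qed

text \<open>\<open>theta\<close> expressed in the coordinates of \<open>b_map\<close>.\<close>

definition tau :: "bool list \<Rightarrow> bool list \<Rightarrow> (nat \<Rightarrow> bool) \<times> 'x \<Rightarrow> (nat \<Rightarrow> bool) \<times> 'x" where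
  "tau p q y = kapi (theta p q (kap y))"

lemma transported_action_eq:
  assumes "(t, s) \<in> tail_cyl p q" "length p = length q" and y: "y \<in> Yc" "fst y = s"
  shows "transported_action X \<sigma> (t, s) y = tau p q y"
proof -
  have "conj_action X \<sigma> (t, s) (char_of X \<sigma> (b_inv X \<sigma> y)) = chi (theta p q (kap y))"
    unfolding b_inv_eq[OF y(1)] char_of_binv[OF y(1)]
    by (rule conj_action_chi[OF assms(1,2) kap_in[OF y(1)]]) (simp add: y)
  then show ?thesis unfolding transported_action_def tau_def
    using y by (simp add: char_inv_chi b_map_binv)
qed

end

section \<open>The tail-equivalence groupoid and its action\<close>

lemma prefix_of_iff: "prefix_of n t = p \<longleftrightarrow> length p = n \<and> (\<forall>i<n. t i = p ! i)"
  unfolding prefix_of_def by (auto simp: list_eq_iff_nth_eq)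

lemma tail_cyl_iff:
  "length p = length q \<Longrightarrow> (t, s) \<in> tail_cyl p q \<longleftrightarrow>
    (\<forall>i<length p. t i = p ! i \<and> s i = q ! i) \<and> (\<forall>i\<ge>length p. t i = s i)"
  unfolding tail_cyl_def by (auto simp: prefix_of_iff)

lemma tail_cylI: "(\<And>i. n \<le> i \<Longrightarrow> t i = s i) \<Longrightarrow> (t, s) \<in> tail_cyl (prefix_of n t) (prefix_of n s)"
  by (simp add: tail_cyl_def)

lemma tail_groupoid_simps [simp]:
  "gp_rng tail_groupoid (t, s) = (t, t)" "gp_src tail_groupoid (t, s) = (s, s)"
  "gp_mult tail_groupoid (t, s) (s', u) = (t, u)"
  by (simp_all add: tail_groupoid_def)

lemma gp_top_tail: "gp_top tail_groupoid = topology_generated_by {tail_cyl p q | p q. length p = length q}"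
  by (simp add: tail_groupoid_def)

lemma topspace_tail: "(t, s) \<in> topspace (gp_top tail_groupoid) \<longleftrightarrow> (\<exists>n. \<forall>i\<ge>n. t i = s i)"
proof
  assume "(t, s) \<in> topspace (gp_top tail_groupoid)"
  then obtain p q where "(t, s) \<in> tail_cyl p q" unfolding gp_top_tail topology_generated_by_topspace by blast
  then have "\<forall>i\<ge>length p. t i = s i" by (simp add: tail_cyl_def)
  then show "\<exists>n. \<forall>i\<ge>n. t i = s i" by blast
next
  assume "\<exists>n. \<forall>i\<ge>n. t i = s i"
  then obtain n where "\<forall>i\<ge>n. t i = s i" by blast
  then have "(t, s) \<in> tail_cyl (prefix_of n t) (prefix_of n s)" by (intro tail_cylI) blast
  moreover have "length (prefix_of n t) = length (prefix_of n s)" by simp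
  ultimately show "(t, s) \<in> topspace (gp_top tail_groupoid)"
    unfolding gp_top_tail topology_generated_by_topspace by blast
qed

lemma openin_tail_cyl: "length p = length q \<Longrightarrow> openin (gp_top tail_groupoid) (tail_cyl p q)"
  unfolding gp_top_tail by (rule topology_generated_by_Basis) blast

context dynamical_system
begin

abbreviation "TG \<equiv> tail_groupoid"
abbreviation "act \<equiv> transported_action X \<sigma>"
abbreviation "AP \<equiv> action_pairs TG Y transported_anchor"

lemma AP_iff: "((t, s), y) \<in> AP \<longleftrightarrow> (\<exists>n. \<forall>i\<ge>n. t i = s i) \<and> y \<in> Yc \<and> fst y = s"
  unfolding action_pairs_def transported_anchor_def by (auto simp: topspace_tail case_prod_beta)

lemma AP_cases:
  assumes "z \<in> AP"
  obtains t s y p q where "z = ((t, s), y)" "y \<in> Yc" "fst y = s" "length p = length q" "(t, s) \<in> tail_cyl p q"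
proof -
  obtain t s y where z: "z = ((t, s), y)" by (metis prod.exhaust)
  then obtain n where n: "\<forall>i\<ge>n. t i = s i" and y: "y \<in> Yc" "fst y = s" using assms AP_iff by blast
  have "(t, s) \<in> tail_cyl (prefix_of n t) (prefix_of n s)" using n by (intro tail_cylI) blast
  then show ?thesis using that[OF z y, of "prefix_of n t" "prefix_of n s"] by simp
qed

lemma tail_cyl_AP:
  assumes "(t, s) \<in> tail_cyl p q" "y \<in> Yc" "fst y = s"
  shows "((t, s), y) \<in> AP"
proof -
  have "\<forall>i\<ge>length p. t i = s i" using assms(1) by (simp add: tail_cyl_def)
  then show ?thesis unfolding AP_iff using assms(2,3) by blast
qed

lemma tau_in: "y \<in> Yc \<Longrightarrow> tau p q y \<in> Yc"
  unfolding tau_def by (intro kapi_in theta_in kap_in)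

lemma act_in:
  assumes "((t, s), y) \<in> AP"
  shows "act (t, s) y \<in> Yc" "fst (act (t, s) y) = t"
proof -
  obtain p q where y: "y \<in> Yc" "fst y = s" and pq: "length p = length q" "(t, s) \<in> tail_cyl p q"
    using assms by (rule AP_cases) auto
  have a: "act (t, s) y = tau p q y" by (rule transported_action_eq[OF pq(2,1) y])
  show "act (t, s) y \<in> Yc" unfolding a by (rule tau_in[OF y(1)])
  show "fst (act (t, s) y) = t" unfolding a tau_def fst_kapi
    by (rule tail_cyl_theta(1)[OF pq(2,1)]) (simp add: y)
qed

lemma theta_Nil: "theta [] [] y = y"
  by (simp add: theta_def)

lemma act_unit:
  assumes "y \<in> Yc" "fst y = t"
  shows "act (t, t) y = y"
proof -
  have "(t, t) \<in> tail_cyl [] []" by (simp add: tail_cyl_def prefix_of_def)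
  then have "act (t, t) y = tau [] [] y" by (rule transported_action_eq) (use assms in auto)
  then show ?thesis using assms(1) by (simp only: tau_def theta_Nil kapi_kap)
qed

lemma theta_comp: "length p = length q \<Longrightarrow> y \<in> Yc \<Longrightarrow> theta p q (theta q r y) = theta p r y"
  by (auto simp: theta_def topspace_Y)

text \<open>Cutting two composable arrows and their product at one length describes them by the same
  three prefixes, so that \<open>theta_comp\<close> applies.\<close>

lemma tail_common:
  assumes "\<exists>n. \<forall>i\<ge>n. (r :: nat \<Rightarrow> bool) i = t i" "\<exists>n. \<forall>i\<ge>n. t i = s i"
  obtains n where "(r, t) \<in> tail_cyl (prefix_of n r) (prefix_of n t)" "(t, s) \<in> tail_cyl (prefix_of n t) (prefix_of n s)"
    "(r, s) \<in> tail_cyl (prefix_of n r) (prefix_of n s)"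
proof -
  obtain m k where mk: "\<forall>i\<ge>m. r i = t i" "\<forall>i\<ge>k. t i = s i" using assms by blast
  show ?thesis
    by (rule that[of "max m k"]; rule tail_cylI) (use mk in auto)
qed

lemma act_mult:
  assumes "((t, s), y) \<in> AP" "(r, t) \<in> topspace (gp_top TG)"
  shows "act (r, s) y = act (r, t) (act (t, s) y)"
proof -
  have y: "y \<in> Yc" "fst y = s" using assms(1) by (auto simp: AP_iff)
  obtain n where n: "(r, t) \<in> tail_cyl (prefix_of n r) (prefix_of n t)" "(t, s) \<in> tail_cyl (prefix_of n t) (prefix_of n s)"
    "(r, s) \<in> tail_cyl (prefix_of n r) (prefix_of n s)"
    using tail_common[of r t s] assms by (metis AP_iff topspace_tail)
  let ?r = "prefix_of n r" and ?t = "prefix_of n t" and ?s = "prefix_of n s"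
  have 1: "act (t, s) y = tau ?t ?s y" by (rule transported_action_eq[OF n(2) _ y]) simp
  have "act (r, t) (act (t, s) y) = tau ?r ?t (tau ?t ?s y)"
    using transported_action_eq[OF n(1) _ act_in[OF assms(1)]] 1 by simp
  also have "\<dots> = tau ?r ?s y"
    unfolding tau_def by (simp only: kap_kapi[OF theta_in[OF kap_in[OF y(1)]]] theta_comp[OF _ kap_in[OF y(1)]] length_prefix_of)
  also have "\<dots> = act (r, s) y" by (rule transported_action_eq[OF n(3) _ y, symmetric]) simp
  finally show ?thesis by simp
qed

lemma tau_cont: "continuous_map Y Y (tau p q)"
  using continuous_map_compose[OF continuous_map_compose[OF kap_cont theta_cont] kapi_cont]
  by (simp add: tau_def[abs_def] o_def)

abbreviation "TT \<equiv> subtopology (prod_topology (gp_top TG) Y) AP"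

lemma topspace_TT: "topspace TT = AP"
  unfolding topspace_subtopology topspace_prod_topology[of "gp_top TG"] by (auto simp: action_pairs_def)

lemma openin_TT:
  assumes "length p = length q" "openin Y V"
  shows "openin TT ((tail_cyl p q \<times> V) \<inter> AP)"
  by (intro openin_subtopology_Int openin_prod_Times_iff[THEN iffD2] disjI2 conjI openin_tail_cyl assms)

text \<open>On each basic set of arrows the action is the single continuous map
  \<open>tau p q\<close>.\<close>

lemma act_cont: "continuous_map TT Y (\<lambda>(\<gamma>, y). act \<gamma> y)"
  unfolding continuous_map_def topspace_TT
proof (intro conjI allI impI)
  show "(\<lambda>(\<gamma>, y). act \<gamma> y) \<in> AP \<rightarrow> Yc" using act_in(1) by (auto)
  fix U assume U: "openin Y U"
  let ?P = "{z \<in> AP. (case z of (\<gamma>, y) \<Rightarrow> act \<gamma> y) \<in> U}"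
  show "openin TT ?P"
  proof (subst openin_subopen, intro ballI)
    fix z assume z: "z \<in> ?P"
    then have "z \<in> AP" by simp
    then obtain t s y p q where z': "z = ((t, s), y)" "y \<in> Yc" "fst y = s" "length p = length q" "(t, s) \<in> tail_cyl p q"
      by (rule AP_cases)
    let ?V = "{y \<in> Yc. tau p q y \<in> U}"
    have sub: "(tail_cyl p q \<times> ?V) \<inter> AP \<subseteq> ?P"
    proof
      fix w assume w: "w \<in> (tail_cyl p q \<times> ?V) \<inter> AP"
      obtain t' s' y' where w': "w = ((t', s'), y')" by (metis prod.exhaust)
      have "act (t', s') y' = tau p q y'"
        using w z'(4) unfolding w' by (intro transported_action_eq) (auto simp: AP_iff)
      then show "w \<in> ?P" using w unfolding w' by simp
    qed
    have "act (t, s) y = tau p q y" by (rule transported_action_eq[OF z'(5,4,2,3)])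
    then have "z \<in> (tail_cyl p q \<times> ?V) \<inter> AP" using z z' by (simp)
    then show "\<exists>T. openin TT T \<and> z \<in> T \<and> T \<subseteq> ?P"
      using sub openin_TT[OF z'(4) openin_continuous_map_preimage[OF tau_cont U]] by blast
  qed
qed

lemma anchor_cont: "continuous_map Y (gp_top TG) transported_anchor"
  unfolding gp_top_tail
proof (rule continuous_on_generated_topo)
  fix U assume "U \<in> {tail_cyl p q | p q. length p = length q}"
  then obtain p q where U: "U = tail_cyl p q" "length p = length q" by blast
  \<comment> \<open>A unit \<open>(t, t)\<close> lies in the basic set of \<open>p\<close> and
    \<open>q\<close> only if \<open>p = q\<close>.\<close>
  have "transported_anchor -` U \<inter> Yc = (if p = q then {y \<in> Yc. pre (length p) y = p} else {})"
    unfolding U(1) transported_anchor_def tail_cyl_def by auto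
  then show "openin Y (transported_anchor -` U \<inter> Yc)" using openin_prefix[of "length p" p]
    by (cases "p = q") (simp_all)
next
  have "transported_anchor y \<in> topspace (gp_top TG)" for y :: "(nat \<Rightarrow> bool) \<times> 'x"
    unfolding transported_anchor_def by (auto simp: topspace_tail case_prod_beta)
  then show "transported_anchor ` Yc \<subseteq> \<Union> {tail_cyl p q | p q. length p = length q}"
    unfolding gp_top_tail topology_generated_by_topspace by blast
qed

lemma action: "groupoid_action TG Y transported_anchor act"
  unfolding groupoid_action_def
proof (intro conjI)
  show "\<forall>y\<in>Yc. gp_src TG (transported_anchor y) = transported_anchor y \<and> gp_rng TG (transported_anchor y) = transported_anchor y"
    by (auto simp: transported_anchor_def)
  show "\<forall>(\<gamma>, y)\<in>AP. transported_anchor (act \<gamma> y) = gp_rng TG \<gamma>"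
  proof (clarify)
    fix t s y1 y2 assume "((t, s), (y1, y2)) \<in> AP"
    from act_in(2)[OF this] show "transported_anchor (act (t, s) (y1, y2)) = gp_rng TG (t, s)"
      by (simp add: transported_anchor_def case_prod_beta)
  qed
  show "\<forall>y\<in>Yc. act (transported_anchor y) y = y"
    using act_unit by (auto simp: transported_anchor_def case_prod_beta)
  show "\<forall>(\<gamma>, y)\<in>AP. \<forall>\<eta>\<in>topspace (gp_top TG). gp_src TG \<eta> = gp_rng TG \<gamma> \<longrightarrow> act (gp_mult TG \<eta> \<gamma>) y = act \<eta> (act \<gamma> y)"
  proof (clarify)
    fix t s y1 y2 r t' assume a: "((t, s), (y1, y2)) \<in> AP" "(r, t') \<in> topspace (gp_top TG)" "gp_src TG (r, t') = gp_rng TG (t, s)"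
    then have "t' = t" by simp
    then show "act (gp_mult TG (r, t') (t, s)) (y1, y2) = act (r, t') (act (t, s) (y1, y2))"
      using act_mult[OF a(1), of r] a(2) by simp
  qed
qed (rule anchor_cont act_cont)+

end

section \<open>Germs and the Weyl groupoid\<close>

lemma fst_germ [simp]: "fst (germ S f x) = x"
  by (simp add: germ_def)

lemma germ_eqI:
  assumes "openin S U" "x \<in> U" "\<And>z. z \<in> U \<Longrightarrow> f z = g z"
  shows "germ S f x = germ S g x"
proof -
  have *: "\<exists>V. openin S V \<and> x \<in> V \<and> (\<forall>z\<in>V. v z = h z)"
    if "\<exists>V. openin S V \<and> x \<in> V \<and> (\<forall>z\<in>V. u z = h z)" "\<forall>z\<in>U. u z = v z" for u v h
  proof -
    from that(1) obtain V where "openin S V" "x \<in> V" "\<forall>z\<in>V. u z = h z" by (elim exE conjE)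
    then show ?thesis using assms(1,2) that(2) by (intro exI[of _ "U \<inter> V"]) auto
  qed
  have "(\<exists>V. openin S V \<and> x \<in> V \<and> (\<forall>z\<in>V. f z = h z)) \<longleftrightarrow> (\<exists>V. openin S V \<and> x \<in> V \<and> (\<forall>z\<in>V. g z = h z))" for h
    by (rule iffI; erule *) (use assms(3) in simp_all)
  then show ?thesis by (simp add: germ_def)
qed

text \<open>Range and product in \<open>germ_groupoid\<close> use a chosen function; it coincides
  with the given one near the base point, which is all that a germ depends on.\<close>

lemma germ_rep_agree:
  assumes "x \<in> topspace S"
  obtains U where "openin S U" "x \<in> U" "\<And>z. z \<in> U \<Longrightarrow> germ_rep (germ S f x) z = f z"
proof -
  have "f \<in> snd (germ S f x)" unfolding germ_def snd_conv using assms by auto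
  then have "germ_rep (germ S f x) \<in> snd (germ S f x)" unfolding germ_rep_def by (rule someI[where P = "\<lambda>h. h \<in> snd (germ S f x)"])
  then obtain U where U: "openin S U" "x \<in> U" "\<forall>z\<in>U. f z = germ_rep (germ S f x) z"
    unfolding germ_def snd_conv by blast
  show ?thesis by (rule that[OF U(1,2)]) (use U(3) in simp)
qed

lemma germ_rep_value: "x \<in> topspace S \<Longrightarrow> germ_rep (germ S f x) x = f x"
  by (metis germ_rep_agree)

context dynamical_system
begin

section \<open>Germs of matrix units and the comparison map\<close>

abbreviation "SS \<equiv> spectrum_top LA D"
abbreviation "WW \<equiv> weyl_groupoid LA D"
abbreviation "Wc \<equiv> topspace (gp_top WW)"
abbreviation "weyl_base \<equiv> {germ SS (\<alpha> n) ` U | n U. n \<in> Nor \<and> openin SS U \<and> U \<subseteq> dm n}"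
abbreviation "mu p q \<equiv> \<alpha> (mun p q)"

lemma chi_in_SS: "y \<in> Yc \<Longrightarrow> chi y \<in> topspace SS"
  unfolding topspace_spectrum by (rule imageI)

lemma openin_chi_image: "openin Y V \<Longrightarrow> openin SS (chi ` V)"
  using homeomorphic_imp_open_map[OF chi_homeomorphic] unfolding open_map_def by blast

lemma chi_cont: "continuous_map Y SS chi"
  using chi_homeomorphic by (rule homeomorphic_imp_continuous_map)

lemma weyl_open:
  assumes "n \<in> Nor" "openin SS U" "U \<subseteq> dm n"
  shows "openin (gp_top WW) (germ SS (\<alpha> n) ` U)"
  unfolding weyl_groupoid_def germ_groupoid_def top_groupoid.simps
  by (rule topology_generated_by_Basis) (use assms in blast)

lemma weyl_gp_top: "gp_top WW = topology_generated_by
    weyl_base"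
  unfolding weyl_groupoid_def germ_groupoid_def top_groupoid.simps
  by (rule arg_cong[of _ _ topology_generated_by]) blast

lemma weyl_simps:
  "gp_rng WW g = germ SS id (germ_rep g (fst g))" "gp_src WW g = germ SS id (fst g)"
  "gp_mult WW g h = germ SS (germ_rep g \<circ> germ_rep h) (fst h)"
  by (simp_all add: weyl_groupoid_def germ_groupoid_def)

text \<open>Points near \<open>y\<close> share the first \<open>m\<close> digits of
  \<open>s\<close>. Replacing these by the digits of \<open>t\<close> gives an arrow in both basic
  sets, so \<open>theta_indep\<close> identifies the two maps at every such point and not only at
  \<open>y\<close>.\<close>

lemma mu_germ_indep:
  assumes pq: "(t, s) \<in> tail_cyl p q" "length p = length q" and pq': "(t, s) \<in> tail_cyl p' q'" "length p' = length q'"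
    and y: "y \<in> Yc" "fst y = s"
  shows "germ SS (mu p q) (chi y) = germ SS (mu p' q') (chi y)"
proof -
  define m where "m = max (length p) (length p')"
  define V where "V = {z \<in> Yc. pre m z = prefix_of m s}"
  have cyl: "(\<lambda>i. if i < m then t i else u i, u) \<in> tail_cyl p q"
    "(\<lambda>i. if i < m then t i else u i, u) \<in> tail_cyl p' q'"
    if "prefix_of m u = prefix_of m s" for u
    using that pq pq' unfolding tail_cyl_iff[OF pq(2)] tail_cyl_iff[OF pq'(2)] prefix_of_eq_iff m_def by auto
  show ?thesis
  proof (rule germ_eqI[of _ "chi ` V"])
    show "openin SS (chi ` V)" unfolding V_def by (intro openin_chi_image openin_prefix)
    show "chi y \<in> chi ` V" using y unfolding V_def by (intro imageI) simp
    fix \<omega> assume "\<omega> \<in> chi ` V"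
    then obtain z where z: "\<omega> = chi z" "z \<in> Yc" "pre m z = prefix_of m s" unfolding V_def by blast
    have "mu p q (chi z) = chi (theta p q z)" "mu p' q' (chi z) = chi (theta p' q' z)"
      using weyl_munit(2)[OF pq(2) z(2) tail_cyl_theta(2)[OF cyl(1)[OF z(3)] pq(2) refl]]
        weyl_munit(2)[OF pq'(2) z(2) tail_cyl_theta(2)[OF cyl(2)[OF z(3)] pq'(2) refl]] by blast+
    then show "mu p q \<omega> = mu p' q' \<omega>"
      using theta_indep[OF cyl(1)[OF z(3)] pq(2) cyl(2)[OF z(3)] pq'(2) z(2) refl] z(1) by simp
  qed
qed

text \<open>The inverse of the isomorphism. The least \<open>n\<close> merely selects one matrix
  unit for the arrow; by \<open>psi_eq\<close> any other one for it gives the same germ. The base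
  point is moved by \<open>kap\<close> because \<open>chi\<close> reads stage-0 coordinates.\<close>

definition psi :: "((nat \<Rightarrow> bool) \<times> (nat \<Rightarrow> bool)) \<times> (nat \<Rightarrow> bool) \<times> 'x \<Rightarrow> ((nat \<Rightarrow> 'x fmat) set \<Rightarrow> complex) germ" where
  "psi = (\<lambda>((t, s), y). let n = (LEAST n. \<forall>i\<ge>n. t i = s i) in germ SS (mu (prefix_of n t) (prefix_of n s)) (chi (kap y)))"

lemma psi_eq:
  assumes "(t, s) \<in> tail_cyl p q" "length p = length q" "y \<in> Yc" "fst y = s"
  shows "psi ((t, s), y) = germ SS (mu p q) (chi (kap y))"
proof -
  define n where "n = (LEAST n. \<forall>i\<ge>n. t i = s i)"
  have "\<forall>i\<ge>length p. t i = s i" using assms(1) by (simp add: tail_cyl_def)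
  then have "\<forall>i\<ge>n. t i = s i" unfolding n_def by (rule LeastI)
  then have cyl: "(t, s) \<in> tail_cyl (prefix_of n t) (prefix_of n s)" by (intro tail_cylI) blast
  have "psi ((t, s), y) = germ SS (mu (prefix_of n t) (prefix_of n s)) (chi (kap y))"
    unfolding psi_def n_def by (simp add: Let_def)
  also have "\<dots> = germ SS (mu p q) (chi (kap y))"
    by (rule mu_germ_indep[OF cyl _ assms(1,2) kap_in[OF assms(3)]]) (simp_all add: assms(4))
  finally show ?thesis .
qed

lemma mu_kap:
  assumes "(t, s) \<in> tail_cyl p q" "length p = length q" "y \<in> Yc" "fst y = s"
  shows "mu p q (chi (kap y)) = chi (kap (tau p q y))"
proof -
  have "pre (length q) (kap y) = q" by (rule tail_cyl_theta(2)[OF assms(1,2)]) (simp add: assms)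
  from weyl_munit(2)[OF assms(2) kap_in[OF assms(3)] this] show ?thesis
    by (simp only: tau_def kap_kapi[OF theta_in[OF kap_in[OF assms(3)]]])
qed

text \<open>The base point of the germ returns \<open>y\<close> and with it \<open>s\<close>; the
  value there has first component \<open>t\<close>.\<close>

lemma psi_inj: "inj_on psi AP"
proof (rule inj_onI)
  fix z w assume z: "z \<in> AP" and w: "w \<in> AP" and eq: "psi z = psi w"
  obtain t s y p q where z': "z = ((t, s), y)" "y \<in> Yc" "fst y = s" "length p = length q" "(t, s) \<in> tail_cyl p q"
    using z by (rule AP_cases)
  obtain t' s' y' p' q' where w': "w = ((t', s'), y')" "y' \<in> Yc" "fst y' = s'" "length p' = length q'" "(t', s') \<in> tail_cyl p' q'"
    using w by (rule AP_cases)
  have g: "germ SS (mu p q) (chi (kap y)) = germ SS (mu p' q') (chi (kap y'))"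
    using eq unfolding z'(1) w'(1) psi_eq[OF z'(5,4,2,3)] psi_eq[OF w'(5,4,2,3)] .
  have "chi (kap y) = chi (kap y')" using arg_cong[OF g, of fst] by simp
  then have "kap y = kap y'" using chi_eq_iff[OF kap_in[OF z'(2)] kap_in[OF w'(2)]] by simp
  then have "kapi (kap y) = kapi (kap y')" by (rule arg_cong)
  then have y: "y = y'" unfolding kapi_kap[OF z'(2)] kapi_kap[OF w'(2)] .
  then have yw: "fst y = s'" using w'(3) by simp
  let ?c = "chi (kap y)"
  note c = chi_in_SS[OF kap_in[OF z'(2)]]
  have g': "germ SS (mu p q) ?c = germ SS (mu p' q') ?c" using g unfolding y .
  have "mu p q ?c = germ_rep (germ SS (mu p q) ?c) ?c" by (rule germ_rep_value[OF c, symmetric])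
  also have "\<dots> = germ_rep (germ SS (mu p' q') ?c) ?c" by (simp only: g')
  also have "\<dots> = mu p' q' ?c" by (rule germ_rep_value[OF c])
  finally have "chi (kap (tau p q y)) = chi (kap (tau p' q' y))"
    unfolding mu_kap[OF z'(5,4,2,3)] mu_kap[OF w'(5,4) z'(2) yw] .
  then have "kap (tau p q y) = kap (tau p' q' y)"
    unfolding chi_eq_iff[OF kap_in[OF tau_in[OF z'(2)]] kap_in[OF tau_in[OF z'(2)]]] .
  then have "fst (kap (tau p q y)) = fst (kap (tau p' q' y))" by (rule arg_cong)
  moreover have "fst (tau p q y) = t"
    using act_in(2)[OF z[unfolded z'(1)]] unfolding transported_action_eq[OF z'(5,4,2,3)] .
  moreover have "fst (tau p' q' y) = t'"
    using act_in(2)[OF w[unfolded w'(1)]] unfolding transported_action_eq[OF w'(5,4,2,3)] y .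
  ultimately show "z = w" unfolding z'(1) w'(1) fst_kap using y z'(3) yw by simp
qed

lemma psi_image_cyl:
  assumes "length p = length q" "B \<subseteq> Yc"
  shows "psi ` ((tail_cyl p q \<times> B) \<inter> AP) = germ SS (mu p q) ` chi ` kap ` {y \<in> B. pre (length q) y = q}"
    (is "_ = germ SS (mu p q) ` chi ` kap ` ?B")
proof (intro set_eqI iffI)
  fix g assume "g \<in> psi ` ((tail_cyl p q \<times> B) \<inter> AP)"
  then obtain t s y where z: "g = psi ((t, s), y)" "(t, s) \<in> tail_cyl p q" "y \<in> B" "((t, s), y) \<in> AP" by auto
  have y: "y \<in> Yc" "fst y = s" using z(4) by (auto simp: AP_iff)
  have "pre (length q) y = q" by (rule tail_cyl_theta(2)[OF z(2) assms(1) y(2)])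
  then show "g \<in> germ SS (mu p q) ` chi ` kap ` ?B"
    unfolding z(1) psi_eq[OF z(2) assms(1) y] using z(3) by blast
next
  fix g assume "g \<in> germ SS (mu p q) ` chi ` kap ` ?B"
  then obtain y where y: "g = germ SS (mu p q) (chi (kap y))" "y \<in> B" "pre (length q) y = q" by blast
  have yY: "y \<in> Yc" using y(2) assms(2) by blast
  define t where "t = fst (theta p q y)"
  have cyl: "(t, fst y) \<in> tail_cyl p q"
    using y(3) assms(1) unfolding tail_cyl_iff[OF assms(1)] t_def by (auto simp: theta_def prefix_of_iff)
  have "g = psi ((t, fst y), y)" unfolding y(1) by (rule psi_eq[OF cyl assms(1) yY refl, symmetric])
  then show "g \<in> psi ` ((tail_cyl p q \<times> B) \<inter> AP)"
    using cyl y(2) tail_cyl_AP[OF cyl yY refl] by blast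
qed

text \<open>\<open>psi\<close> sends a basic open set to the germs of one matrix unit over an open
  set, which is basic open in the Weyl groupoid. This openness is later the continuity of
  \<open>phi\<close>.\<close>

lemma openin_psi_cyl:
  assumes "length p = length q" "openin Y B"
  shows "openin (gp_top WW) (psi ` ((tail_cyl p q \<times> B) \<inter> AP))"
proof -
  let ?B = "{y \<in> B. pre (length q) y = q}" and ?E = "{y \<in> Yc. kapi y \<in> B} \<inter> {y \<in> Yc. pre (length q) y = q}"
  have B: "B \<subseteq> Yc" using openin_subset[OF assms(2)] .
  have "kap ` ?B = ?E"
  proof (intro set_eqI iffI)
    fix y assume "y \<in> kap ` ?B"
    then obtain x where x: "y = kap x" "x \<in> B" "pre (length q) x = q" by blast
    have xY: "x \<in> Yc" using x(2) B by blast
    show "y \<in> ?E"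
      unfolding x(1) using kap_in[OF xY] kapi_kap[OF xY] x(2,3) by (simp)
  next
    fix y assume y: "y \<in> ?E"
    then have "y = kap (kapi y)" by (simp)
    then show "y \<in> kap ` ?B"
      using y by (intro image_eqI[of _ _ "kapi y"]) auto
  qed
  then have "openin Y (kap ` ?B)"
    using openin_continuous_map_preimage[OF kapi_cont assms(2)] openin_prefix[of "length q" q]
    by (simp only: openin_Int)
  then have op: "openin SS (chi ` kap ` ?B)" by (rule openin_chi_image)
  have "chi ` kap ` ?B \<subseteq> dm (mun p q)"
  proof
    fix \<omega> assume "\<omega> \<in> chi ` kap ` ?B"
    then obtain y where y: "\<omega> = chi (kap y)" "y \<in> B" "pre (length q) y = q" by blast
    have yY: "y \<in> Yc" using y(2) B by blast
    show "\<omega> \<in> dm (mun p q)"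
      unfolding y(1) by (rule weyl_munit(1)[OF assms(1) kap_in[OF yY]]) (simp add: y(3))
  qed
  from weyl_open[OF munit_normaliser[OF assms(1)] op this] show ?thesis
    unfolding psi_image_cyl[OF assms(1) B] .
qed

text \<open>Germ form of \<open>normaliser_local\<close>: near a point of its domain a normaliser
  has the same germs as one matrix unit. Surjectivity and continuity of \<open>psi\<close> both rest
  on it.\<close>

lemma weyl_germ_local:
  assumes n: "n \<in> Nor" and w: "\<omega> \<in> dm n"
  obtains t y p q V where "length p = length q" "openin Y V" "\<omega> = chi (kap y)" "y \<in> Yc" "kap y \<in> V"
    "(t, fst y) \<in> tail_cyl p q" "\<And>z. z \<in> V \<Longrightarrow> germ SS (\<alpha> n) (chi z) = germ SS (mu p q) (chi z)"
proof -
  have "\<omega> \<in> chi ` Yc" using w unfolding weyl_dom_def characters_eq by blast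
  then obtain y0 where y0: "\<omega> = chi y0" "y0 \<in> Yc" by blast
  obtain p q V where pqV: "length p = length q" "openin Y V" "y0 \<in> V"
    "\<And>z. z \<in> V \<Longrightarrow> pre (length q) z = q"
    "\<And>z. z \<in> V \<Longrightarrow> \<alpha> n (chi z) = chi (theta p q z)"
    using w unfolding y0(1) by (rule normaliser_local[OF n y0(2)]) blast
  show ?thesis
  proof (rule that[OF pqV(1,2), of "kapi y0" "fst (theta p q y0)"])
    show "\<omega> = chi (kap (kapi y0))" "kapi y0 \<in> Yc" "kap (kapi y0) \<in> V"
      using y0 pqV(3) kapi_in[OF y0(2)] by (simp_all)
    show "(fst (theta p q y0), fst (kapi y0)) \<in> tail_cyl p q"
      using pqV(4)[OF pqV(3)] pqV(1) unfolding tail_cyl_iff[OF pqV(1)] by (auto simp: theta_def prefix_of_iff)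
    fix z assume z: "z \<in> V"
    show "germ SS (\<alpha> n) (chi z) = germ SS (mu p q) (chi z)"
    proof (rule germ_eqI[of _ "chi ` V"])
      show "openin SS (chi ` V)" by (rule openin_chi_image[OF pqV(2)])
      show "chi z \<in> chi ` V" using z by (rule imageI)
      fix \<nu> assume "\<nu> \<in> chi ` V"
      then obtain v where v: "\<nu> = chi v" "v \<in> V" by blast
      have vY: "v \<in> Yc" using openin_subset[OF pqV(2)] v(2) by blast
      show "\<alpha> n \<nu> = mu p q \<nu>"
        unfolding v(1) using pqV(5)[OF v(2)] weyl_munit(2)[OF pqV(1) vY pqV(4)[OF v(2)]] by simp
    qed
  qed
qed

lemma psi_image: "psi ` AP = Wc"
proof (intro set_eqI iffI)
  fix g assume "g \<in> psi ` AP"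
  then obtain z where z: "g = psi z" "z \<in> AP" by blast
  from z(2) obtain t s y p q where z': "z = ((t, s), y)" "y \<in> Yc" "fst y = s" "length p = length q" "(t, s) \<in> tail_cyl p q"
    by (rule AP_cases)
  have "g \<in> psi ` ((tail_cyl p q \<times> Yc) \<inter> AP)" unfolding z(1) using z(2) z' by (intro imageI) (simp)
  then show "g \<in> Wc"
    using openin_subset[OF openin_psi_cyl[OF z'(4) openin_topspace]] by blast
next
  fix g assume "g \<in> Wc"
  then obtain n U \<omega> where g: "n \<in> Nor" "U \<subseteq> dm n" "\<omega> \<in> U" "g = germ SS (\<alpha> n) \<omega>"
    unfolding weyl_gp_top topology_generated_by_topspace by blast
  have "\<omega> \<in> dm n" using g by blast
  from g(1) this obtain t y p q V where l: "length p = length q" "openin Y V" "\<omega> = chi (kap y)" "y \<in> Yc" "kap y \<in> V"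
    "(t, fst y) \<in> tail_cyl p q" "\<And>z. z \<in> V \<Longrightarrow> germ SS (\<alpha> n) (chi z) = germ SS (mu p q) (chi z)"
    by (rule weyl_germ_local) blast
  have "g = psi ((t, fst y), y)"
    unfolding g(4) l(3) l(7)[OF l(5)] by (rule psi_eq[OF l(6,1,4) refl, symmetric])
  then show "g \<in> psi ` AP" using tail_cyl_AP[OF l(6,4) refl] by blast
qed

lemma psi_cont: "continuous_map TT (gp_top WW) psi"
  unfolding weyl_gp_top
proof (rule continuous_on_generated_topo)
  show "psi ` topspace TT \<subseteq> \<Union> weyl_base"
    unfolding topspace_TT using psi_image[unfolded weyl_gp_top topology_generated_by_topspace] by (rule equalityD1)
  fix B assume "B \<in> weyl_base"
  then obtain n U where n: "n \<in> Nor" and U: "openin SS U" "U \<subseteq> dm n"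
    and B: "B = germ SS (\<alpha> n) ` U" by (elim CollectE exE conjE)
  show "openin TT (psi -` B \<inter> topspace TT)" unfolding topspace_TT
  proof (subst openin_subopen, intro ballI)
    fix z assume z: "z \<in> psi -` B \<inter> AP"
    then obtain \<omega> where w: "\<omega> \<in> U" "psi z = germ SS (\<alpha> n) \<omega>" unfolding B by blast
    have "\<omega> \<in> dm n" using w U by blast
    from n this obtain t y p q V where l: "length p = length q" "openin Y V" "\<omega> = chi (kap y)" "y \<in> Yc" "kap y \<in> V"
      "(t, fst y) \<in> tail_cyl p q" "\<And>z. z \<in> V \<Longrightarrow> germ SS (\<alpha> n) (chi z) = germ SS (mu p q) (chi z)"
      by (rule weyl_germ_local) blast
    have zAP: "((t, fst y), y) \<in> AP" by (rule tail_cyl_AP[OF l(6,4) refl])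
    have "psi z = psi ((t, fst y), y)"
      unfolding w(2) l(3) l(7)[OF l(5)] by (rule psi_eq[OF l(6,1,4) refl, symmetric])
    then have z': "z = ((t, fst y), y)" using psi_inj z zAP by (auto dest: inj_onD)
    \<comment> \<open>Two conditions keep a nearby germ in \<open>B\<close>: its base point stays in
      \<open>U\<close>, and the matrix unit still has the germ of \<open>n\<close> there.\<close>
    let ?V = "{y \<in> Yc. kap y \<in> V} \<inter> {y \<in> Yc. (chi \<circ> kap) y \<in> U}"
    have oV: "openin Y ?V"
      by (intro openin_Int openin_continuous_map_preimage[OF kap_cont l(2)]
          openin_continuous_map_preimage[OF continuous_map_compose[OF kap_cont chi_cont] U(1)])
    have "z \<in> (tail_cyl p q \<times> ?V) \<inter> AP" unfolding z' using l w(1) zAP by (simp)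
    moreover have "(tail_cyl p q \<times> ?V) \<inter> AP \<subseteq> psi -` B \<inter> AP"
    proof
      fix v assume v: "v \<in> (tail_cyl p q \<times> ?V) \<inter> AP"
      obtain t' s' y' where v': "v = ((t', s'), y')" by (metis prod.exhaust)
      have y': "(t', s') \<in> tail_cyl p q" "y' \<in> Yc" "kap y' \<in> V" "chi (kap y') \<in> U" "fst y' = s'"
        using v unfolding v' by (auto simp: AP_iff)
      have "psi v = germ SS (\<alpha> n) (chi (kap y'))"
        unfolding v' psi_eq[OF y'(1) l(1) y'(2,5)] l(7)[OF y'(3)] ..
      then show "v \<in> psi -` B \<inter> AP" unfolding B using y'(4) v by blast
    qed
    ultimately show "\<exists>T. openin TT T \<and> z \<in> T \<and> T \<subseteq> psi -` B \<inter> AP"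
      using openin_TT[OF l(1) oV] by blast
  qed
qed

section \<open>The inverse of \<open>psi\<close> and its continuity\<close>

definition phi where "phi = inv_into AP psi"

lemma phi_psi: "z \<in> AP \<Longrightarrow> phi (psi z) = z"
  unfolding phi_def by (rule inv_into_f_f[OF psi_inj])

lemma psi_phi: "g \<in> Wc \<Longrightarrow> psi (phi g) = g"
  unfolding phi_def psi_image[symmetric] by (rule f_inv_into_f)

lemma phi_in: "g \<in> Wc \<Longrightarrow> phi g \<in> AP"
  unfolding phi_def psi_image[symmetric] by (rule inv_into_into)

lemma phi_preimage: "{g \<in> Wc. phi g \<in> K} = psi ` (K \<inter> AP)"
proof (intro set_eqI iffI)
  fix g assume "g \<in> {g \<in> Wc. phi g \<in> K}"
  then show "g \<in> psi ` (K \<inter> AP)" using psi_phi[of g] phi_in[of g] by (intro image_eqI[of _ _ "phi g"]) auto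
next
  fix g assume "g \<in> psi ` (K \<inter> AP)"
  then obtain z where "g = psi z" "z \<in> K" "z \<in> AP" by blast
  then show "g \<in> {g \<in> Wc. phi g \<in> K}" using psi_image phi_psi by auto
qed

lemma phi_cont: "continuous_map (gp_top WW) TT phi"
proof (rule continuous_map_into_subtopology)
  have 1: "continuous_map (gp_top WW) (gp_top TG) (fst \<circ> phi)"
    unfolding gp_top_tail
  proof (rule continuous_on_generated_topo)
    show "(fst \<circ> phi) ` Wc \<subseteq> \<Union> {tail_cyl p q | p q. length p = length q}"
      using phi_in unfolding action_pairs_def gp_top_tail topology_generated_by_topspace by fastforce
    fix B assume "B \<in> {tail_cyl p q | p q. length p = length q}"
    then obtain p q where pq: "B = tail_cyl p q" "length p = length q" by blast
    have "(fst \<circ> phi) -` B \<inter> Wc = {g \<in> Wc. phi g \<in> B \<times> Yc}"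
    proof -
      have "snd (phi g) \<in> Yc" if "g \<in> Wc" for g
        using phi_in[OF that] unfolding action_pairs_def by (auto)
      then show ?thesis by (auto simp: mem_Times_iff)
    qed
    then show "openin (gp_top WW) ((fst \<circ> phi) -` B \<inter> Wc)"
      unfolding phi_preimage pq(1) using openin_psi_cyl[OF pq(2) openin_topspace] by (simp only:)
  qed
  have 2: "continuous_map (gp_top WW) Y (snd \<circ> phi)"
    unfolding continuous_map_def
  proof (intro conjI allI impI)
    show "snd \<circ> phi \<in> Wc \<rightarrow> Yc"
      using phi_in unfolding action_pairs_def by (fastforce)
    fix B assume B: "openin Y B"
    \<comment> \<open>A condition on the second component leaves the arrow free, hence the union
      over all basic sets of arrows.\<close>
    let ?U = "(\<Union>(p, q)\<in>{(p, q). length p = length q}. psi ` ((tail_cyl p q \<times> B) \<inter> AP))" and ?G = "{g \<in> Wc. (snd \<circ> phi) g \<in> B}"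
    have eq: "?G = ?U"
    proof (intro set_eqI iffI)
      fix g assume g: "g \<in> ?G"
      then have gW: "g \<in> Wc" by simp
      from phi_in[OF gW] obtain t s y p q where z: "phi g = ((t, s), y)" "y \<in> Yc" "fst y = s" "length p = length q" "(t, s) \<in> tail_cyl p q"
        by (rule AP_cases)
      have "phi g \<in> (tail_cyl p q \<times> B) \<inter> AP" using g z phi_in[OF gW] by simp
      then have "g \<in> psi ` ((tail_cyl p q \<times> B) \<inter> AP)" using psi_phi[OF gW] by (metis image_eqI)
      then show "g \<in> ?U" using z(4) by blast
    next
      fix g assume "g \<in> ?U"
      then obtain z where z: "g = psi z" "z \<in> AP" "snd z \<in> B" by auto
      show "g \<in> ?G"
        using z phi_psi[OF z(2)] psi_image by auto
    qed
    show "openin (gp_top WW) ?G"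
      unfolding eq by (intro openin_Union) (use openin_psi_cyl B in auto)
  qed
  show "continuous_map (gp_top WW) (prod_topology (gp_top TG) Y) phi"
    by (rule continuous_map_pairwise[THEN iffD2, OF conjI[OF 1 2]])
  show "phi \<in> Wc \<rightarrow> AP" using phi_in by blast
qed

lemma phi_homeomorphic: "homeomorphic_map (gp_top WW) TT phi"
proof -
  have "homeomorphic_maps (gp_top WW) TT phi psi"
    unfolding homeomorphic_maps_def topspace_TT using phi_cont psi_cont phi_psi psi_phi by blast
  then show ?thesis unfolding homeomorphic_map_maps by blast
qed

section \<open>Compatibility with range, source and product\<close>

abbreviation "TR \<equiv> transformation_groupoid TG Y transported_anchor act"

lemma TR_simps [simp]:
  "gp_top TR = TT" "gp_rng TR (\<gamma>, y) = (gp_rng TG \<gamma>, act \<gamma> y)" "gp_src TR (\<gamma>, y) = (gp_src TG \<gamma>, y)"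
  "gp_mult TR (\<eta>, z) (\<gamma>, y) = (gp_mult TG \<eta> \<gamma>, y)"
  by (simp_all add: transformation_groupoid_def)

text \<open>The exchange of empty prefixes is the identity on the spectrum, which yields the unit
  germs.\<close>

lemma psi_unit:
  assumes "y \<in> Yc" "fst y = t"
  shows "psi ((t, t), y) = germ SS id (chi (kap y))" "((t, t), y) \<in> AP"
proof -
  have cyl: "(t, t) \<in> tail_cyl [] []" by (simp add: tail_cyl_def prefix_of_def)
  have "mu [] [] \<omega> = id \<omega>" if w: "\<omega> \<in> topspace SS" for \<omega>
  proof -
    obtain z where z: "\<omega> = chi z" "z \<in> Yc" using w unfolding topspace_spectrum by blast
    show ?thesis unfolding z(1) using weyl_munit(2)[of "[]" "[]" z] z(2) by (simp add: prefix_of_def theta_Nil)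
  qed
  then have "germ SS (mu [] []) (chi (kap y)) = germ SS id (chi (kap y))"
    by (intro germ_eqI[OF openin_topspace chi_in_SS[OF kap_in[OF assms(1)]]])
  then show "psi ((t, t), y) = germ SS id (chi (kap y))" using psi_eq[OF cyl refl assms] by simp
  show "((t, t), y) \<in> AP" by (rule tail_cyl_AP[OF cyl assms])
qed

lemma psi_rng_src:
  assumes "z \<in> AP"
  shows "psi (gp_rng TR z) = gp_rng WW (psi z)" "psi (gp_src TR z) = gp_src WW (psi z)"
    "gp_rng TR z \<in> AP" "gp_src TR z \<in> AP"
proof -
  obtain t s y p q where z: "z = ((t, s), y)" "y \<in> Yc" "fst y = s" "length p = length q" "(t, s) \<in> tail_cyl p q"
    using assms by (rule AP_cases)
  note a = act_in[OF assms[unfolded z(1)]]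
  have psi: "psi z = germ SS (mu p q) (chi (kap y))" unfolding z(1) by (rule psi_eq[OF z(5,4,2,3)])
  have "germ_rep (psi z) (chi (kap y)) = chi (kap (act (t, s) y))"
    unfolding psi germ_rep_value[OF chi_in_SS[OF kap_in[OF z(2)]]] mu_kap[OF z(5,4,2,3)] transported_action_eq[OF z(5,4,2,3)] ..
  then show "psi (gp_rng TR z) = gp_rng WW (psi z)"
    unfolding weyl_simps psi fst_germ unfolding z(1) TR_simps tail_groupoid_simps psi_unit(1)[OF a] by simp
  show "psi (gp_src TR z) = gp_src WW (psi z)"
    unfolding weyl_simps psi fst_germ unfolding z(1) TR_simps tail_groupoid_simps psi_unit(1)[OF z(2,3)] ..
  show "gp_rng TR z \<in> AP" "gp_src TR z \<in> AP"
    unfolding z(1) TR_simps tail_groupoid_simps by (rule psi_unit(2)[OF a] psi_unit(2)[OF z(2,3)])+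
qed

text \<open>With all three arrows cut at one length, two successive exchanges of prefixes make a
  single one. The product of germs involves chosen representatives, so the identity is checked on a
  neighbourhood where these are the maps of matrix units.\<close>

lemma psi_mult:
  assumes z: "z \<in> AP" and w: "w \<in> AP" and comp: "gp_src TR z = gp_rng TR w"
  shows "psi (gp_mult TR z w) = gp_mult WW (psi z) (psi w)" "gp_mult TR z w \<in> AP"
proof -
  obtain r t x where z': "z = ((r, t), x)" by (metis prod.exhaust)
  obtain t' s y where w': "w = ((t', s), y)" by (metis prod.exhaust)
  have t': "t' = t" and x: "x = act (t, s) y" using comp unfolding z' w' by auto
  have y: "y \<in> Yc" "fst y = s" and xY: "x \<in> Yc" "fst x = t"
    using z w unfolding z' w' by (auto simp: AP_iff)
  obtain n where n: "(r, t) \<in> tail_cyl (prefix_of n r) (prefix_of n t)" "(t, s) \<in> tail_cyl (prefix_of n t) (prefix_of n s)"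
    "(r, s) \<in> tail_cyl (prefix_of n r) (prefix_of n s)"
    using tail_common[of r t s] z w unfolding z' w' t' AP_iff by metis
  let ?p = "prefix_of n r" and ?q = "prefix_of n t" and ?o = "prefix_of n s"
  have l: "length ?p = length ?q" "length ?q = length ?o" "length ?p = length ?o" by simp_all
  have m: "gp_mult TR z w = ((r, s), y)" unfolding z' w' by simp
  show "gp_mult TR z w \<in> AP" unfolding m by (rule tail_cyl_AP[OF n(3) y])
  let ?c = "chi (kap y)"
  have cS: "?c \<in> topspace SS" "chi (kap x) \<in> topspace SS" by (rule chi_in_SS[OF kap_in[OF y(1)]] chi_in_SS[OF kap_in[OF xY(1)]])+
  have pz: "psi z = germ SS (mu ?p ?q) (chi (kap x))" unfolding z' by (rule psi_eq[OF n(1) l(1) xY])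
  have pw: "psi w = germ SS (mu ?q ?o) ?c" unfolding w' t' by (rule psi_eq[OF n(2) l(2) y])
  obtain U1 where U1: "openin SS U1" "chi (kap x) \<in> U1" "\<And>\<omega>. \<omega> \<in> U1 \<Longrightarrow> germ_rep (psi z) \<omega> = mu ?p ?q \<omega>"
    unfolding pz by (rule germ_rep_agree[OF cS(2), of "mu ?p ?q"]) blast
  obtain U2 where U2: "openin SS U2" "?c \<in> U2" "\<And>\<omega>. \<omega> \<in> U2 \<Longrightarrow> germ_rep (psi w) \<omega> = mu ?q ?o \<omega>"
    unfolding pw by (rule germ_rep_agree[OF cS(1), of "mu ?q ?o"]) blast
  \<comment> \<open>The three conditions put the point in the cylinder of \<open>?o\<close>, make
    the representative of \<open>psi w\<close> the expected map there, and do the same for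
    \<open>psi z\<close> at the image point.\<close>
  define V where "V = {v \<in> Yc. pre (length ?o) v = ?o} \<inter> {v \<in> Yc. chi v \<in> U2} \<inter>
    {v \<in> Yc. (chi \<circ> theta ?q ?o) v \<in> U1}"
  have V: "openin Y V" unfolding V_def
    by (intro openin_Int openin_prefix openin_continuous_map_preimage[OF chi_cont U2(1)]
        openin_continuous_map_preimage[OF continuous_map_compose[OF theta_cont chi_cont] U1(1)])
  have "kap x = theta ?q ?o (kap y)"
    unfolding x transported_action_eq[OF n(2) l(2) y] tau_def by (rule kap_kapi[OF theta_in[OF kap_in[OF y(1)]]])
  then have yV: "kap y \<in> V" using U1(2) U2(2) y kap_in[OF y(1)] by (simp add: V_def)
  have "germ SS (germ_rep (psi z) \<circ> germ_rep (psi w)) ?c = germ SS (mu ?p ?o) ?c"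
  proof (rule germ_eqI[OF openin_chi_image[OF V] imageI[OF yV]])
    fix \<omega> assume "\<omega> \<in> chi ` V"
    then obtain v where v: "\<omega> = chi v" "v \<in> V" by blast
    have v': "v \<in> Yc" "pre (length ?o) v = ?o" "chi v \<in> U2" "chi (theta ?q ?o v) \<in> U1"
      using v(2) by (simp_all add: V_def)
    have th: "pre (length ?q) (theta ?q ?o v) = ?q"
      using prefix_theta[of ?q "length ?q" ?o v] by simp
    have "germ_rep (psi w) \<omega> = chi (theta ?q ?o v)"
      unfolding v(1) U2(3)[OF v'(3)] by (rule weyl_munit(2)[OF l(2) v'(1,2)])
    then have "(germ_rep (psi z) \<circ> germ_rep (psi w)) \<omega> = mu ?p ?q (chi (theta ?q ?o v))"
      by (simp add: U1(3)[OF v'(4)])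
    also have "\<dots> = chi (theta ?p ?q (theta ?q ?o v))" by (rule weyl_munit(2)[OF l(1) theta_in[OF v'(1)] th])
    also have "\<dots> = chi (theta ?p ?o v)" by (simp only: theta_comp[OF l(1) v'(1)])
    also have "\<dots> = mu ?p ?o \<omega>" unfolding v(1) by (rule weyl_munit(2)[OF l(3) v'(1,2), symmetric])
    finally show "(germ_rep (psi z) \<circ> germ_rep (psi w)) \<omega> = mu ?p ?o \<omega>" .
  qed
  then show "psi (gp_mult TR z w) = gp_mult WW (psi z) (psi w)"
    unfolding m psi_eq[OF n(3) l(3) y] weyl_simps pw fst_germ by simp
qed

text \<open>The identities are proved for \<open>psi\<close>, which has a formula; applying
  \<open>phi\<close> to both sides transfers them.\<close>

lemma weyl_iso: "top_groupoid_iso WW TR phi"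
  unfolding top_groupoid_iso_def
proof (intro conjI ballI impI)
  show "homeomorphic_map (gp_top WW) (gp_top TR) phi" by (simp only: TR_simps phi_homeomorphic)
  fix g assume g: "g \<in> Wc"
  note z = phi_in[OF g] and gz = psi_phi[OF g]
  show r: "phi (gp_rng WW g) = gp_rng TR (phi g)"
    using psi_rng_src(1)[OF z] phi_psi[OF psi_rng_src(3)[OF z]] unfolding gz by simp
  show s: "phi (gp_src WW g) = gp_src TR (phi g)"
    using psi_rng_src(2)[OF z] phi_psi[OF psi_rng_src(4)[OF z]] unfolding gz by simp
  fix h assume h: "h \<in> Wc" and comp: "gp_src WW g = gp_rng WW h"
  note w = phi_in[OF h] and hw = psi_phi[OF h]
  have "phi (gp_rng WW h) = gp_rng TR (phi h)"
    using psi_rng_src(1)[OF w] phi_psi[OF psi_rng_src(3)[OF w]] unfolding hw by simp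
  then have "gp_src TR (phi g) = gp_rng TR (phi h)" using s comp by simp
  from psi_mult[OF z w this] show "phi (gp_mult WW g h) = gp_mult TR (phi g) (phi h)"
    unfolding gz hw using phi_psi by metis
qed

end

theorem proposition5p2:
  fixes X :: "'x topology" and \<sigma> :: "'x \<Rightarrow> 'x"
  assumes "compact_space X" and "Hausdorff_space X" and "homeomorphic_map X X \<sigma>"
  shows "homeomorphic_map (proj_limit X \<sigma>) (prod_topology cantor X) b_map \<and>
    groupoid_action tail_groupoid (prod_topology cantor X) transported_anchor
      (transported_action X \<sigma>) \<and>
    top_groupoids_isomorphic
      (weyl_groupoid (AH_algebra X \<sigma>) (AH_diagonal X \<sigma>))
      (transformation_groupoid tail_groupoid (prod_topology cantor X) transported_anchor
        (transported_action X \<sigma>))"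
proof -
  obtain \<sigma>i where "homeomorphic_maps X X \<sigma> \<sigma>i" using assms(3) unfolding homeomorphic_map_maps by blast
  then interpret dynamical_system X \<sigma> \<sigma>i using assms by unfold_locales
  show ?thesis
    unfolding AH_algebra_eq top_groupoids_isomorphic_def
    using b_map_homeomorphic action weyl_iso by blast
qed

end
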